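(* Let $G$ be a (finite simple) chordal graph with vertex set $V$, let $K$ be a field, let $S=K[V]$, and let $I(G)\subset S$ be the edge ideal of $G$. Then $$\operatorname{pd} S/I(G)=d_G=d_G'.$$
   Context: For a finite simple graph $G$ with vertex set $V=V(G)$ and edge set $E(G)$ and a field $K$, $S=K[V]=K[x:x\in V]$ is the polynomial ring with each variable of degree $1$, and the edge ideal $I(G)\subset S$ is the ideal generated by all products $xy$ with $\{x,y\}\in E(G)$. $\operatorname{pd} S/I(G)$ is the projective dimension of $S/I(G)$ over $S$, i.e. the length of its minimal graded free resolution. A graph is chordal if each of its cycles of length more than $3$ has a chord. Distance of edges: for distinct edges $e,e'$ of $G$, $\operatorname{dist}_G(e,e')$ is the minimum $\ell$ such that there is a sequence of edges $e_0=e,e_1,\dots,e_\ell=e'$ of $G$ with $e_{k-1}\cap e_k\neq\emptyset$ for all $k$ (and $\infty$ if there is no such sequence). A set of edges is pairwise $3$-disjoint in $G$ if any two distinct edges $e,e'$ of it satisfy $\operatorname{dist}_G(e,e')\ge 3$. Bouquets: a bouquet is a graph $B$ with $V(B)=\{w,z_1,\dots,z_d\}$ and $E(B)=\{\{w,z_k\}:k=1,\dots,d\}$, $d\ge 1$, with designated root $w$; the $z_k$ are its flowers and the edges $\{w,z_k\}$ its stems. A bouquet of $G$ is a bouquet that is a (not necessarily induced) subgraph of $G$. For a set $\mathcal B$ of bouquets of $G$, $F(\mathcal B)$ and $R(\mathcal B)$ are the sets of vertices that are a flower, respectively a root, of some bouquet in $\mathcal B$. The empty set of bouquets is allowed. A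 set $\mathcal B=\{B_1,\dots,B_j\}$ of bouquets of $G$ is strongly disjoint in $G$ if (1) $V(B_k)\cap V(B_\ell)=\emptyset$ for all $k\ne\ell$, and (2) one can choose a stem $s_k$ from each $B_k$ so that $\{s_1,\dots,s_j\}$ is pairwise $3$-disjoint in $G$. It is semi-strongly disjoint in $G$ if (1) $V(B_k)\cap V(B_\ell)=\emptyset$ for all $k\ne\ell$, and (2) no two vertices belonging to $R(\mathcal B)$ are adjacent in $G$. Define $d_G=\max\{\#F(\mathcal B):\mathcal B\text{ is a strongly disjoint set of bouquets of }G\}$ and $d_G'=\max\{\#F(\mathcal B):\mathcal B\text{ is a semi-strongly disjoint set of bouquets of }G\}$. *)

theory Defs
  imports
    "HOL-Algebra.QuotRing"
    "HOL-Algebra.Module"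
    "HOL-Library.Poly_Mapping"
    "HOL-Library.Extended_Nat"
begin

section \<open>Finite simple graphs\<close>

definition simple_graph :: "'v set \<Rightarrow> 'v set set \<Rightarrow> bool" where
  "simple_graph V E \<longleftrightarrow> finite V \<and> (\<forall>e\<in>E. e \<subseteq> V \<and> card e = 2)"

definition cycle_edges :: "'v list \<Rightarrow> 'v set set" where
  "cycle_edges vs = {{vs ! i, vs ! (Suc i mod length vs)} | i. i < length vs}"

definition is_cycle :: "'v set set \<Rightarrow> 'v list \<Rightarrow> bool" where
  "is_cycle E vs \<longleftrightarrow> 3 \<le> length vs \<and> distinct vs \<and> cycle_edges vs \<subseteq> E"

definition chordal :: "'v set set \<Rightarrow> bool" where
  "chordal E \<longleftrightarrow>
     (\<forall>vs. is_cycle E vs \<and> length vs > 3 \<longrightarrow> (\<exists>e\<in>E. e \<subseteq> set vs \<and> e \<notin> cycle_edges vs))"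

definition edge_chain :: "'v set set \<Rightarrow> 'v set list \<Rightarrow> bool" where
  "edge_chain E es \<longleftrightarrow> es \<noteq> [] \<and> set es \<subseteq> E \<and>
     (\<forall>k. Suc k < length es \<longrightarrow> es ! k \<inter> es ! Suc k \<noteq> {})"

text \<open>If no chain joins the two edges, the infimum is over the empty set and equals \<open>\<infinity>\<close>.\<close>
definition edge_dist :: "'v set set \<Rightarrow> 'v set \<Rightarrow> 'v set \<Rightarrow> enat" where
  "edge_dist E e e' =
     (INF es \<in> {es. edge_chain E es \<and> hd es = e \<and> last es = e'}. enat (length es - 1))"

definition pairwise_3_disjoint :: "'v set set \<Rightarrow> 'v set set \<Rightarrow> bool" where
  "pairwise_3_disjoint E A \<longleftrightarrow> A \<subseteq> E \<and> (\<forall>e\<in>A. \<forall>e'\<in>A. e \<noteq> e' \<longrightarrow> edge_dist E e e' \<ge> 3)"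


section \<open>Bouquets\<close>

text \<open>A bouquet is given by its root and its set of flowers.\<close>
datatype 'v bouquet = Bouquet (bouquet_root: 'v) (flowers: "'v set")

definition bouquet_verts :: "'v bouquet \<Rightarrow> 'v set" where
  "bouquet_verts B = insert (bouquet_root B) (flowers B)"

definition stems :: "'v bouquet \<Rightarrow> 'v set set" where
  "stems B = {{bouquet_root B, z} | z. z \<in> flowers B}"

definition bouquet_of :: "'v set \<Rightarrow> 'v set set \<Rightarrow> 'v bouquet \<Rightarrow> bool" where
  "bouquet_of V E B \<longleftrightarrow>
     finite (flowers B) \<and> flowers B \<noteq> {} \<and> bouquet_root B \<notin> flowers B \<and>
     bouquet_verts B \<subseteq> V \<and> stems B \<subseteq> E"

definition all_flowers :: "'v bouquet set \<Rightarrow> 'v set" where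
  "all_flowers \<B> = (\<Union>B\<in>\<B>. flowers B)"

definition all_roots :: "'v bouquet set \<Rightarrow> 'v set" where
  "all_roots \<B> = bouquet_root ` \<B>"

definition strongly_disjoint :: "'v set \<Rightarrow> 'v set set \<Rightarrow> 'v bouquet set \<Rightarrow> bool" where
  "strongly_disjoint V E \<B> \<longleftrightarrow>
     (\<forall>B\<in>\<B>. bouquet_of V E B) \<and>
     (\<forall>B\<in>\<B>. \<forall>B'\<in>\<B>. B \<noteq> B' \<longrightarrow> bouquet_verts B \<inter> bouquet_verts B' = {}) \<and>
     (\<exists>s. (\<forall>B\<in>\<B>. s B \<in> stems B) \<and> pairwise_3_disjoint E (s ` \<B>))"

definition semi_strongly_disjoint :: "'v set \<Rightarrow> 'v set set \<Rightarrow> 'v bouquet set \<Rightarrow> bool" where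
  "semi_strongly_disjoint V E \<B> \<longleftrightarrow>
     (\<forall>B\<in>\<B>. bouquet_of V E B) \<and>
     (\<forall>B\<in>\<B>. \<forall>B'\<in>\<B>. B \<noteq> B' \<longrightarrow> bouquet_verts B \<inter> bouquet_verts B' = {}) \<and>
     (\<forall>u\<in>all_roots \<B>. \<forall>v\<in>all_roots \<B>. {u, v} \<notin> E)"

definition d_strong :: "'v set \<Rightarrow> 'v set set \<Rightarrow> nat" where
  "d_strong V E = Max {card (all_flowers \<B>) | \<B>. strongly_disjoint V E \<B>}"

definition d_semi_strong :: "'v set \<Rightarrow> 'v set set \<Rightarrow> nat" where
  "d_semi_strong V E = Max {card (all_flowers \<B>) | \<B>. semi_strongly_disjoint V E \<B>}"


section \<open>Polynomial rings and edge ideals\<close>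

text \<open>
  A polynomial maps each monomial, i.e. each finitely supported exponent vector
  \<open>'v \<Rightarrow>\<^sub>0 nat\<close>, to its coefficient. The argument of type \<open>'k itself\<close> names the
  coefficient field.
\<close>
type_synonym ('v, 'k) mpoly = "('v \<Rightarrow>\<^sub>0 nat) \<Rightarrow>\<^sub>0 'k"

definition var :: "'v \<Rightarrow> ('v, 'k::field) mpoly" where
  "var x = Poly_Mapping.single (Poly_Mapping.single x 1) 1"

definition poly_ring :: "'k::field itself \<Rightarrow> 'v set \<Rightarrow> ('v, 'k) mpoly ring" where
  "poly_ring K V = \<lparr>carrier = {p. \<forall>m\<in>Poly_Mapping.keys p. Poly_Mapping.keys m \<subseteq> V},
     mult = (*), one = 1, zero = 0, add = (+)\<rparr>"

definition mon_degree :: "('v \<Rightarrow>\<^sub>0 nat) \<Rightarrow> nat" where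
  "mon_degree m = (\<Sum>x\<in>Poly_Mapping.keys m. Poly_Mapping.lookup m x)"

text \<open>The homogeneous component of degree \<open>t\<close>; it is zero for \<open>t < 0\<close>.\<close>
definition homogeneous_part :: "'k::field itself \<Rightarrow> 'v set \<Rightarrow> int \<Rightarrow> ('v, 'k) mpoly set" where
  "homogeneous_part K V t =
     {p \<in> carrier (poly_ring K V). \<forall>m\<in>Poly_Mapping.keys p. int (mon_degree m) = t}"

definition irrelevant_ideal :: "'k::field itself \<Rightarrow> 'v set \<Rightarrow> ('v, 'k) mpoly set" where
  "irrelevant_ideal K V = Idl\<^bsub>poly_ring K V\<^esub> (var ` V)"

definition edge_ideal :: "'k::field itself \<Rightarrow> 'v set \<Rightarrow> 'v set set \<Rightarrow> ('v, 'k) mpoly set" where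
  "edge_ideal K V E = Idl\<^bsub>poly_ring K V\<^esub> {var x * var y | x y. {x, y} \<in> E}"


section \<open>Graded modules over polynomial rings\<close>

text \<open>
  The fields \<^const>\<open>mult\<close> and \<^const>\<open>one\<close> of the two module records below come from the record type
  and are irrelevant to the module structure.
\<close>
definition quotient_module :: "('a, 'b) ring_scheme \<Rightarrow> 'a set \<Rightarrow> ('a, 'a set) module" where
  "quotient_module R I = \<lparr>carrier = carrier (R Quot I),
     mult = mult (R Quot I), one = one (R Quot I),
     zero = zero (R Quot I), add = add (R Quot I),
     smult = (\<lambda>r X. (I +>\<^bsub>R\<^esub> r) \<otimes>\<^bsub>R Quot I\<^esub> X)\<rparr>"

definition quotient_grading ::
  "'k::field itself \<Rightarrow> 'v set \<Rightarrow> ('v, 'k) mpoly set \<Rightarrow> int \<Rightarrow> ('v, 'k) mpoly set set" where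
  "quotient_grading K V I t = (\<lambda>p. I +>\<^bsub>poly_ring K V\<^esub> p) ` homogeneous_part K V t"

definition free_module :: "('a, 'b) ring_scheme \<Rightarrow> nat \<Rightarrow> ('a, nat \<Rightarrow> 'a) module" where
  "free_module R n = \<lparr>carrier = {..<n} \<rightarrow>\<^sub>E carrier R,
     mult = undefined, one = undefined,
     zero = (\<lambda>j\<in>{..<n}. \<zero>\<^bsub>R\<^esub>),
     add = (\<lambda>u v. \<lambda>j\<in>{..<n}. u j \<oplus>\<^bsub>R\<^esub> v j),
     smult = (\<lambda>r u. \<lambda>j\<in>{..<n}. r \<otimes>\<^bsub>R\<^esub> u j)\<rparr>"

text \<open>The grading of \<open>S(-a 0) \<oplus> \<dots> \<oplus> S(-a (n - 1))\<close>: the \<open>j\<close>-th basis element has degree \<open>a j\<close>.\<close>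
definition free_grading ::
  "'k::field itself \<Rightarrow> 'v set \<Rightarrow> nat \<Rightarrow> (nat \<Rightarrow> int) \<Rightarrow> int \<Rightarrow> (nat \<Rightarrow> ('v, 'k) mpoly) set" where
  "free_grading K V n a t = (\<Pi>\<^sub>E j\<in>{..<n}. homogeneous_part K V (t - a j))"

definition mod_hom ::
  "('a, 'r) ring_scheme \<Rightarrow> ('a, 'b, 'm) module_scheme \<Rightarrow> ('a, 'c, 'n) module_scheme \<Rightarrow> ('b \<Rightarrow> 'c) set"
where
  "mod_hom R M N = {f \<in> carrier M \<rightarrow> carrier N.
     (\<forall>x\<in>carrier M. \<forall>y\<in>carrier M. f (x \<oplus>\<^bsub>M\<^esub> y) = f x \<oplus>\<^bsub>N\<^esub> f y) \<and>
     (\<forall>r\<in>carrier R. \<forall>x\<in>carrier M. f (r \<odot>\<^bsub>M\<^esub> x) = r \<odot>\<^bsub>N\<^esub> f x)}"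


section \<open>Minimal graded free resolutions and projective dimension\<close>

text \<open>
  \<open>\<dots> \<rightarrow> F\<^sub>2 \<rightarrow> F\<^sub>1 \<rightarrow> F\<^sub>0 \<rightarrow> M \<rightarrow> 0\<close>, where \<open>M\<close> is graded by \<open>gr\<close>, \<open>F\<^sub>i\<close> is free of rank \<open>b i\<close> with
  basis degrees \<open>a i 0, \<dots>, a i (b i - 1)\<close>, \<open>\<epsilon>\<close> is the map \<open>F\<^sub>0 \<rightarrow> M\<close>, and \<open>d i\<close> is the
  differential \<open>F\<^sub>i \<rightarrow> F\<^sub>i\<^sub>-\<^sub>1\<close> for \<open>i \<ge> 1\<close> (\<open>d 0\<close> is not used). All maps are homogeneous
  of degree \<open>0\<close>.
\<close>
definition graded_free_resolution ::
  "'k::field itself \<Rightarrow> 'v set \<Rightarrow> (('v, 'k) mpoly, 'b, 'm) module_scheme \<Rightarrow> (int \<Rightarrow> 'b set) \<Rightarrow>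
   (nat \<Rightarrow> nat) \<Rightarrow> (nat \<Rightarrow> nat \<Rightarrow> int) \<Rightarrow>
   (nat \<Rightarrow> (nat \<Rightarrow> ('v, 'k) mpoly) \<Rightarrow> (nat \<Rightarrow> ('v, 'k) mpoly)) \<Rightarrow>
   ((nat \<Rightarrow> ('v, 'k) mpoly) \<Rightarrow> 'b) \<Rightarrow> bool" where
  "graded_free_resolution K V M gr b a d \<epsilon> \<longleftrightarrow>
     (let S = poly_ring K V; F = (\<lambda>i. free_module S (b i)) in
       \<epsilon> \<in> mod_hom S (F 0) M \<and>
       (\<forall>i. d (Suc i) \<in> mod_hom S (F (Suc i)) (F i)) \<and>
       (\<forall>t. \<epsilon> ` free_grading K V (b 0) (a 0) t \<subseteq> gr t) \<and>
       (\<forall>i t. d (Suc i) ` free_grading K V (b (Suc i)) (a (Suc i)) t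
                \<subseteq> free_grading K V (b i) (a i) t) \<and>
       \<epsilon> ` carrier (F 0) = carrier M \<and>
       a_kernel (F 0) M \<epsilon> = d 1 ` carrier (F 1) \<and>
       (\<forall>i. a_kernel (F (Suc i)) (F i) (d (Suc i)) = d (Suc (Suc i)) ` carrier (F (Suc (Suc i)))))"

text \<open>Minimality: \<open>d\<^sub>i\<^sub>+\<^sub>1 F\<^sub>i\<^sub>+\<^sub>1 \<subseteq> \<mm> F\<^sub>i\<close> with \<open>\<mm>\<close> the irrelevant ideal.\<close>
definition minimal_graded_free_resolution ::
  "'k::field itself \<Rightarrow> 'v set \<Rightarrow> (('v, 'k) mpoly, 'b, 'm) module_scheme \<Rightarrow> (int \<Rightarrow> 'b set) \<Rightarrow>
   (nat \<Rightarrow> nat) \<Rightarrow> (nat \<Rightarrow> nat \<Rightarrow> int) \<Rightarrow>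
   (nat \<Rightarrow> (nat \<Rightarrow> ('v, 'k) mpoly) \<Rightarrow> (nat \<Rightarrow> ('v, 'k) mpoly)) \<Rightarrow>
   ((nat \<Rightarrow> ('v, 'k) mpoly) \<Rightarrow> 'b) \<Rightarrow> bool" where
  "minimal_graded_free_resolution K V M gr b a d \<epsilon> \<longleftrightarrow>
     graded_free_resolution K V M gr b a d \<epsilon> \<and>
     (\<forall>i. d (Suc i) ` carrier (free_module (poly_ring K V) (b (Suc i)))
            \<subseteq> ({..<b i} \<rightarrow>\<^sub>E irrelevant_ideal K V))"

definition resolution_length :: "(nat \<Rightarrow> nat) \<Rightarrow> enat" where
  "resolution_length b = (SUP i \<in> {i. b i \<noteq> 0}. enat i)"

text \<open>
  The length of the minimal graded free resolution of a finitely generated graded module, which is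
  unique up to isomorphism. (For the zero module this gives \<open>0\<close> instead of \<open>-\<infinity>\<close>.)
\<close>
definition projective_dimension ::
  "'k::field itself \<Rightarrow> 'v set \<Rightarrow> (('v, 'k) mpoly, 'b, 'm) module_scheme \<Rightarrow> (int \<Rightarrow> 'b set) \<Rightarrow> enat"
where
  "projective_dimension K V M gr =
     (THE l. \<exists>b a d \<epsilon>. minimal_graded_free_resolution K V M gr b a d \<epsilon> \<and> l = resolution_length b)"

definition pd_edge_ring :: "'k::field itself \<Rightarrow> 'v set \<Rightarrow> 'v set set \<Rightarrow> enat" where
  "pd_edge_ring K V E =
     (let I = edge_ideal K V E in
       projective_dimension K V (quotient_module (poly_ring K V) I) (quotient_grading K V I))"

end

theory Submission
  imports Defs "HOL-Library.Function_Algebras"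
begin

text \<open>
  Upper bound: a chordal graph has a perfect elimination ordering. Let \<open>v\<close> be its first non-isolated
  vertex, \<open>e = {u, v}\<close> an edge and \<open>J = I(G - e)\<close>. Since \<open>N(v) \<subseteq> N[u]\<close>, the ideal \<open>J : e\<close> is generated by
  the variables in \<open>N(u) - v\<close> and by \<open>I(G - N[u])\<close>. Hence \<open>pd S/I(G)\<close> is at most the maximum of
  \<open>pd S/I(G - e)\<close> and \<open>deg u + pd S/I(G - N[u])\<close>, while \<open>d\<^sub>G\<close> is at least the maximum of \<open>d\<close> of \<open>G - e\<close>
  and \<open>deg u + d\<close> of \<open>G - N[u]\<close>; so \<open>pd S/I(G) \<le> d\<^sub>G\<close>.

  Lower bound: the flowers of a semi-strongly disjoint set of bouquets lie in a minimal vertex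
  cover \<open>C\<close>, because its roots extend to a maximal independent set \<open>A = V - C\<close>. The product of the
  variables in \<open>A\<close> is a nonzero element of \<open>S/I(G)\<close> killed by the variables in \<open>C\<close>, i.e. a nonzero class in
  the top Koszul homology with respect to \<open>C\<close>, so that \<open>pd S/I(G) \<ge> |C| \<ge> d'\<^sub>G \<ge> d\<^sub>G\<close>.

  Projective dimensions are compared with Koszul homology by shifting along the syzygies of a
  resolution. A minimal resolution exists without appeal to Noetherianity: the syzygies are
  squarefree multigraded modules, hence determined by finitely many finite-dimensional spaces.
\<close>

section \<open>Perfect elimination orderings of chordal graphs\<close>

text \<open>The projective dimension is a definite description over all minimal resolutions, so some
  length must occur and no other may. Instead of comparing two resolutions, both bounds are proved
  for an arbitrary minimal resolution, and existence is shown separately. The bounds use different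
  Koszul complexes. For the upper bound it is taken on all variables: there minimality turns
  vanishing homology in degree \<open>i\<close> into a vanishing \<open>i\<close>-th rank, through
  the constant coefficient of a basis vector. For the lower bound it is taken on \<open>C\<close>
  only, so that \<open>|C|\<close> is the top degree and a nonzero cycle cannot bound; this applies
  to any graded free resolution. Elements of \<open>S/I\<close> are cosets. They are replaced by
  representatives, at the price that the map \<open>F_0 -> S/I\<close> is linear only modulo
  \<open>I\<close>. The number \<open>deg u\<close> in the recursion is 1 for passing to
  \<open>J : e\<close>, plus \<open>deg u - 1\<close> for the variables in \<open>N(u) - v\<close>,
  which occur in no generator of \<open>I(G - N[u])\<close>. On the bouquet side it counts the
  flowers of a new bouquet with root \<open>u\<close>.\<close>

lemma doubleton_cases:
  assumes "card f = 2" "x \<in> f"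
  obtains y where "f = {x, y}" "y \<noteq> x"
  using assms by (metis card_2_iff' insert_absorb insert_iff singletonD card_2_iff doubleton_eq_iff)

lemma chordal_induced:
  assumes "chordal E" shows "chordal {e \<in> E. e \<subseteq> W}"
  unfolding chordal_def
proof (intro allI impI)
  fix vs assume vs: "is_cycle {e \<in> E. e \<subseteq> W} vs \<and> length vs > 3"
  then have "is_cycle E vs" by (auto simp: is_cycle_def)
  then obtain e where e: "e \<in> E" "e \<subseteq> set vs" "e \<notin> cycle_edges vs"
    using assms vs unfolding chordal_def by meson
  have "set vs \<subseteq> W"
  proof
    fix x assume "x \<in> set vs"
    then obtain i where "i < length vs" "x = vs ! i" by (auto simp: in_set_conv_nth)
    then have "{x, vs ! (Suc i mod length vs)} \<in> cycle_edges vs"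
      by (auto simp: cycle_edges_def)
    then show "x \<in> W" using vs by (auto simp: is_cycle_def)
  qed
  with e show "\<exists>e\<in>{e \<in> E. e \<subseteq> W}. e \<subseteq> set vs \<and> e \<notin> cycle_edges vs" by auto
qed

abbreviation walk :: "'v set set \<Rightarrow> 'v list \<Rightarrow> bool" where
  "walk E \<equiv> successively (\<lambda>x y. {x, y} \<in> E)"

lemma walk_of_rtrancl:
  assumes "(h, h') \<in> {(a, b). a \<in> R \<and> b \<in> R \<and> {a, b} \<in> E}\<^sup>*" "h \<in> R"
  shows "\<exists>q. q \<noteq> [] \<and> hd q = h \<and> last q = h' \<and> set q \<subseteq> R \<and> walk E q"
  using assms
proof (induction rule: rtrancl_induct)
  case base
  then show ?case by (intro exI[of _ "[h]"]) auto
next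
  case (step y z)
  then obtain q where "q \<noteq> []" "hd q = h" "last q = y" "set q \<subseteq> R" "walk E q" by auto
  with step.hyps show ?case
    by (intro exI[of _ "q @ [z]"]) (auto simp: successively_append_iff)
qed

lemma split_two_indices:
  assumes "i < j" "j < length q"
  shows "q = take i q @ [q ! i] @ drop (Suc i) (take j q) @ [q ! j] @ drop (Suc j) q"
proof -
  have "take j q = take i (take j q) @ take j q ! i # drop (Suc i) (take j q)"
    using assms by (intro id_take_nth_drop) simp
  then have "take j q = take i q @ q ! i # drop (Suc i) (take j q)"
    using assms by (simp add: min_def)
  moreover have "q = take j q @ q ! j # drop (Suc j) q"
    using assms by (intro id_take_nth_drop)
  ultimately show ?thesis by (metis append.assoc append_Cons append_Nil)
qed

text \<open>A shortest walk from \<open>a\<close> to \<open>b\<close> through non-neighbours of \<open>x\<close> is an induced path, so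
  together with \<open>x\<close> it would form a chordless cycle.\<close>
lemma neighbours_adjacent_if_connected_outside:
  assumes E: "\<forall>e\<in>E. card e = 2" and "chordal E"
    and ab: "{x, a} \<in> E" "{x, b} \<in> E" "a \<noteq> b"
    and R: "\<And>r. r \<in> R \<Longrightarrow> r \<noteq> x \<and> {x, r} \<notin> E"
    and q0: "q0 \<noteq> []" "hd q0 = a" "last q0 = b" "set q0 \<subseteq> R \<union> {a, b}" "walk E q0"
  shows "{a, b} \<in> E"
proof (rule ccontr)
  assume nab: "{a, b} \<notin> E"
  define P where "P q \<longleftrightarrow> q \<noteq> [] \<and> hd q = a \<and> last q = b \<and> set q \<subseteq> R \<union> {a, b} \<and> walk E q" for q
  have "P q0" using q0 by (simp add: P_def)
  then obtain q where q: "P q" and min: "\<And>q'. P q' \<Longrightarrow> length q \<le> length q'"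
    using ex_has_least_nat[of P q0 length] by blast
  have q': "q \<noteq> []" "hd q = a" "last q = b" "set q \<subseteq> R \<union> {a, b}" "walk E q"
    using q by (auto simp: P_def)
  have dist: "distinct q"
  proof (rule ccontr)
    assume "\<not> distinct q"
    then obtain xs y ys zs where d: "q = xs @ [y] @ ys @ [y] @ zs"
      using not_distinct_decomp by blast
    have "walk E (xs @ [y] @ ys @ [y] @ zs)" using q'(5) d by simp
    then have "walk E (xs @ [y])" "walk E (y # zs)"
      by (auto simp: successively_append_iff successively_Cons)
    then have "walk E (xs @ [y] @ zs)"
      by (auto simp: successively_append_iff successively_Cons)
    moreover have "hd (xs @ [y] @ zs) = a"
      using q'(2) by (subst (asm) d) (cases xs; simp)
    moreover have "last (xs @ [y] @ zs) = b"
      using q'(3) by (subst (asm) d) (cases zs; simp)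
    moreover have "set (xs @ [y] @ zs) \<subseteq> R \<union> {a, b}"
      using q'(4) by (subst (asm) d) auto
    ultimately have "P (xs @ [y] @ zs)" unfolding P_def by blast
    from min[OF this] show False by (simp add: d)
  qed
  have shortcut: "j = Suc i" if ij: "i < j" "j < length q" "{q ! i, q ! j} \<in> E" for i j
  proof (rule ccontr)
    assume "j \<noteq> Suc i"
    define ys where "ys = drop (Suc i) (take j q)"
    define xs where "xs = take i q"
    define zs where "zs = drop (Suc j) q"
    have "length ys > 0" using ij \<open>j \<noteq> Suc i\<close> by (simp add: ys_def)
    have d: "q = xs @ [q ! i] @ ys @ [q ! j] @ zs"
      unfolding xs_def ys_def zs_def by (rule split_two_indices) fact+
    have "P (xs @ [q ! i] @ [q ! j] @ zs)"
    proof -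
      have w: "walk E (xs @ [q ! i] @ ys @ [q ! j] @ zs)" using q'(5) by (simp only: d[symmetric])
      then have w1: "walk E (xs @ [q ! i])" "walk E ([q ! j] @ zs)"
        by (auto simp: successively_append_iff successively_Cons)
      have "walk E ((xs @ [q ! i]) @ ([q ! j] @ zs))"
        using w1 ij(3) by (subst successively_append_iff) auto
      then have "walk E (xs @ [q ! i] @ [q ! j] @ zs)" by simp
      moreover have "hd (xs @ [q ! i] @ [q ! j] @ zs) = a"
        using q'(2) by (subst (asm) d) (cases xs; simp)
      moreover have "last (xs @ [q ! i] @ [q ! j] @ zs) = b"
        using q'(3) by (subst (asm) d) (cases zs; simp)
      moreover have "set (xs @ [q ! i] @ [q ! j] @ zs) \<subseteq> R \<union> {a, b}"
        using q'(4) by (subst (asm) d) auto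
      ultimately show ?thesis unfolding P_def by blast
    qed
    from min[OF this] have "length q \<le> length xs + length zs + 2" by simp
    moreover have "length q = length xs + length ys + length zs + 2"
      by (subst d) simp
    ultimately show False using \<open>length ys > 0\<close> by simp
  qed
  have hd: "q ! 0 = a" using q'(1,2) by (simp add: hd_conv_nth)
  have last: "q ! (length q - 1) = b" using q'(1,3) by (simp add: last_conv_nth)
  \<comment> \<open>As \<open>a\<close> and \<open>b\<close> are distinct and not adjacent,
    \<open>q\<close> has an inner vertex, so the cycle \<open>x # q\<close> has length at least 4
    and chordality applies.\<close>
  have len: "length q \<ge> 3"
  proof (rule ccontr)
    assume "\<not> length q \<ge> 3"
    then consider "length q = 1" | "length q = 2"
      using q'(1) by (cases "length q") (auto simp: not_le less_Suc_eq numeral_3_eq_3 numeral_2_eq_2)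
    then show False
    proof cases
      case 1 then show False using hd last ab(3) by simp
    next
      case 2
      then obtain s t where "q = [s, t]" by (auto simp: length_Suc_conv numeral_2_eq_2)
      then show False using q' nab by simp
    qed
  qed
  have adj: "{q ! i, q ! Suc i} \<in> E" if "Suc i < length q" for i
    using q'(5) that by (simp add: successively_conv_nth)
  have xq: "x \<notin> set q"
  proof
    assume "x \<in> set q"
    then have "x \<in> R \<or> x = a \<or> x = b" using q'(4) by auto
    then show False using R[of x] E ab by force
  qed
  let ?vs = "x # q"
  have "is_cycle E ?vs"
    unfolding is_cycle_def
  proof (intro conjI subsetI)
    show "3 \<le> length ?vs" using len by simp
    show "distinct ?vs" using dist xq by simp
    fix e assume "e \<in> cycle_edges ?vs"
    then obtain i where i: "i < length ?vs" "e = {?vs ! i, ?vs ! (Suc i mod length ?vs)}"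
      by (auto simp: cycle_edges_def)
    consider "i = 0" | "i > 0" "i < length q" | "i = length q" using i by force
    then show "e \<in> E"
    proof cases
      case 1
      then show ?thesis using i hd ab q'(1) by simp
    next
      case 2
      then show ?thesis using i adj[of "i - 1"] by simp
    next
      case 3
      have "e = {q ! (length q - 1), x}" using i 3 q'(1) by (simp add: nth_Cons')
      then show ?thesis using last ab by (simp add: insert_commute)
    qed
  qed
  with \<open>chordal E\<close> len obtain e where e: "e \<in> E" "e \<subseteq> set ?vs" "e \<notin> cycle_edges ?vs"
    unfolding chordal_def by fastforce
  \<comment> \<open>A chord at \<open>x\<close> would have to end in \<open>a\<close> or
    \<open>b\<close>, since all other vertices of \<open>q\<close> are non-neighbours of
    \<open>x\<close>; a chord between two vertices of \<open>q\<close> is excluded by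
    \<open>shortcut\<close>.\<close>
  show False
  proof (cases "x \<in> e")
    case True
    then obtain t where t: "e = {x, t}" "t \<noteq> x"
      using E e(1) by (meson doubleton_cases)
    then have "t \<in> R \<union> {a, b}" using e(2) q'(4) by auto
    with t e(1) R have "t = a \<or> t = b" by auto
    then show False
    proof
      assume "t = a"
      then have "e = {?vs ! 0, ?vs ! (Suc 0 mod length ?vs)}" using t hd q'(1) by simp
      then show False using e(3) unfolding cycle_edges_def by blast
    next
      assume "t = b"
      then have "e = {?vs ! length q, ?vs ! (Suc (length q) mod length ?vs)}"
        using t last q'(1) by (auto simp: nth_Cons')
      then show False using e(3) unfolding cycle_edges_def by fastforce
    qed
  next
    case False
    obtain s t where st: "e = {s, t}" "s \<noteq> t"
      using E e(1) by (meson card_2_iff)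
    then have "s \<in> set q" "t \<in> set q" using e(2) False by auto
    then obtain i j where ij: "i < length q" "j < length q" "e = {q ! i, q ! j}" "i < j"
      using st unfolding in_set_conv_nth by (metis insert_commute linorder_neq_iff)
    then have "j = Suc i" using shortcut e(1) by simp
    then have "e = {?vs ! Suc i, ?vs ! (Suc (Suc i) mod length ?vs)}" using ij by simp
    then show False using e(3) ij unfolding cycle_edges_def by fastforce
  qed
qed

definition simplicial :: "'v set set \<Rightarrow> 'v \<Rightarrow> bool" where
  "simplicial E z \<longleftrightarrow> (\<forall>a b. {z, a} \<in> E \<longrightarrow> {z, b} \<in> E \<longrightarrow> a \<noteq> b \<longrightarrow> {a, b} \<in> E)"

text \<open>Dirac's theorem. Asking for a simplicial vertex outside the closed neighbourhood of a given
  vertex is what makes the induction go through: it is applied to a component of the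
  non-neighbours of \<open>x\<close> together with the clique of its neighbours.\<close>
lemma exists_simplicial_nonneighbour:
  assumes "simple_graph V E" "chordal E" "x \<in> V" "y \<in> V" "y \<noteq> x" "{x, y} \<notin> E"
  shows "\<exists>z\<in>V. z \<noteq> x \<and> {x, z} \<notin> E \<and> simplicial E z"
  using assms
proof (induction "card V" arbitrary: V E x y rule: less_induct)
  case less
  have E2: "\<forall>e\<in>E. card e = 2" and fin: "finite V" and EV: "\<And>e. e \<in> E \<Longrightarrow> e \<subseteq> V"
    using less.prems(1) by (auto simp: simple_graph_def)
  have noloop: "{a} \<notin> E" for a using E2 by force
  define R where "R = {r \<in> V. r \<noteq> x \<and> {x, r} \<notin> E}"
  define rel where "rel = {(a, b). a \<in> R \<and> b \<in> R \<and> {a, b} \<in> E}"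
  \<comment> \<open>\<open>H\<close> is the component of \<open>y\<close> among the non-neighbours
    of \<open>x\<close>; \<open>N\<close> consists of the neighbours of \<open>x\<close> that touch
    \<open>H\<close>.\<close>
  define H where "H = rel\<^sup>* `` {y}"
  define N where "N = {a. {x, a} \<in> E \<and> (\<exists>h\<in>H. {a, h} \<in> E)}"
  have yR: "y \<in> R" using less.prems by (simp add: R_def)
  have HR: "H \<subseteq> R"
  proof
    fix h assume "h \<in> H"
    then have "(y, h) \<in> rel\<^sup>*" by (simp add: H_def)
    then show "h \<in> R" using yR by (induction rule: rtrancl_induct) (auto simp: rel_def)
  qed
  have yH: "y \<in> H" by (simp add: H_def)
  have closed: "w \<in> H \<union> N" if "h \<in> H" "{h, w} \<in> E" for h w
  proof -
    have "w \<in> V" using EV[OF that(2)] by auto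
    have hR: "h \<in> R" using that HR by auto
    show ?thesis
    proof (cases "w \<in> R")
      case True
      then have "(h, w) \<in> rel" using hR that by (simp add: rel_def)
      then show ?thesis using that(1) by (auto simp: H_def intro: rtrancl_into_rtrancl)
    next
      case False
      have "w \<noteq> x" using hR that(2) by (auto simp: R_def insert_commute)
      then have "{x, w} \<in> E" using False \<open>w \<in> V\<close> by (simp add: R_def)
      then show ?thesis using that by (auto simp: N_def insert_commute)
    qed
  qed
  have "sym rel" by (auto simp: rel_def sym_def insert_commute)
  then have symr: "sym (rel\<^sup>*)" by (rule sym_rtrancl)
  have clique: "{a, b} \<in> E" if ab: "a \<in> N" "b \<in> N" "a \<noteq> b" for a b
  proof -
    obtain h h' where h: "h \<in> H" "{a, h} \<in> E" "h' \<in> H" "{b, h'} \<in> E"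
      using ab unfolding N_def by blast
    have "(h, y) \<in> rel\<^sup>*" "(y, h') \<in> rel\<^sup>*"
      using h symr by (auto simp: H_def sym_def)
    then have "(h, h') \<in> rel\<^sup>*" by (rule rtrancl_trans)
    then obtain q where q: "q \<noteq> []" "hd q = h" "last q = h'" "set q \<subseteq> R" "walk E q"
      using walk_of_rtrancl[of h h' R E] h HR unfolding rel_def by blast
    have "{a, hd q} \<in> E" "{last q, b} \<in> E"
      using q h by (simp_all add: insert_commute)
    then have w: "walk E (a # q @ [b])"
      using q by (simp add: successively_append_iff successively_Cons)
    have xab: "{x, a} \<in> E" "{x, b} \<in> E" using ab by (simp_all add: N_def)
    have nR: "\<And>r. r \<in> R \<Longrightarrow> r \<noteq> x \<and> {x, r} \<notin> E" by (simp add: R_def)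
    have sub: "set (a # q @ [b]) \<subseteq> R \<union> {a, b}" using q(4) by auto
    show ?thesis
      by (rule neighbours_adjacent_if_connected_outside[OF E2 less.prems(2) xab ab(3) nR _ _ _ sub w]) auto
  qed
  define V' where "V' = H \<union> N"
  define E' where "E' = {e \<in> E. e \<subseteq> V'}"
  have "V' \<subseteq> V" using HR EV by (fastforce simp: V'_def R_def N_def)
  moreover have "x \<notin> V'" using HR noloop by (auto simp: V'_def R_def N_def)
  ultimately have card: "card V' < card V"
    using fin less.prems(3) by (intro psubset_card_mono) auto
  have sg: "simple_graph V' E'"
    using less.prems(1) finite_subset[OF \<open>V' \<subseteq> V\<close> fin]
    by (auto simp: simple_graph_def E'_def)
  have ch: "chordal E'" unfolding E'_def by (rule chordal_induced) fact
  \<comment> \<open>All neighbours of a vertex of \<open>H\<close> lie in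
    \<open>H \<union> N\<close>, so nothing is lost by passing to the induced subgraph.\<close>
  have lift: "simplicial E z" if "z \<in> H" "simplicial E' z" for z
    unfolding simplicial_def
  proof (intro allI impI)
    fix a b assume "{z, a} \<in> E" "{z, b} \<in> E" "a \<noteq> b"
    with closed[OF that(1)] that(1) have "{z, a} \<in> E'" "{z, b} \<in> E'"
      by (auto simp: E'_def V'_def)
    then have "{a, b} \<in> E'" using that(2) \<open>a \<noteq> b\<close> by (auto simp: simplicial_def)
    then show "{a, b} \<in> E" by (simp add: E'_def)
  qed
  show ?case
  proof (cases "\<exists>w\<in>V'. \<exists>w'\<in>V'. w \<noteq> w' \<and> {w, w'} \<notin> E")
    case False
    have "simplicial E y"
      unfolding simplicial_def using closed[OF yH] False unfolding V'_def by blast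
    then show ?thesis using yR by (auto simp: R_def)
  next
    case True
    define nd where "nd w \<longleftrightarrow> w \<in> V' \<and> (\<exists>w'\<in>V'. w' \<noteq> w \<and> {w, w'} \<notin> E)" for w
    \<comment> \<open>The vertex \<open>w\<close> to be avoided is taken from \<open>N\<close>
      whenever some vertex of \<open>N\<close> has a non-neighbour in \<open>V'\<close>. Then
      \<open>z\<close> cannot lie in \<open>N\<close>: for \<open>w\<close> in \<open>N\<close>
      because \<open>N\<close> is a clique, otherwise because vertices of \<open>N\<close> are
      adjacent to all of \<open>V'\<close>.\<close>
    obtain w where w: "nd w" "(\<exists>w\<in>N. nd w) \<longrightarrow> w \<in> N"
      using True unfolding nd_def by metis
    then obtain w' where w': "w \<in> V'" "w' \<in> V'" "w' \<noteq> w" "{w, w'} \<notin> E"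
      unfolding nd_def by blast
    then have "{w, w'} \<notin> E'" by (simp add: E'_def)
    from less.hyps[OF card sg ch w'(1,2,3) this] obtain z where
      z: "z \<in> V'" "z \<noteq> w" "{w, z} \<notin> E'" "simplicial E' z" by blast
    have wz: "{w, z} \<notin> E" using z w' by (auto simp: E'_def)
    have "z \<notin> N"
    proof
      assume "z \<in> N"
      then have "nd z" using z w' wz unfolding nd_def by (auto simp: insert_commute)
      then have "w \<in> N" using w \<open>z \<in> N\<close> by blast
      then show False using clique[OF _ \<open>z \<in> N\<close>] z wz by auto
    qed
    then have "z \<in> H" using z by (simp add: V'_def)
    then show ?thesis using lift z HR by (auto simp: R_def)
  qed
qed

text \<open>The ordering is a rank function and is constrained on the edges only, so that the same
  \<open>r\<close> can serve for the graphs obtained by deleting edges.\<close>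

definition perfect_elimination :: "'v set set \<Rightarrow> ('v \<Rightarrow> nat) \<Rightarrow> bool" where
  "perfect_elimination E r \<longleftrightarrow> inj_on r (\<Union>E) \<and> (\<forall>v a b. {v, a} \<in> E \<longrightarrow> {v, b} \<in> E \<longrightarrow>
     r v < r a \<longrightarrow> r v < r b \<longrightarrow> a \<noteq> b \<longrightarrow> {a, b} \<in> E)"

text \<open>A simplicial vertex gets rank 0 and the ordering of the remaining vertices is shifted up
  by one. In a complete graph every vertex is simplicial; otherwise Dirac's theorem supplies
  one.\<close>

lemma chordal_perfect_elimination:
  assumes "simple_graph V E" "chordal E"
  shows "\<exists>r. inj_on r V \<and> perfect_elimination E r"
  using assms
proof (induction "card V" arbitrary: V E)
  case 0
  then have "V = {}" "E = {}" by (auto simp: simple_graph_def)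
  then show ?case by (auto simp: perfect_elimination_def)
next
  case (Suc n)
  then obtain x where x: "x \<in> V" by fastforce
  have fin: "finite V" and EV: "\<And>e. e \<in> E \<Longrightarrow> e \<subseteq> V \<and> card e = 2"
    using Suc.prems(1) by (auto simp: simple_graph_def)
  have "\<exists>z\<in>V. simplicial E z"
  proof (cases "\<exists>x\<in>V. \<exists>y\<in>V. y \<noteq> x \<and> {x, y} \<notin> E")
    case True
    then show ?thesis using exists_simplicial_nonneighbour[OF Suc.prems] by metis
  next
    case False
    have "simplicial E x"
      unfolding simplicial_def
    proof (intro allI impI)
      fix a b assume "{x, a} \<in> E" "{x, b} \<in> E" "a \<noteq> b"
      then have "a \<in> V" "b \<in> V" using EV[of "{x, a}"] EV[of "{x, b}"] by auto
      with False \<open>a \<noteq> b\<close> show "{a, b} \<in> E" by metis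
    qed
    then show ?thesis using x by blast
  qed
  then obtain z where z: "z \<in> V" "simplicial E z" by blast
  let ?E = "{e \<in> E. e \<subseteq> V - {z}}"
  have sg: "simple_graph (V - {z}) ?E"
    using Suc.prems(1) by (auto simp: simple_graph_def)
  have n: "n = card (V - {z})" using Suc.hyps(2) z fin by simp
  obtain r where r: "inj_on r (V - {z})" "perfect_elimination ?E r"
    using Suc.hyps(1)[OF n sg chordal_induced[OF Suc.prems(2)]] by (elim exE conjE)
  define r' where "r' x = (if x = z then 0 else Suc (r x))" for x
  have inj: "inj_on r' V"
  proof (rule inj_onI)
    fix a b assume "a \<in> V" "b \<in> V" "r' a = r' b"
    then show "a = b"
      using inj_onD[OF r(1), of a b] by (auto simp: r'_def split: if_splits)
  qed
  have "perfect_elimination E r'"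
    unfolding perfect_elimination_def
  proof (intro conjI allI impI)
    show "inj_on r' (\<Union>E)" by (rule inj_on_subset[OF inj]) (use EV in blast)
    fix v a b
    assume *: "{v, a} \<in> E" "{v, b} \<in> E" "r' v < r' a" "r' v < r' b" "a \<noteq> b"
    show "{a, b} \<in> E"
    proof (cases "v = z")
      case True
      then show ?thesis using * z(2) by (auto simp: simplicial_def)
    next
      case False
      then have nz: "a \<noteq> z" "b \<noteq> z" using * by (auto simp: r'_def split: if_splits)
      then have "{v, a} \<in> ?E" "{v, b} \<in> ?E" using * EV False by auto
      moreover have "r v < r a" "r v < r b" using * nz False by (auto simp: r'_def)
      ultimately have "{a, b} \<in> ?E"
        by (rule r(2)[unfolded perfect_elimination_def, THEN conjunct2, rule_format]) (rule *(5))
      then show ?thesis by simp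
    qed
  qed
  with inj show ?case by blast
qed

section \<open>Strongly disjoint bouquets and the recursion on edges\<close>

text \<open>Distances 0, 1 and 2 correspond to chains of one, two and three edges, so the infimum
  over chains becomes a local condition.\<close>

lemma edge_dist_ge_3_iff:
  assumes "e \<in> E" "e' \<in> E"
  shows "edge_dist E e e' \<ge> 3 \<longleftrightarrow> e \<noteq> e' \<and> e \<inter> e' = {} \<and> (\<forall>f\<in>E. f \<inter> e = {} \<or> f \<inter> e' = {})"
proof
  assume *: "edge_dist E e e' \<ge> 3"
  have ge: "3 \<le> length es - 1" if "edge_chain E es" "hd es = e" "last es = e'" for es
  proof -
    have "edge_dist E e e' \<le> enat (length es - 1)"
      unfolding edge_dist_def using that by (intro INF_lower) auto
    with * have "(3::enat) \<le> enat (length es - 1)" by (rule order_trans)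
    then show ?thesis by (simp add: numeral_eq_enat)
  qed
  have "e \<noteq> e'"
    using ge[of "[e]"] assms by (auto simp: edge_chain_def)
  moreover have "e \<inter> e' = {}"
    using ge[of "[e, e']"] assms by (auto simp: edge_chain_def)
  moreover have "f \<inter> e = {} \<or> f \<inter> e' = {}" if "f \<in> E" for f
    using ge[of "[e, f, e']"] assms that by (auto simp: edge_chain_def less_Suc_eq Int_commute)
  ultimately show "e \<noteq> e' \<and> e \<inter> e' = {} \<and> (\<forall>f\<in>E. f \<inter> e = {} \<or> f \<inter> e' = {})"
    by blast
next
  assume *: "e \<noteq> e' \<and> e \<inter> e' = {} \<and> (\<forall>f\<in>E. f \<inter> e = {} \<or> f \<inter> e' = {})"
  show "edge_dist E e e' \<ge> 3"
    unfolding edge_dist_def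
  proof (rule INF_greatest)
    fix es assume "es \<in> {es. edge_chain E es \<and> hd es = e \<and> last es = e'}"
    then have es: "edge_chain E es" "hd es = e" "last es = e'" by auto
    have "3 \<le> length es - 1"
    proof (rule ccontr)
      assume "\<not> 3 \<le> length es - 1"
      moreover have "es \<noteq> []" using es by (simp add: edge_chain_def)
      ultimately consider a where "es = [a]" | a b where "es = [a, b]" | a b c where "es = [a, b, c]"
        by (cases es; cases "tl es"; cases "tl (tl es)"; cases "tl (tl (tl es))") auto
      then show False
      proof cases
        case 1 then show False using es * by simp
      next
        case 2
        then have "a \<inter> b \<noteq> {}" using es(1) by (auto simp: edge_chain_def)
        then show False using es 2 * by simp
      next
        case 3
        have "es ! k \<inter> es ! Suc k \<noteq> {}" if "Suc k < length es" for k
          using es(1) that by (auto simp: edge_chain_def)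
        from this[of 0] this[of 1] 3 have "a \<inter> b \<noteq> {}" "b \<inter> c \<noteq> {}" by auto
        moreover have "b \<in> E" using es(1) 3 by (auto simp: edge_chain_def)
        ultimately show False using es 3 * by auto
      qed
    qed
    then show "(3::enat) \<le> enat (length es - 1)" by (simp add: numeral_eq_enat)
  qed
qed

lemma stems_subset_verts: "s \<in> stems B \<Longrightarrow> s \<subseteq> bouquet_verts B"
  by (auto simp: stems_def bouquet_verts_def)

text \<open>Disjoint bouquets have distinct stems. Hence the condition on the set of chosen stems
  can be indexed by pairs of bouquets, and the distance disappears from it.\<close>

lemma strongly_disjoint_iff:
  "strongly_disjoint V E \<B> \<longleftrightarrow> (\<forall>B\<in>\<B>. bouquet_of V E B) \<and>
     (\<forall>B\<in>\<B>. \<forall>B'\<in>\<B>. B \<noteq> B' \<longrightarrow> bouquet_verts B \<inter> bouquet_verts B' = {}) \<and>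
     (\<exists>s. (\<forall>B\<in>\<B>. s B \<in> stems B) \<and>
        (\<forall>B\<in>\<B>. \<forall>B'\<in>\<B>. B \<noteq> B' \<longrightarrow> (\<forall>f\<in>E. f \<inter> s B = {} \<or> f \<inter> s B' = {})))"
proof -
  have key: "pairwise_3_disjoint E (s ` \<B>) \<longleftrightarrow>
      (\<forall>B\<in>\<B>. \<forall>B'\<in>\<B>. B \<noteq> B' \<longrightarrow> (\<forall>f\<in>E. f \<inter> s B = {} \<or> f \<inter> s B' = {}))"
    if B: "\<forall>B\<in>\<B>. bouquet_of V E B"
      and disj: "\<forall>B\<in>\<B>. \<forall>B'\<in>\<B>. B \<noteq> B' \<longrightarrow> bouquet_verts B \<inter> bouquet_verts B' = {}"
      and s: "\<forall>B\<in>\<B>. s B \<in> stems B" for s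
  proof -
    have sE: "s B \<in> E" if "B \<in> \<B>" for B
      using B s that by (auto simp: bouquet_of_def)
    have sV: "s B \<subseteq> bouquet_verts B" "s B \<noteq> {}" if "B \<in> \<B>" for B
      using stems_subset_verts[of "s B" B] s that by (auto simp: stems_def)
    have sd: "s B \<inter> s B' = {}" if "B \<in> \<B>" "B' \<in> \<B>" "B \<noteq> B'" for B B'
      using sV[OF that(1)] sV[OF that(2)] disj that by blast
    then have sne: "s B \<noteq> s B'" if "B \<in> \<B>" "B' \<in> \<B>" "B \<noteq> B'" for B B'
      using sV[OF that(1)] that by force
    have "pairwise_3_disjoint E (s ` \<B>) \<longleftrightarrow>
      (\<forall>B\<in>\<B>. \<forall>B'\<in>\<B>. s B \<noteq> s B' \<longrightarrow> 3 \<le> edge_dist E (s B) (s B'))"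
    proof -
      have "s ` \<B> \<subseteq> E" using sE by blast
      then show ?thesis by (simp add: pairwise_3_disjoint_def)
    qed
    also have "\<dots> \<longleftrightarrow>
      (\<forall>B\<in>\<B>. \<forall>B'\<in>\<B>. B \<noteq> B' \<longrightarrow> (\<forall>f\<in>E. f \<inter> s B = {} \<or> f \<inter> s B' = {}))"
      by (intro ball_cong refl) (use edge_dist_ge_3_iff[OF sE sE] sd sne in metis)
    finally show ?thesis .
  qed
  show ?thesis
    unfolding strongly_disjoint_def
    by (intro conj_cong refl arg_cong[where f = Ex] ext) (rule key; assumption)
qed

lemma strongly_disjointE:
  assumes "strongly_disjoint V E \<B>"
  obtains s where "\<And>B. B \<in> \<B> \<Longrightarrow> s B \<in> stems B"
    "\<And>B B' f. B \<in> \<B> \<Longrightarrow> B' \<in> \<B> \<Longrightarrow> B \<noteq> B' \<Longrightarrow> f \<in> E \<Longrightarrow> f \<inter> s B = {} \<or> f \<inter> s B' = {}"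
    "\<And>B. B \<in> \<B> \<Longrightarrow> bouquet_of V E B"
    "\<And>B B'. B \<in> \<B> \<Longrightarrow> B' \<in> \<B> \<Longrightarrow> B \<noteq> B' \<Longrightarrow> bouquet_verts B \<inter> bouquet_verts B' = {}"
proof -
  obtain s where 1: "\<forall>B\<in>\<B>. bouquet_of V E B"
     "\<forall>B\<in>\<B>. \<forall>B'\<in>\<B>. B \<noteq> B' \<longrightarrow> bouquet_verts B \<inter> bouquet_verts B' = {}"
     "\<forall>B\<in>\<B>. s B \<in> stems B"
     "\<forall>B\<in>\<B>. \<forall>B'\<in>\<B>. B \<noteq> B' \<longrightarrow> (\<forall>f\<in>E. f \<inter> s B = {} \<or> f \<inter> s B' = {})"
    using assms unfolding strongly_disjoint_iff by (elim exE conjE)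
  show ?thesis
    by (rule that[of s]) (use 1 in simp_all)
qed

text \<open>A stem contains the root of its bouquet, so an edge between two roots would meet two
  chosen stems.\<close>

lemma strongly_imp_semi_strongly_disjoint:
  assumes "\<And>a. {a} \<notin> E" "strongly_disjoint V E \<B>"
  shows "semi_strongly_disjoint V E \<B>"
proof -
  obtain s where s: "\<And>B. B \<in> \<B> \<Longrightarrow> s B \<in> stems B"
      "\<And>B B' f. B \<in> \<B> \<Longrightarrow> B' \<in> \<B> \<Longrightarrow> B \<noteq> B' \<Longrightarrow> f \<in> E \<Longrightarrow> f \<inter> s B = {} \<or> f \<inter> s B' = {}"
    using strongly_disjointE[OF assms(2)] by metis
  have "{u, v} \<notin> E" if R: "u \<in> all_roots \<B>" "v \<in> all_roots \<B>" for u v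
  proof
    assume uv: "{u, v} \<in> E"
    obtain B B' where B: "B \<in> \<B>" "u = bouquet_root B" "B' \<in> \<B>" "v = bouquet_root B'"
      using R by (auto simp: all_roots_def)
    then have "u \<in> s B" "v \<in> s B'" using s(1)[of B] s(1)[of B'] by (auto simp: stems_def)
    moreover have "B \<noteq> B'" using B uv assms(1) by auto
    ultimately show False using s(2)[OF B(1,3) _ uv] by blast
  qed
  then show ?thesis
    using assms(2) by (simp add: strongly_disjoint_def semi_strongly_disjoint_def)
qed

section \<open>The invariants as attained maxima\<close>

lemma all_flowers_subset:
  assumes "\<forall>B\<in>\<B>. bouquet_of V E B" shows "all_flowers \<B> \<subseteq> V"
  using assms by (auto simp: all_flowers_def bouquet_of_def bouquet_verts_def)

lemma finite_card_flowers:
  assumes "finite V" "\<And>\<B>. P \<B> \<Longrightarrow> all_flowers \<B> \<subseteq> V"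
  shows "finite {card (all_flowers \<B>) | \<B>. P \<B>}"
proof (rule finite_subset)
  show "{card (all_flowers \<B>) | \<B>. P \<B>} \<subseteq> {..card V}"
    using assms card_mono[OF assms(1)] by auto
qed simp

lemma d_strong_ge:
  assumes "finite V" "strongly_disjoint V E \<B>"
  shows "card (all_flowers \<B>) \<le> d_strong V E"
  unfolding d_strong_def
  by (rule Max_ge[OF finite_card_flowers[OF assms(1)]])
    (use assms in \<open>auto simp: strongly_disjoint_def intro!: all_flowers_subset\<close>)

lemma d_semi_strong_ge:
  assumes "finite V" "semi_strongly_disjoint V E \<B>"
  shows "card (all_flowers \<B>) \<le> d_semi_strong V E"
  unfolding d_semi_strong_def
  by (rule Max_ge[OF finite_card_flowers[OF assms(1)]])
    (use assms in \<open>auto simp: semi_strongly_disjoint_def intro!: all_flowers_subset\<close>)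

lemma d_strong_attained:
  assumes "finite V" 
  obtains \<B> where "strongly_disjoint V E \<B>" "d_strong V E = card (all_flowers \<B>)"
proof -
  \<comment> \<open>The empty family makes the set of values nonempty, as \<open>Max\<close>
    requires.\<close>
  have "strongly_disjoint V E {}" by (simp add: strongly_disjoint_iff)
  then have "d_strong V E \<in> {card (all_flowers \<B>) | \<B>. strongly_disjoint V E \<B>}"
    unfolding d_strong_def
    by (intro Max_in finite_card_flowers[OF assms])
      (auto simp: strongly_disjoint_def intro!: all_flowers_subset)
  then show ?thesis using that by blast
qed

lemma d_semi_strong_attained:
  assumes "finite V" 
  obtains \<B> where "semi_strongly_disjoint V E \<B>" "d_semi_strong V E = card (all_flowers \<B>)"
proof -
  have "semi_strongly_disjoint V E {}" by (simp add: semi_strongly_disjoint_def all_roots_def)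
  then have "d_semi_strong V E \<in> {card (all_flowers \<B>) | \<B>. semi_strongly_disjoint V E \<B>}"
    unfolding d_semi_strong_def
    by (intro Max_in finite_card_flowers[OF assms])
      (auto simp: semi_strongly_disjoint_def intro!: all_flowers_subset)
  then show ?thesis using that by blast
qed

lemma d_strong_le_d_semi_strong:
  assumes "simple_graph V E" shows "d_strong V E \<le> d_semi_strong V E"
proof -
  have fin: "finite V" and nl: "{a} \<notin> E" for a
    using assms by (force simp: simple_graph_def)+
  obtain \<B> where "strongly_disjoint V E \<B>" "d_strong V E = card (all_flowers \<B>)"
    using d_strong_attained[OF fin] .
  then show ?thesis
    using d_semi_strong_ge[OF fin] strongly_imp_semi_strongly_disjoint[OF nl] by simp
qed

text \<open>Maximality gives every vertex outside \<open>A\<close> a neighbour in \<open>A\<close>.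
  A flower is adjacent to its root, which lies in \<open>A\<close>, so independence keeps the flower
  out.\<close>

lemma semi_strongly_disjoint_maximal_independent:
  assumes "simple_graph V E" "semi_strongly_disjoint V E \<B>"
  obtains A where "A \<subseteq> V" "\<And>f. f \<in> E \<Longrightarrow> \<not> f \<subseteq> A"
    "\<And>c. c \<in> V - A \<Longrightarrow> \<exists>a\<in>A. {c, a} \<in> E" "all_flowers \<B> \<subseteq> V - A"
proof -
  have fin: "finite V" and EV: "\<And>e. e \<in> E \<Longrightarrow> e \<subseteq> V \<and> card e = 2"
    using assms by (auto simp: simple_graph_def)
  define P where "P A \<longleftrightarrow> A \<subseteq> V \<and> (\<forall>f\<in>E. \<not> f \<subseteq> A)" for A
  have "all_roots \<B> \<subseteq> V"
    using assms(2) by (auto simp: semi_strongly_disjoint_def all_roots_def bouquet_of_def bouquet_verts_def)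
  moreover have "\<not> f \<subseteq> all_roots \<B>" if f: "f \<in> E" for f
  proof -
    obtain u v where "f = {u, v}" using EV[OF f] by (meson card_2_iff)
    then show ?thesis using assms(2) f by (auto simp: semi_strongly_disjoint_def)
  qed
  ultimately have "P (all_roots \<B>)" by (simp add: P_def)
  moreover have "finite {A. P A}"
    by (rule finite_subset[of _ "Pow V"]) (use fin in \<open>auto simp: P_def\<close>)
  ultimately have "\<exists>A. P A \<and> all_roots \<B> \<subseteq> A \<and> (\<forall>A'. P A' \<longrightarrow> A \<subseteq> A' \<longrightarrow> A = A')"
    using finite_has_maximal2[of "{A. P A}" "all_roots \<B>"] by auto
  then obtain A where A: "P A" "all_roots \<B> \<subseteq> A" "\<And>A'. P A' \<Longrightarrow> A \<subseteq> A' \<Longrightarrow> A = A'"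
    by metis
  show ?thesis
  proof (rule that)
    show "A \<subseteq> V" "\<And>f. f \<in> E \<Longrightarrow> \<not> f \<subseteq> A" using A(1) by (auto simp: P_def)
    show "\<exists>a\<in>A. {c, a} \<in> E" if c: "c \<in> V - A" for c
    proof -
      have "\<not> P (insert c A)" using A(3)[of "insert c A"] c by auto
      then obtain f where f: "f \<in> E" "f \<subseteq> insert c A"
        using A(1) c by (auto simp: P_def)
      then have "c \<in> f" using A(1) by (auto simp: P_def)
      then obtain a where "f = {c, a}" "a \<noteq> c"
        using EV[OF f(1)] by (meson doubleton_cases)
      then show ?thesis using f by auto
    qed
    show "all_flowers \<B> \<subseteq> V - A"
    proof
      fix z assume "z \<in> all_flowers \<B>"
      then obtain B where B: "B \<in> \<B>" "z \<in> flowers B" by (auto simp: all_flowers_def)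
      then have b: "{bouquet_root B, z} \<in> E" "z \<in> V"
        using assms(2)
        by (auto simp: semi_strongly_disjoint_def bouquet_of_def bouquet_verts_def stems_def)
      moreover have "bouquet_root B \<in> A" using A(2) B by (auto simp: all_roots_def)
      ultimately show "z \<in> V - A" using A(1) by (auto simp: P_def)
    qed
  qed
qed

text \<open>An optimal family for the smaller graph stays strongly disjoint when \<open>e\<close> is
  put back. Only \<open>e\<close> could now join two stems, one containing \<open>u\<close> and the
  other \<open>{v, a}\<close>; but then \<open>{u, a}\<close> joined them before.\<close>

lemma d_strong_delete_edge:
  assumes "simple_graph V E" and e: "e = {u, v}" "e \<in> E"
    and dom: "\<And>a. {v, a} \<in> E \<Longrightarrow> a \<noteq> u \<Longrightarrow> {u, a} \<in> E"
  shows "d_strong V (E - {e}) \<le> d_strong V E"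
proof -
  have fin: "finite V" and EV: "\<And>e. e \<in> E \<Longrightarrow> e \<subseteq> V \<and> card e = 2"
    using assms by (auto simp: simple_graph_def)
  obtain \<B> where B: "strongly_disjoint V (E - {e}) \<B>" "d_strong V (E - {e}) = card (all_flowers \<B>)"
    using d_strong_attained[OF fin] .
  obtain s where s: "\<And>B. B \<in> \<B> \<Longrightarrow> s B \<in> stems B"
      "\<And>B B' f. B \<in> \<B> \<Longrightarrow> B' \<in> \<B> \<Longrightarrow> B \<noteq> B' \<Longrightarrow> f \<in> E - {e} \<Longrightarrow> f \<inter> s B = {} \<or> f \<inter> s B' = {}"
    and bo: "\<And>B. B \<in> \<B> \<Longrightarrow> bouquet_of V (E - {e}) B"
    and disj: "\<And>B B'. B \<in> \<B> \<Longrightarrow> B' \<in> \<B> \<Longrightarrow> B \<noteq> B' \<Longrightarrow> bouquet_verts B \<inter> bouquet_verts B' = {}"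
    by (rule strongly_disjointE[OF B(1)]) (rule that, simp_all)
  have key: False if BB: "B \<in> \<B>" "B' \<in> \<B>" "B \<noteq> B'" "u \<in> s B" "v \<in> s B'" for B B'
  proof -
    have sE: "s B' \<in> E - {e}" using bo[OF BB(2)] s(1)[OF BB(2)] by (auto simp: bouquet_of_def)
    then obtain a where a: "s B' = {v, a}" "a \<noteq> v"
      using EV BB(5) by (metis DiffE doubleton_cases)
    then have "a \<noteq> u" using sE e by (auto simp: insert_commute)
    then have "{u, a} \<in> E - {e}" using dom a sE e(1) by (auto simp: doubleton_eq_iff)
    from s(2)[OF BB(1-3) this] show False using a BB by auto
  qed
  have "f \<inter> s B = {} \<or> f \<inter> s B' = {}" if BB: "B \<in> \<B>" "B' \<in> \<B>" "B \<noteq> B'" "f \<in> E" for B B' f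
  proof (cases "f = e")
    case True
    have "s B \<inter> s B' = {}"
      using stems_subset_verts[OF s(1)] disj[OF BB(1-3)] BB by blast
    moreover have "\<not> (u \<in> s B \<and> v \<in> s B')" "\<not> (v \<in> s B \<and> u \<in> s B')"
      using key[OF BB(1,2,3)] key[OF BB(2,1) BB(3)[symmetric]] by blast+
    ultimately show ?thesis unfolding True e(1) by blast
  qed (use s(2) BB in auto)
  moreover have "bouquet_of V E B" if "B \<in> \<B>" for B
    using bo[OF that] by (auto simp: bouquet_of_def)
  ultimately have "strongly_disjoint V E \<B>"
    unfolding strongly_disjoint_iff using s(1) disj by (intro conjI exI[of _ s]) simp_all
  then show ?thesis using d_strong_ge[OF fin] B(2) by metis
qed

text \<open>The bouquet with root \<open>u\<close> and flowers \<open>N\<close> is added, with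
  chosen stem \<open>{u, v}\<close>. By \<open>dom\<close>, every edge meeting this stem lies inside
  \<open>insert u N\<close>, hence meets no other stem.\<close>

lemma d_strong_delete_neighbourhood:
  assumes "simple_graph V E" and e: "{u, v} \<in> E"
    and N: "N = {a. {u, a} \<in> E}" and E': "E' = {f \<in> E. f \<inter> insert u N = {}}"
    and dom: "\<And>a. {v, a} \<in> E \<Longrightarrow> a \<noteq> u \<Longrightarrow> {u, a} \<in> E"
  shows "card N + d_strong V E' \<le> d_strong V E"
proof -
  have fin: "finite V" and EV: "\<And>e. e \<in> E \<Longrightarrow> e \<subseteq> V \<and> card e = 2"
    using assms by (auto simp: simple_graph_def)
  have uN: "u \<notin> N" "N \<subseteq> V" "v \<in> N" "u \<in> V" using EV e by (force simp: N)+
  obtain \<B> where B: "strongly_disjoint V E' \<B>" "d_strong V E' = card (all_flowers \<B>)"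
    using d_strong_attained[OF fin] .
  obtain s where s: "\<And>B. B \<in> \<B> \<Longrightarrow> s B \<in> stems B"
      "\<And>B B' f. B \<in> \<B> \<Longrightarrow> B' \<in> \<B> \<Longrightarrow> B \<noteq> B' \<Longrightarrow> f \<in> E' \<Longrightarrow> f \<inter> s B = {} \<or> f \<inter> s B' = {}"
    and bo: "\<And>B. B \<in> \<B> \<Longrightarrow> bouquet_of V E' B"
    and disj: "\<And>B B'. B \<in> \<B> \<Longrightarrow> B' \<in> \<B> \<Longrightarrow> B \<noteq> B' \<Longrightarrow> bouquet_verts B \<inter> bouquet_verts B' = {}"
    by (rule strongly_disjointE[OF B(1)]) (rule that, simp_all)
  have avoid: "bouquet_verts B \<inter> insert u N = {}" if "B \<in> \<B>" for B
  proof -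
    have fl: "flowers B \<noteq> {}" "\<And>z. z \<in> flowers B \<Longrightarrow> {bouquet_root B, z} \<in> E'"
      using bo[OF that] by (auto simp: bouquet_of_def stems_def)
    then have "z \<notin> insert u N" "bouquet_root B \<notin> insert u N" if "z \<in> flowers B" for z
      using that by (auto simp: E')
    then show ?thesis using fl(1) by (auto simp: bouquet_verts_def)
  qed
  have sav: "s B \<inter> insert u N = {}" if "B \<in> \<B>" for B
    using avoid[OF that] stems_subset_verts[OF s(1)[OF that]] by blast
  let ?Bu = "Bouquet u N"
  have new: "?Bu \<notin> \<B>" using avoid[of ?Bu] by (auto simp: bouquet_verts_def)
  define s' where "s' = s(?Bu := {u, v})"
  have s'B: "s' B = s B" if "B \<in> \<B>" for B using that new by (auto simp: s'_def)
  have 1: "f \<inter> {u, v} = {} \<or> f \<inter> s B = {}" if fB: "f \<in> E" "B \<in> \<B>" for f B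
  proof (rule ccontr)
    assume *: "\<not> ?thesis"
    have "f \<subseteq> insert u N"
    proof (cases "u \<in> f")
      case True
      then obtain a where "f = {u, a}" using EV[OF fB(1)] by (meson doubleton_cases)
      then show ?thesis using fB by (simp add: N)
    next
      case False
      then have "v \<in> f" using * by auto
      then obtain a where a: "f = {v, a}" using EV[OF fB(1)] by (meson doubleton_cases)
      then have "a \<in> N" using dom fB(1) False by (auto simp: N)
      then show ?thesis using a uN by auto
    qed
    then show False using sav[OF fB(2)] * by blast
  qed
  have 2: "f \<inter> s B = {} \<or> f \<inter> s B' = {}" if BB: "B \<in> \<B>" "B' \<in> \<B>" "B \<noteq> B'" "f \<in> E" for f B B'
  proof (rule ccontr)
    assume *: "\<not> ?thesis"
    then obtain x y where xy: "x \<in> f" "x \<in> s B" "y \<in> f" "y \<in> s B'" by blast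
    have "s B \<inter> s B' = {}"
      using stems_subset_verts[OF s(1)] disj[OF BB(1-3)] BB by blast
    then have "x \<noteq> y" using xy by auto
    \<comment> \<open>An edge meeting two old stems has both its ends on them, thus outside
      \<open>insert u N\<close>, and so it was already present in \<open>E'\<close>.\<close>
    then have "f = {x, y}" using EV[OF BB(4)] xy by (metis doubleton_cases insert_iff singletonD)
    then have "f \<in> E'" using BB sav xy unfolding E' by blast
    then show False using s(2)[OF BB(1-3)] * by blast
  qed
  have "strongly_disjoint V E (insert ?Bu \<B>)"
    unfolding strongly_disjoint_iff
  proof (intro conjI exI[of _ s'])
    have "bouquet_of V E ?Bu"
      using uN finite_subset[OF uN(2) fin]
      by (auto simp: bouquet_of_def bouquet_verts_def stems_def N)
    moreover have "bouquet_of V E B" if "B \<in> \<B>" for B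
      using bo[OF that] by (auto simp: bouquet_of_def E')
    ultimately show "\<forall>B\<in>insert ?Bu \<B>. bouquet_of V E B" by blast
    have "bouquet_verts ?Bu = insert u N" by (simp add: bouquet_verts_def)
    then show "\<forall>B\<in>insert ?Bu \<B>. \<forall>B'\<in>insert ?Bu \<B>. B \<noteq> B' \<longrightarrow> bouquet_verts B \<inter> bouquet_verts B' = {}"
      using avoid disj by (simp add: Int_commute)
    have "s' ?Bu \<in> stems ?Bu" using uN by (auto simp: s'_def stems_def)
    then show "\<forall>B\<in>insert ?Bu \<B>. s' B \<in> stems B" using s(1) s'B by auto
    show "\<forall>B\<in>insert ?Bu \<B>. \<forall>B'\<in>insert ?Bu \<B>. B \<noteq> B' \<longrightarrow> (\<forall>f\<in>E. f \<inter> s' B = {} \<or> f \<inter> s' B' = {})"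
    proof (intro ballI impI)
      fix B B' f assume a: "B \<in> insert ?Bu \<B>" "B' \<in> insert ?Bu \<B>" "B \<noteq> B'" "f \<in> E"
      have su: "s' ?Bu = {u, v}" by (simp add: s'_def)
      consider "B = ?Bu" "B' \<in> \<B>" | "B' = ?Bu" "B \<in> \<B>" | "B \<in> \<B>" "B' \<in> \<B>"
        using a by blast
      then show "f \<inter> s' B = {} \<or> f \<inter> s' B' = {}"
        using 1[OF a(4)] 2[OF _ _ a(3,4)] su s'B by cases metis+
    qed
  qed
  moreover have "card (all_flowers (insert ?Bu \<B>)) = card N + card (all_flowers \<B>)"
  proof -
    have "all_flowers \<B> \<inter> N = {}"
      using avoid by (fastforce simp: all_flowers_def bouquet_verts_def)
    moreover have "finite (all_flowers \<B>)"
      using all_flowers_subset[of \<B> V E'] bo fin finite_subset by blast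
    ultimately show ?thesis
      using finite_subset[OF uN(2) fin]
      by (subst card_Un_disjoint[symmetric]) (auto simp: all_flowers_def)
  qed
  ultimately show ?thesis using d_strong_ge[OF fin] B(2) by metis
qed

section \<open>Certificates for upper bounds on the projective dimension\<close>

text \<open>\<open>pd_bound V \<Gamma> p\<close> certifies \<open>pd S/I \<le> p\<close> for the ideal \<open>I\<close> generated by the squarefree monomials
  with supports in \<open>\<Gamma>\<close>.\<close>
inductive pd_bound :: "'v set \<Rightarrow> 'v set set \<Rightarrow> nat \<Rightarrow> bool" for V where
  empty: "pd_bound V {} 0"
| mono: "pd_bound V \<Gamma> p \<Longrightarrow> p \<le> q \<Longrightarrow> pd_bound V \<Gamma> q"
| cong: "pd_bound V \<Gamma> p \<Longrightarrow> (\<forall>U\<in>\<Gamma>. \<exists>U'\<in>\<Gamma>'. U' \<subseteq> U) \<Longrightarrow> (\<forall>U'\<in>\<Gamma>'. \<exists>U\<in>\<Gamma>. U \<subseteq> U') \<Longrightarrow> pd_bound V \<Gamma>' p"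
| colon: "pd_bound V \<Gamma> (Suc p) \<Longrightarrow> pd_bound V ((\<lambda>U. U - T) ` \<Gamma>) p \<Longrightarrow> finite T \<Longrightarrow> T \<subseteq> V
    \<Longrightarrow> pd_bound V (insert T \<Gamma>) (Suc p)"

text \<open>A variable that divides no generator leaves the colon ideal equal to the ideal, so
  adjoining it costs exactly one application of \<open>colon\<close>.\<close>

lemma pd_bound_singletons:
  assumes "pd_bound V \<Gamma> p" "finite X" "X \<subseteq> V" "X \<inter> \<Union>\<Gamma> = {}"
  shows "pd_bound V (\<Gamma> \<union> (\<lambda>x. {x}) ` X) (p + card X)"
  using assms(2-)
proof (induction X rule: finite_induct)
  case empty
  then show ?case using assms(1) by simp
next
  case (insert x X)
  let ?\<Gamma> = "\<Gamma> \<union> (\<lambda>x. {x}) ` X"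
  have IH: "pd_bound V ?\<Gamma> (p + card X)" using insert by auto
  have "(\<lambda>U. U - {x}) ` ?\<Gamma> = (\<lambda>U. U) ` ?\<Gamma>"
    by (rule image_cong) (use insert.hyps insert.prems in auto)
  then have "pd_bound V (insert {x} ?\<Gamma>) (Suc (p + card X))"
    using IH insert.prems by (intro pd_bound.colon) (auto intro: pd_bound.mono)
  then show ?case using insert.hyps by simp
qed

text \<open>The only danger is that the edge \<open>{a, b}\<close> required by an earlier common
  neighbour is among those deleted.\<close>

lemma perfect_elimination_subset:
  assumes "perfect_elimination E r" "E' \<subseteq> E"
    and "\<And>v a b. \<lbrakk>{v, a} \<in> E'; {v, b} \<in> E'; {a, b} \<in> E; r v < r a; r v < r b\<rbrakk> \<Longrightarrow> {a, b} \<in> E'"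
  shows "perfect_elimination E' r"
proof -
  have "inj_on r (\<Union>E')"
    by (rule inj_on_subset[of r "\<Union>E"]) (use assms in \<open>auto simp: perfect_elimination_def\<close>)
  moreover have "{a, b} \<in> E'"
    if "{v, a} \<in> E'" "{v, b} \<in> E'" "r v < r a" "r v < r b" "a \<noteq> b" for v a b
  proof (rule assms(3)[OF that(1,2)])
    show "{a, b} \<in> E" using assms(1,2) that unfolding perfect_elimination_def by blast
  qed (use that in auto)
  ultimately show ?thesis unfolding perfect_elimination_def by blast
qed

lemma pd_bound_perfect_elimination:
  assumes "simple_graph V E" "perfect_elimination E r"
  shows "pd_bound V E (d_strong V E)"
  using assms
proof (induction "card E" arbitrary: E rule: less_induct)
  case less
  have fin: "finite V" and EV: "\<And>e. e \<in> E \<Longrightarrow> e \<subseteq> V \<and> card e = 2"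
    using less.prems by (auto simp: simple_graph_def)
  have finE: "finite E"
    by (rule finite_subset[of _ "Pow V"]) (use EV fin in auto)
  show ?case
  proof (cases "E = {}")
    case True
    then show ?thesis using pd_bound.mono[OF pd_bound.empty] by auto
  next
    case False
    have inj: "inj_on r (\<Union>E)" using less.prems by (simp add: perfect_elimination_def)
    have fU: "finite (\<Union>E)" by (rule finite_subset[of _ V]) (use EV fin in auto)
    have "\<Union>E \<noteq> {}" using False EV by fastforce
    then obtain v where v: "v \<in> \<Union>E" "\<And>w. w \<in> \<Union>E \<Longrightarrow> r v \<le> r w"
      using arg_min_if_finite(1)[OF fU] arg_min_least[OF fU] by metis
    have vless: "r v < r w" if "w \<in> \<Union>E" "w \<noteq> v" for w
    proof -
      have "r v \<noteq> r w" using inj_onD[OF inj _ v(1) that(1)] that(2) by metis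
      then show ?thesis using v(2)[OF that(1)] by simp
    qed
    obtain e where e: "e \<in> E" "v \<in> e" using v(1) by auto
    then obtain u where u: "e = {v, u}" "u \<noteq> v" using EV by (meson doubleton_cases)
    have euv: "e = {u, v}" using u by auto
    have nbr: "a \<noteq> v \<and> r v < r a" if "{v, a} \<in> E" for a
    proof -
      have "a \<noteq> v" using EV[OF that] by auto
      then show ?thesis using vless[of a] that by auto
    qed
    have dom: "{u, a} \<in> E" if "{v, a} \<in> E" "a \<noteq> u" for a
      using less.prems(2) nbr[OF that(1)] nbr[of u] that e u
      unfolding perfect_elimination_def by metis
    define N where "N = {a. {u, a} \<in> E}"
    define E' where "E' = {f \<in> E. f \<inter> insert u N = {}}"
    have vN: "v \<in> N" using e euv by (simp add: N_def)
    have NV: "N \<subseteq> V" using EV by (force simp: N_def)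
    have uN: "u \<notin> N" using EV by (force simp: N_def)
    have d1: "d_strong V (E - {e}) \<le> d_strong V E"
      by (rule d_strong_delete_edge[OF less.prems(1) euv e(1) dom])
    have d2: "card N + d_strong V E' \<le> d_strong V E"
      by (rule d_strong_delete_neighbourhood[OF less.prems(1) _ N_def E'_def dom]) (use e euv in auto)
    have N1: "card N = Suc (card (N - {v}))"
      using vN finite_subset[OF NV fin] by (metis card.remove)
    \<comment> \<open>The predecessor form suits \<open>colon\<close>; since \<open>v\<close> lies
      in \<open>N\<close>, the value \<open>d_strong V E\<close> is positive.\<close>
    define p where "p = d_strong V E - 1"
    have p: "d_strong V E = Suc p" "card (N - {v}) + d_strong V E' \<le> p"
      using d2 N1 unfolding p_def by linarith+
    have lt: "card (E - {e}) < card E" "card E' < card E"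
    proof -
      show "card (E - {e}) < card E" using finE e by (meson card_Diff1_less)
      have "e \<notin> E'" using euv by (simp add: E'_def)
      then show "card E' < card E"
        using finE e by (intro psubset_card_mono) (auto simp: E'_def)
    qed
    have b1: "pd_bound V (E - {e}) (d_strong V (E - {e}))"
    proof (rule less.hyps[OF lt(1)])
      show "simple_graph V (E - {e})" using less.prems(1) by (simp add: simple_graph_def)
      show "perfect_elimination (E - {e}) r"
      proof (rule perfect_elimination_subset[OF less.prems(2)])
        fix w a b assume *: "{w, a} \<in> E - {e}" "{w, b} \<in> E - {e}" "{a, b} \<in> E" "r w < r a" "r w < r b"
        \<comment> \<open>Neither \<open>a\<close> nor \<open>b\<close> is the vertex
          \<open>v\<close> of least rank, so the deleted edge is never the one that is
          required.\<close>
        have "r v \<le> r w" using v(2) * by blast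
        then have "a \<noteq> v" "b \<noteq> v" using * by auto
        then show "{a, b} \<in> E - {e}" using * euv by (auto simp: doubleton_eq_iff)
      qed auto
    qed
    have b2: "pd_bound V E' (d_strong V E')"
    proof (rule less.hyps[OF lt(2)])
      show "simple_graph V E'" using less.prems(1) by (simp add: simple_graph_def E'_def)
      show "perfect_elimination E' r"
        by (rule perfect_elimination_subset[OF less.prems(2)]) (auto simp: E'_def)
    qed
    have "finite (N - {v})" "N - {v} \<subseteq> V" "(N - {v}) \<inter> \<Union>E' = {}"
      using NV finite_subset[OF NV fin] by (auto simp: E'_def)
    then have "pd_bound V (E' \<union> (\<lambda>x. {x}) ` (N - {v})) (d_strong V E' + card (N - {v}))"
      by (rule pd_bound_singletons[OF b2])
    \<comment> \<open>The generators of \<open>J : e\<close> are compared up to divisibility. Edges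
      at \<open>u\<close> or \<open>v\<close> shrink to a singleton \<open>{a}\<close> with
      \<open>a\<close> in \<open>N - {v}\<close>, other edges meeting \<open>N\<close> contain such
      a singleton, and the rest form \<open>E'\<close>.\<close>
    then have "pd_bound V ((\<lambda>U. U - e) ` (E - {e})) (d_strong V E' + card (N - {v}))"
    proof (rule pd_bound.cong)
      show "\<forall>U\<in>E' \<union> (\<lambda>x. {x}) ` (N - {v}). \<exists>U'\<in>(\<lambda>U. U - e) ` (E - {e}). U' \<subseteq> U"
      proof
        fix U assume "U \<in> E' \<union> (\<lambda>x. {x}) ` (N - {v})"
        then consider "U \<in> E'" | a where "a \<in> N" "a \<noteq> v" "U = {a}" by auto
        then show "\<exists>U'\<in>(\<lambda>U. U - e) ` (E - {e}). U' \<subseteq> U"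
        proof cases
          case 1
          then have m: "U \<in> E - {e}" using euv by (auto simp: E'_def)
          show ?thesis by (rule bexI[OF _ imageI[OF m]]) blast
        next
          case 2
          then have m: "{u, a} \<in> E - {e}" using euv uN by (auto simp: N_def doubleton_eq_iff)
          show ?thesis by (rule bexI[OF _ imageI[OF m]]) (use 2 euv in auto)
        qed
      qed
      show "\<forall>U'\<in>(\<lambda>U. U - e) ` (E - {e}). \<exists>U\<in>E' \<union> (\<lambda>x. {x}) ` (N - {v}). U \<subseteq> U'"
      proof
        fix U' assume "U' \<in> (\<lambda>U. U - e) ` (E - {e})"
        then obtain U where U: "U \<in> E" "U \<noteq> e" "U' = U - e" by auto
        have sing: "\<exists>U\<in>E' \<union> (\<lambda>x. {x}) ` (N - {v}). U \<subseteq> U'" if "a \<in> N" "a \<noteq> v" "a \<in> U" for a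
        proof (rule bexI)
          show "{a} \<subseteq> U'" using that U(3) euv uN by auto
          show "{a} \<in> E' \<union> (\<lambda>x. {x}) ` (N - {v})" using that by simp
        qed
        consider "U \<inter> insert u N = {}" | "u \<in> U" | "u \<notin> U" "v \<in> U"
          | a where "a \<in> N" "a \<noteq> v" "a \<in> U" by blast
        then show "\<exists>U\<in>E' \<union> (\<lambda>x. {x}) ` (N - {v}). U \<subseteq> U'"
        proof cases
          case 1
          then have "U \<in> E'" "U' \<subseteq> U" "U \<subseteq> U'" using U euv vN by (auto simp: E'_def)
          then show ?thesis by (intro bexI[of _ U]) auto
        next
          case 2
          then obtain a where a: "U = {u, a}" using EV[OF U(1)] by (meson doubleton_cases)
          then have "a \<in> N" "a \<noteq> v" using U euv by (auto simp: N_def)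
          then show ?thesis using sing a by auto
        next
          case 3
          then obtain a where a: "U = {v, a}" using EV[OF U(1)] by (meson doubleton_cases)
          then have "a \<in> N" using dom 3 U by (auto simp: N_def)
          moreover have "a \<noteq> v" using nbr a U by auto
          ultimately show ?thesis using sing a by auto
        next
          case 4
          then show ?thesis using sing by auto
        qed
      qed
    qed
    then have c: "pd_bound V ((\<lambda>U. U - e) ` (E - {e})) p"
      by (rule pd_bound.mono) (use p in simp)
    have "pd_bound V (insert e (E - {e})) (Suc p)"
    proof (rule pd_bound.colon[OF _ c])
      show "pd_bound V (E - {e}) (Suc p)"
        using pd_bound.mono[OF b1] d1 p(1) by simp
    qed (use EV[OF e(1)] fin in \<open>auto intro: finite_subset\<close>)
    then show ?thesis using e p(1) by (simp add: insert_absorb)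
  qed
qed

section \<open>Koszul complexes\<close>

text \<open>A chain assigns a coefficient to each subset of the list of variables, encoded as a list of
  truth values. The differential is built up as an iterated mapping cone, so that no signs of
  permutations occur.\<close>
primrec koszul_d :: "('v \<Rightarrow> 'm::ab_group_add \<Rightarrow> 'm) \<Rightarrow> 'v list \<Rightarrow> (bool list \<Rightarrow> 'm) \<Rightarrow> bool list \<Rightarrow> 'm" where
  "koszul_d X [] c = (\<lambda>b. 0)"
| "koszul_d X (v # vs) c = (\<lambda>b. case b of [] \<Rightarrow> 0
     | t # b' \<Rightarrow> if t then - koszul_d X vs (\<lambda>b. c (True # b)) b'
               else koszul_d X vs (\<lambda>b. c (False # b)) b' + X v (c (True # b')))"

text \<open>These are the elements of the \<open>k\<close>-th exterior power with coefficients in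
  \<open>N\<close>; a list with \<open>k\<close> entries \<open>True\<close> stands for a basis
  element.\<close>

definition koszul_chain :: "nat \<Rightarrow> nat \<Rightarrow> 'm::zero set \<Rightarrow> (bool list \<Rightarrow> 'm) set" where
  "koszul_chain n k N = {c. (\<forall>b. c b \<in> N) \<and> (\<forall>b. c b \<noteq> 0 \<longrightarrow> length b = n \<and> count_list b True = k)}"

text \<open>Vanishing of the \<open>k\<close>-th Koszul homology of the quotient module \<open>N/B\<close>, in terms of
  representatives.\<close>
definition acyclic_at :: "('v \<Rightarrow> 'm::ab_group_add \<Rightarrow> 'm) \<Rightarrow> 'v list \<Rightarrow> nat \<Rightarrow> 'm set \<Rightarrow> 'm set \<Rightarrow> bool" where
  "acyclic_at X vs k N B \<longleftrightarrow> (\<forall>c\<in>koszul_chain (length vs) k N. (\<forall>b. koszul_d X vs c b \<in> B) \<longrightarrow>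
     (\<exists>e\<in>koszul_chain (length vs) (Suc k) N. \<forall>b. c b - koszul_d X vs e b \<in> B))"

text \<open>The submodule notion of the Koszul arguments: the action of the variables in
  \<open>W\<close> is all of the ring that they see.\<close>

definition stable_under :: "('v \<Rightarrow> 'm::ab_group_add \<Rightarrow> 'm) \<Rightarrow> 'v set \<Rightarrow> 'm set \<Rightarrow> bool" where
  "stable_under X W N \<longleftrightarrow> 0 \<in> N \<and> (\<forall>a\<in>N. \<forall>b\<in>N. a - b \<in> N) \<and> (\<forall>a\<in>N. \<forall>v\<in>W. X v a \<in> N)"

text \<open>This is the submodule generated by the products of the variables in \<open>vs\<close>
  with \<open>N\<close>. It is written as the image of the first Koszul differential, evaluated at
  the empty subset, so that membership directly hands over a bounding chain.\<close>

definition var_span :: "('v \<Rightarrow> 'm::ab_group_add \<Rightarrow> 'm) \<Rightarrow> 'v list \<Rightarrow> 'm set \<Rightarrow> 'm set" where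
  "var_span X vs N = (\<lambda>e. koszul_d X vs e (replicate (length vs) False)) ` koszul_chain (length vs) 1 N"

text \<open>The head is tested modulo the variables behind it, which matches the recursion of the
  iterated mapping cone.\<close>

primrec regular_sequence :: "('v \<Rightarrow> 'm::ab_group_add \<Rightarrow> 'm) \<Rightarrow> 'v list \<Rightarrow> 'm set \<Rightarrow> bool" where
  "regular_sequence X [] N \<longleftrightarrow> True"
| "regular_sequence X (v # vs) N \<longleftrightarrow>
     (\<forall>a\<in>N. X v a \<in> var_span X vs N \<longrightarrow> a \<in> var_span X vs N) \<and> regular_sequence X vs N"

section \<open>Stable subsets and Koszul chains\<close>

lemma stable_zero: "stable_under X W N \<Longrightarrow> 0 \<in> N"
  and stable_diff: "stable_under X W N \<Longrightarrow> a \<in> N \<Longrightarrow> b \<in> N \<Longrightarrow> a - b \<in> N"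
  and stable_act: "stable_under X W N \<Longrightarrow> a \<in> N \<Longrightarrow> v \<in> W \<Longrightarrow> X v a \<in> N"
  by (auto simp: stable_under_def)

lemma stable_uminus: "stable_under X W N \<Longrightarrow> a \<in> N \<Longrightarrow> - a \<in> N"
  using stable_diff[of X W N 0 a] stable_zero[of X W N] by simp

lemma stable_add: "stable_under X W N \<Longrightarrow> a \<in> N \<Longrightarrow> b \<in> N \<Longrightarrow> a + b \<in> N"
  using stable_diff[of X W N a "- b"] stable_uminus[of X W N b] by simp

lemma stable_subset: "stable_under X W N \<Longrightarrow> W' \<subseteq> W \<Longrightarrow> stable_under X W' N"
  by (auto simp: stable_under_def)

lemma chain_mem: "c \<in> koszul_chain n k N \<Longrightarrow> c b \<in> N"
  and chain_supp: "c \<in> koszul_chain n k N \<Longrightarrow> c b \<noteq> 0 \<Longrightarrow> length b = n \<and> count_list b True = k"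
  by (auto simp: koszul_chain_def)

lemma chainI:
  assumes "\<And>b. c b \<in> N" "\<And>b. c b \<noteq> 0 \<Longrightarrow> length b = n \<and> count_list b True = k"
  shows "c \<in> koszul_chain n k N"
  using assms by (auto simp: koszul_chain_def)

lemma chain_mono: "c \<in> koszul_chain n k N \<Longrightarrow> N \<subseteq> N' \<Longrightarrow> c \<in> koszul_chain n k N'"
  by (auto simp: koszul_chain_def)

lemma chain_diff: 
  assumes "stable_under X W N" "c \<in> koszul_chain n k N" "e \<in> koszul_chain n k N"
  shows "(\<lambda>b. c b - e b) \<in> koszul_chain n k N"
proof (rule chainI)
  show "c b - e b \<in> N" for b
    using assms by (meson chain_mem stable_diff)
  show "length b = n \<and> count_list b True = k" if "c b - e b \<noteq> 0" for b
    using that chain_supp[OF assms(2), of b] chain_supp[OF assms(3), of b] by fastforce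
qed

lemma chain_False: 
  assumes "c \<in> koszul_chain (Suc n) k N" shows "(\<lambda>b. c (False # b)) \<in> koszul_chain n k N"
proof (rule chainI)
  show "length b = n \<and> count_list b True = k" if "c (False # b) \<noteq> 0" for b
    using chain_supp[OF assms that] by simp
qed (rule chain_mem[OF assms])

lemma chain_True:
  assumes "c \<in> koszul_chain (Suc n) (Suc k) N" shows "(\<lambda>b. c (True # b)) \<in> koszul_chain n k N"
proof (rule chainI)
  show "length b = n \<and> count_list b True = k" if "c (True # b) \<noteq> 0" for b
    using chain_supp[OF assms that] by simp
qed (rule chain_mem[OF assms])

lemma chain_0_True: "c \<in> koszul_chain (Suc n) 0 N \<Longrightarrow> c (True # b) = 0"
  using chain_supp[of c "Suc n" 0 N "True # b"] by auto

lemma count_0: "count_list b True = 0 \<longleftrightarrow> b = replicate (length b) False"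
  by (induction b) auto

lemma length_0_count: "length b = n \<and> count_list b True = 0 \<longleftrightarrow> b = replicate n False"
  using count_0[of b] by auto

lemma count_full: "count_list b True = length b \<longleftrightarrow> b = replicate (length b) True"
proof (induction b)
  case (Cons t b)
  then show ?case using count_le_length[of b True] by (cases t) auto
qed simp

lemma length_count: "length b = n \<and> count_list b True = n \<longleftrightarrow> b = replicate n True"
  using count_full[of b] by auto

section \<open>The Koszul complex of commuting operators\<close>

locale commuting_operators =
  fixes X :: "'v \<Rightarrow> 'm::ab_group_add \<Rightarrow> 'm"
  assumes X_add: "X v (a + b) = X v a + X v b"
    and X_commute: "X u (X v a) = X v (X u a)"
begin

lemma X_zero [simp]: "X v 0 = 0"
  using X_add[of v 0 0] by simp

lemma X_uminus [simp]: "X v (- a) = - X v a"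
  using X_add[of v a "- a"] by (simp add: eq_neg_iff_add_eq_0 add.commute)

lemma koszul_d_zero [simp]: "koszul_d X vs (\<lambda>b. 0) b = 0"
  by (induction vs arbitrary: b) (auto split: list.split)

lemma koszul_d_add: "koszul_d X vs (\<lambda>b. c b + e b) b = koszul_d X vs c b + koszul_d X vs e b"
  by (induction vs arbitrary: b c e) (auto simp: X_add algebra_simps split: list.split)

lemma koszul_d_uminus: "koszul_d X vs (\<lambda>b. - c b) b = - koszul_d X vs c b"
  by (induction vs arbitrary: b c) (auto simp: X_add algebra_simps split: list.split)

lemma koszul_d_diff: "koszul_d X vs (\<lambda>b. c b - e b) b = koszul_d X vs c b - koszul_d X vs e b"
  using koszul_d_add[of vs c "\<lambda>b. - e b" b] by (simp add: koszul_d_uminus)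

lemma koszul_d_act: "koszul_d X vs (\<lambda>b. X v (c b)) b = X v (koszul_d X vs c b)"
  by (induction vs arbitrary: b c) (auto simp: X_add X_commute[of v] split: list.split)

text \<open>The minus sign in the \<open>True\<close> component makes the two cross terms with
  \<open>X v\<close> cancel.\<close>

lemma koszul_d_koszul_d [simp]: "koszul_d X vs (koszul_d X vs c) b = 0"
proof (induction vs arbitrary: b c)
  case (Cons v vs)
  show ?case
    by (auto simp: koszul_d_add koszul_d_act koszul_d_uminus Cons split: list.split)
qed simp

lemma koszul_d_closed: "stable_under X (set vs) N \<Longrightarrow> (\<And>b. c b \<in> N) \<Longrightarrow> koszul_d X vs c b \<in> N"
proof (induction vs arbitrary: b c)
  case Nil
  then show ?case by (simp add: stable_zero)
next
  case (Cons v vs)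
  have st: "stable_under X (set vs) N"
    using Cons.prems(1) by (auto simp: stable_under_def)
  have IH: "koszul_d X vs c' b' \<in> N" if "\<And>b. c' b \<in> N" for c' b'
    by (rule Cons.IH[OF st that])
  show ?case
  proof (cases b)
    case Nil
    then show ?thesis using stable_zero[OF st] by simp
  next
    case (Cons t b')
    have 1: "koszul_d X vs (\<lambda>b. c (u # b)) b' \<in> N" for u
      by (rule IH) (rule Cons.prems)
    have 2: "X v (c (True # b')) \<in> N"
      using stable_act[OF Cons.prems(1) Cons.prems(2)] by simp
    show ?thesis
      using stable_uminus[OF st 1] stable_add[OF st 1 2] Cons by simp
  qed
qed

lemma koszul_d_chain_0: "c \<in> koszul_chain (length vs) 0 N \<Longrightarrow> koszul_d X vs c b = 0"
proof (induction vs arbitrary: b c)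
  case (Cons v vs)
  have F: "(\<lambda>b. c (False # b)) \<in> koszul_chain (length vs) 0 N"
    using Cons.prems by (auto intro: chain_False)
  have T: "c (True # b) = 0" for b
    using Cons.prems by (auto intro: chain_0_True)
  show ?case using Cons.IH[OF F] by (auto simp: T split: list.split)
qed simp

lemma koszul_d_chain:
  assumes "stable_under X (set vs) N" "c \<in> koszul_chain (length vs) (Suc k) N"
  shows "koszul_d X vs c \<in> koszul_chain (length vs) k N"
proof (rule chainI)
  show "koszul_d X vs c b \<in> N" for b
    using koszul_d_closed[OF assms(1)] chain_mem[OF assms(2)] by blast
  show "length b = length vs \<and> count_list b True = k" if "koszul_d X vs c b \<noteq> 0" for b
    using assms(2) that
  proof (induction vs arbitrary: b c k)
    case (Cons v vs)
    have F: "(\<lambda>b. c (False # b)) \<in> koszul_chain (length vs) (Suc k) N"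
      using Cons.prems by (auto intro: chain_False)
    have T: "(\<lambda>b. c (True # b)) \<in> koszul_chain (length vs) k N"
      using Cons.prems by (auto intro: chain_True)
    obtain t b' where b: "b = t # b'"
      using Cons.prems(2) by (cases b) auto
    show ?case
    proof (cases t)
      case True
      with Cons.prems b have nz: "koszul_d X vs (\<lambda>b. c (True # b)) b' \<noteq> 0" by simp
      then obtain k' where k: "k = Suc k'"
        using koszul_d_chain_0 T by (cases k) auto
      show ?thesis
        using Cons.IH[OF T[unfolded k] nz] b k True by simp
    next
      case False
      with Cons.prems b
      have "koszul_d X vs (\<lambda>b. c (False # b)) b' \<noteq> 0 \<or> c (True # b') \<noteq> 0" by auto
      then show ?thesis
      proof
        assume "koszul_d X vs (\<lambda>b. c (False # b)) b' \<noteq> 0"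
        from Cons.IH[OF F this] show ?thesis using b False by simp
      next
        assume "c (True # b') \<noteq> 0"
        from chain_supp[OF T this] show ?thesis using b False by simp
      qed
    qed
  qed simp
qed

text \<open>Acyclicity of the Koszul complex in positive degrees, by induction along the mapping
  cone: the \<open>True\<close> component \<open>c1\<close> of a cycle is bounded first, then the
  \<open>False\<close> component corrected by \<open>X v\<close>.\<close>

lemma exact_if_regular:
  assumes "stable_under X (set vs) N" "regular_sequence X vs N" "c \<in> koszul_chain (length vs) (Suc k) N"
    and "\<And>b. koszul_d X vs c b = 0"
  shows "\<exists>e\<in>koszul_chain (length vs) (Suc (Suc k)) N. \<forall>b. c b = koszul_d X vs e b"
  using assms
proof (induction vs arbitrary: c k)
  case Nil
  have "c b = 0" for b
    using chain_supp[OF Nil(3), of b] by (cases b) auto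
  moreover have "(\<lambda>b. 0) \<in> koszul_chain 0 (Suc (Suc k)) N"
    using stable_zero[OF Nil(1)] by (auto intro: chainI)
  ultimately show ?case by fastforce
next
  case (Cons v vs)
  let ?n = "length vs"
  have st: "stable_under X (set vs) N"
    using Cons.prems(1) by (auto simp: stable_under_def)
  define c0 where "c0 = (\<lambda>b. c (False # b))"
  define c1 where "c1 = (\<lambda>b. c (True # b))"
  have c0: "c0 \<in> koszul_chain ?n (Suc k) N"
    unfolding c0_def using Cons.prems by (auto intro: chain_False)
  have c1: "c1 \<in> koszul_chain ?n k N"
    unfolding c1_def using Cons.prems by (auto intro: chain_True)
  have kd1: "koszul_d X vs c1 b = 0" for b
    using Cons.prems(4)[of "True # b"] by (simp add: c1_def)
  have kd0: "koszul_d X vs c0 b + X v (c1 b) = 0" for b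
    using Cons.prems(4)[of "False # b"] by (simp add: c1_def c0_def)
  \<comment> \<open>The component \<open>c1\<close> is a cycle of degree \<open>k\<close>. For
    positive \<open>k\<close> the induction hypothesis applies. In degree 0 every chain is a cycle,
    and it is regularity of \<open>v\<close> that makes \<open>c1\<close> a boundary.\<close>
  have "\<exists>e1\<in>koszul_chain ?n (Suc k) N. \<forall>b. c1 b = koszul_d X vs e1 b"
  proof (cases k)
    case 0
    let ?r = "replicate ?n False"
    have "X v (c1 ?r) = koszul_d X vs (\<lambda>b. - c0 b) ?r"
      using kd0[of ?r] by (simp add: koszul_d_uminus eq_neg_iff_add_eq_0 add.commute)
    moreover have "(\<lambda>b. - c0 b) \<in> koszul_chain ?n 1 N"
      using c0 0 stable_uminus[OF st] by (auto simp: koszul_chain_def)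
    ultimately have "X v (c1 ?r) \<in> var_span X vs N"
      by (auto simp: var_span_def)
    with Cons.prems(2) have "c1 ?r \<in> var_span X vs N"
      using chain_mem[OF c1] by simp
    then obtain e where e: "e \<in> koszul_chain ?n (Suc 0) N" "c1 ?r = koszul_d X vs e ?r"
      by (auto simp: var_span_def)
    have "c1 b = koszul_d X vs e b" for b
    proof (cases "b = ?r")
      case False
      then have "\<not> (length b = ?n \<and> count_list b True = 0)"
        by (simp add: length_0_count)
      then show ?thesis
        using chain_supp[OF c1, of b] chain_supp[OF koszul_d_chain[OF st e(1)], of b] 0
        by metis
    qed (use e in simp)
    then show ?thesis using e 0 by auto
  next
    case (Suc k')
    show ?thesis
      using Cons.IH[OF st _ c1[unfolded Suc]] Cons.prems(2) kd1 Suc by auto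
  qed
  then obtain e1 where e1: "e1 \<in> koszul_chain ?n (Suc k) N" "\<And>b. c1 b = koszul_d X vs e1 b"
    by auto
  have ch: "(\<lambda>b. c0 b + X v (e1 b)) \<in> koszul_chain ?n (Suc k) N"
  proof (rule chainI)
    show "c0 b + X v (e1 b) \<in> N" for b
      using stable_add[OF st chain_mem[OF c0]] stable_act[OF Cons.prems(1) chain_mem[OF e1(1)]]
      by simp
    show "length b = ?n \<and> count_list b True = Suc k" if "c0 b + X v (e1 b) \<noteq> 0" for b
      using that chain_supp[OF c0, of b] chain_supp[OF e1(1), of b] by fastforce
  qed
  have "koszul_d X vs (\<lambda>b. c0 b + X v (e1 b)) b = 0" for b
    using kd0[of b] by (simp add: koszul_d_add koszul_d_act e1(2))
  with Cons.IH[OF st _ ch] Cons.prems(2) obtain e0 where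
    e0: "e0 \<in> koszul_chain ?n (Suc (Suc k)) N" "\<And>b. c0 b + X v (e1 b) = koszul_d X vs e0 b"
    by auto
  \<comment> \<open>The sign of \<open>e1\<close> compensates the one that \<open>koszul_d\<close>
    puts on the \<open>True\<close> component.\<close>
  define e where "e = (\<lambda>b. case b of [] \<Rightarrow> 0 | t # b' \<Rightarrow> if t then - e1 b' else e0 b')"
  have "e \<in> koszul_chain (length (v # vs)) (Suc (Suc k)) N"
  proof (rule chainI)
    show "e b \<in> N" for b
      using stable_zero[OF st] stable_uminus[OF st chain_mem[OF e1(1)]] chain_mem[OF e0(1)]
      by (auto simp: e_def split: list.split)
    show "length b = length (v # vs) \<and> count_list b True = Suc (Suc k)" if "e b \<noteq> 0" for b
      using that chain_supp[OF e1(1)] chain_supp[OF e0(1)]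
      by (auto simp: e_def split: list.splits if_splits)
  qed
  moreover have "c b = koszul_d X (v # vs) e b" for b
  proof (cases b)
    case Nil
    then show ?thesis using chain_supp[OF Cons.prems(3), of b] by auto
  next
    case (Cons t b')
    have "c0 b' = koszul_d X vs e0 b' - X v (e1 b')" for b'
      by (simp add: e0(2)[symmetric])
    then show ?thesis
      using Cons e1(2)[of b'] by (auto simp: e_def koszul_d_uminus c0_def c1_def)
  qed
  ultimately show ?case by blast
qed

end

section \<open>Shifting Koszul homology along an epimorphism\<close>

text \<open>An epimorphism \<open>F \<rightarrow> N/B\<close> given by a choice of representatives, which is additive and linear
  only modulo \<open>B\<close>.\<close>
locale commuting_operators_map =
  src: commuting_operators X + tgt: commuting_operators Y
  for X :: "'v \<Rightarrow> 'm::ab_group_add \<Rightarrow> 'm" and Y :: "'v \<Rightarrow> 'n::ab_group_add \<Rightarrow> 'n" +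
  fixes W :: "'v set" and F :: "'m set" and B :: "'n set" and N :: "'n set" and \<delta> :: "'m \<Rightarrow> 'n"
  assumes F: "stable_under X W F" and B: "stable_under Y W B" and N: "stable_under Y W N"
    and delta_zero: "\<delta> 0 = 0"
    and delta_add: "\<lbrakk>a \<in> F; b \<in> F\<rbrakk> \<Longrightarrow> \<delta> (a + b) - (\<delta> a + \<delta> b) \<in> B"
    and delta_act: "\<lbrakk>a \<in> F; v \<in> W\<rbrakk> \<Longrightarrow> \<delta> (X v a) - Y v (\<delta> a) \<in> B"
    and delta_mem: "a \<in> F \<Longrightarrow> \<delta> a \<in> N"
    and delta_surj: "n \<in> N \<Longrightarrow> \<exists>a\<in>F. n - \<delta> a \<in> B"
    and B_sub: "B \<subseteq> N"
begin

definition Z :: "'m set" where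
  "Z = {a \<in> F. \<delta> a \<in> B}"

lemma B_cong: "a \<in> B \<Longrightarrow> a - b \<in> B \<Longrightarrow> b \<in> B"
  using stable_diff[OF B, of a "a - b"] by simp

lemma B_cong': "b \<in> B \<Longrightarrow> a - b \<in> B \<Longrightarrow> a \<in> B"
  using stable_add[OF B, of "a - b" b] by simp

lemma B_trans: "a - b \<in> B \<Longrightarrow> b - c \<in> B \<Longrightarrow> a - c \<in> B"
  using stable_add[OF B, of "a - b" "b - c"] by simp

lemma B_sym: "a - b \<in> B \<Longrightarrow> b - a \<in> B"
  using stable_uminus[OF B, of "a - b"] by simp

lemma delta_uminus:
  assumes "a \<in> F" shows "\<delta> (- a) - (- \<delta> a) \<in> B"
proof -
  have "\<delta> (a + - a) - (\<delta> a + \<delta> (- a)) \<in> B"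
    using assms stable_uminus[OF F] by (intro delta_add)
  from stable_uminus[OF B this] show ?thesis
    by (simp add: delta_zero add.commute)
qed

lemma delta_diff:
  assumes "a \<in> F" "b \<in> F" shows "\<delta> (a - b) - (\<delta> a - \<delta> b) \<in> B"
proof -
  have 1: "\<delta> (a + - b) - (\<delta> a + \<delta> (- b)) \<in> B"
    using assms stable_uminus[OF F] by (intro delta_add)
  show ?thesis
    using stable_add[OF B 1 delta_uminus[OF assms(2)]] by (simp add: algebra_simps)
qed

lemma koszul_d_delta:
  assumes "\<And>b. c b \<in> F" "set vs \<subseteq> W"
  shows "koszul_d Y vs (\<lambda>b. \<delta> (c b)) b - \<delta> (koszul_d X vs c b) \<in> B"
  using assms
proof (induction vs arbitrary: b c)
  case Nil
  then show ?case using stable_zero[OF B] by (simp add: delta_zero)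
next
  case (Cons v vs)
  have sub: "set vs \<subseteq> W" "v \<in> W" using Cons.prems by auto
  show ?case
  proof (cases b)
    case Nil
    then show ?thesis using stable_zero[OF B] by (simp add: delta_zero)
  next
    case (Cons t b')
    let ?c = "\<lambda>t b. c (t # b)"
    have kF: "koszul_d X vs (?c t) b' \<in> F" for t
      by (rule src.koszul_d_closed[OF stable_subset[OF F sub(1)]]) (rule Cons.prems(1))
    have IH: "koszul_d Y vs (\<lambda>b. \<delta> (?c t b)) b' - \<delta> (koszul_d X vs (?c t) b') \<in> B" for t
      by (rule Cons.IH) (use Cons.prems sub in auto)
    show ?thesis
    proof (cases t)
      case True
      have 1: "- (koszul_d Y vs (\<lambda>b. \<delta> (?c True b)) b') - (- \<delta> (koszul_d X vs (?c True) b')) \<in> B"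
        using stable_uminus[OF B IH[of True]] by (simp add: algebra_simps)
      show ?thesis
        using B_trans[OF 1 B_sym[OF delta_uminus[OF kF[of True]]]] True Cons by simp
    next
      case False
      have 2: "Y v (\<delta> (c (True # b'))) - \<delta> (X v (c (True # b'))) \<in> B"
        by (rule B_sym[OF delta_act[OF Cons.prems(1) sub(2)]])
      have 3: "(\<delta> (koszul_d X vs (?c False) b') + \<delta> (X v (c (True # b')))) -
          \<delta> (koszul_d X vs (?c False) b' + X v (c (True # b'))) \<in> B"
        by (rule B_sym[OF delta_add[OF kF stable_act[OF F Cons.prems(1) sub(2)]]])
      have "(koszul_d Y vs (\<lambda>b. \<delta> (?c False b)) b' + Y v (\<delta> (c (True # b')))) -
          \<delta> (koszul_d X vs (?c False) b' + X v (c (True # b'))) \<in> B"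
        using stable_add[OF B stable_add[OF B IH[of False] 2] 3]
        by (simp add: algebra_simps)
      then show ?thesis using False Cons by simp
    qed
  qed
qed

lemma lift_chain:
  assumes "c \<in> koszul_chain n k N"
  shows "\<exists>e\<in>koszul_chain n k F. \<forall>b. c b - \<delta> (e b) \<in> B"
proof -
  \<comment> \<open>Zero coefficients are lifted to zero, which keeps the support and hence the
    degree of the chain.\<close>
  have "\<exists>a\<in>F. c b - \<delta> a \<in> B \<and> (c b = 0 \<longrightarrow> a = 0)" for b
    using delta_surj[OF chain_mem[OF assms, of b]] stable_zero[OF F] stable_zero[OF B]
    by (cases "c b = 0") (auto simp: delta_zero)
  then obtain e where e: "\<And>b. e b \<in> F" "\<And>b. c b - \<delta> (e b) \<in> B" "\<And>b. c b = 0 \<Longrightarrow> e b = 0"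
    by metis
  have "e \<in> koszul_chain n k F"
    using e(1,3) chain_supp[OF assms] by (intro chainI) auto
  with e show ?thesis by auto
qed

lemma delta_chain: "e \<in> koszul_chain n k F \<Longrightarrow> (\<lambda>b. \<delta> (e b)) \<in> koszul_chain n k N"
  by (rule chainI) (use delta_mem delta_zero chain_mem chain_supp in \<open>metis+\<close>)

text \<open>A piece of the long exact sequence of \<open>0 -> Z -> F -> N/B -> 0\<close>: if
  \<open>H_(k+1)(N/B)\<close> vanishes and \<open>H_k(Z) -> H_k(F)\<close> is zero, then
  \<open>H_k(Z)\<close> vanishes. The condition \<open>ex\<close> on the map is stated separately
  because \<open>F\<close> has homology in degree 0.\<close>

lemma acyclic_shift_kernel:
  assumes vs: "set vs \<subseteq> W" and ac: "acyclic_at Y vs (Suc k) N B"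
    and ex: "\<And>z. z \<in> koszul_chain (length vs) k Z \<Longrightarrow> (\<And>b. koszul_d X vs z b = 0) \<Longrightarrow>
      \<exists>w\<in>koszul_chain (length vs) (Suc k) F. \<forall>b. z b = koszul_d X vs w b"
  shows "acyclic_at X vs k Z {0}"
  unfolding acyclic_at_def
proof (intro ballI impI)
  fix z assume z: "z \<in> koszul_chain (length vs) k Z" "\<forall>b. koszul_d X vs z b \<in> {0}"
  then obtain w where w: "w \<in> koszul_chain (length vs) (Suc k) F" "\<And>b. z b = koszul_d X vs w b"
    using ex[OF z(1)] z(2) by auto
  let ?w = "\<lambda>b. \<delta> (w b)"
  have "koszul_d Y vs ?w b \<in> B" for b
  proof (rule B_cong')
    show "\<delta> (z b) \<in> B" using chain_mem[OF z(1)] by (simp add: Z_def)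
    show "koszul_d Y vs ?w b - \<delta> (z b) \<in> B"
      using koszul_d_delta[OF chain_mem[OF w(1)] vs] by (simp add: w(2))
  qed
  then obtain y where y: "y \<in> koszul_chain (length vs) (Suc (Suc k)) N" "\<And>b. ?w b - koszul_d Y vs y b \<in> B"
    using ac delta_chain[OF w(1)] unfolding acyclic_at_def by meson
  obtain e where e: "e \<in> koszul_chain (length vs) (Suc (Suc k)) F" "\<And>b. y b - \<delta> (e b) \<in> B"
    using lift_chain[OF y(1)] by auto
  have ke: "koszul_d X vs e \<in> koszul_chain (length vs) (Suc k) F"
    using src.koszul_d_chain[OF stable_subset[OF F vs] e(1)] .
  \<comment> \<open>The image of \<open>w\<close> is a cycle of \<open>N/B\<close>, hence bounds.
    Subtracting the lifted boundary moves \<open>w\<close> into \<open>Z\<close> without changing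
    its own boundary \<open>z\<close>.\<close>
  have Zm: "w b - koszul_d X vs e b \<in> Z" for b
  proof -
    have F1: "w b \<in> F" "koszul_d X vs e b \<in> F"
      using chain_mem[OF w(1)] chain_mem[OF ke] by auto
    have "koszul_d Y vs (\<lambda>b. y b - \<delta> (e b)) b \<in> B"
      using tgt.koszul_d_closed[OF stable_subset[OF B vs] e(2)] .
    then have 1: "koszul_d Y vs y b - koszul_d Y vs (\<lambda>b. \<delta> (e b)) b \<in> B"
      by (simp add: tgt.koszul_d_diff)
    have 2: "\<delta> (w b) - \<delta> (koszul_d X vs e b) \<in> B"
      using B_trans[OF B_trans[OF y(2) 1] koszul_d_delta[OF chain_mem[OF e(1)] vs]] .
    then show ?thesis
      using B_cong'[OF 2 delta_diff[OF F1]] stable_diff[OF F F1] by (simp add: Z_def)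
  qed
  have "(\<lambda>b. w b - koszul_d X vs e b) \<in> koszul_chain (length vs) (Suc k) Z"
    using chain_diff[OF F w(1) ke] Zm by (auto simp: koszul_chain_def)
  moreover have "z b - koszul_d X vs (\<lambda>b. w b - koszul_d X vs e b) b = 0" for b
    by (simp add: src.koszul_d_diff w(2))
  ultimately show "\<exists>e\<in>koszul_chain (length vs) (Suc k) Z. \<forall>b. z b - koszul_d X vs e b \<in> {0}"
    by auto
qed

text \<open>The opposite direction of the same sequence: \<open>H_k(Z)\<close> and
  \<open>H_(k+1)(F)\<close> vanish, the latter by regularity, so \<open>H_(k+1)(N/B)\<close>
  vanishes.\<close>

lemma acyclic_shift_image:
  assumes vs: "set vs \<subseteq> W" and ac: "acyclic_at X vs k Z {0}"
    and reg: "regular_sequence X vs F"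
  shows "acyclic_at Y vs (Suc k) N B"
  unfolding acyclic_at_def
proof (intro ballI impI)
  fix c assume c: "c \<in> koszul_chain (length vs) (Suc k) N" "\<forall>b. koszul_d Y vs c b \<in> B"
  have Fv: "stable_under X (set vs) F" using stable_subset[OF F vs] .
  obtain w where w: "w \<in> koszul_chain (length vs) (Suc k) F" "\<And>b. c b - \<delta> (w b) \<in> B"
    using lift_chain[OF c(1)] by auto
  have kw: "koszul_d X vs w \<in> koszul_chain (length vs) k F"
    using src.koszul_d_chain[OF Fv w(1)] .
  have "koszul_d X vs w b \<in> Z" for b
  proof -
    have "koszul_d Y vs (\<lambda>b. c b - \<delta> (w b)) b \<in> B"
      using tgt.koszul_d_closed[OF stable_subset[OF B vs] w(2)] .
    then have "koszul_d Y vs c b - koszul_d Y vs (\<lambda>b. \<delta> (w b)) b \<in> B"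
      by (simp add: tgt.koszul_d_diff)
    from B_trans[OF this koszul_d_delta[OF chain_mem[OF w(1)] vs]]
    have "\<delta> (koszul_d X vs w b) \<in> B"
      using B_cong c(2) by blast
    then show ?thesis using chain_mem[OF kw] by (simp add: Z_def)
  qed
  then have "koszul_d X vs w \<in> koszul_chain (length vs) k Z"
    using kw by (auto simp: koszul_chain_def)
  then obtain z where z: "z \<in> koszul_chain (length vs) (Suc k) Z" "\<And>b. koszul_d X vs w b - koszul_d X vs z b = 0"
    using ac unfolding acyclic_at_def by fastforce
  have zF: "z \<in> koszul_chain (length vs) (Suc k) F"
    using z(1) by (rule chain_mono) (auto simp: Z_def)
  obtain y where y: "y \<in> koszul_chain (length vs) (Suc (Suc k)) F" "\<And>b. w b - z b = koszul_d X vs y b"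
    using src.exact_if_regular[OF Fv reg chain_diff[OF F w(1) zF]] z(2)
    by (auto simp: src.koszul_d_diff)
  have "c b - koszul_d Y vs (\<lambda>b. \<delta> (y b)) b \<in> B" for b
  proof -
    have F1: "w b \<in> F" "z b \<in> F"
      using chain_mem[OF w(1)] chain_mem[OF zF] by auto
    have zB: "\<delta> (z b) \<in> B" using chain_mem[OF z(1)] by (simp add: Z_def)
    have 1: "\<delta> (koszul_d X vs y b) - (\<delta> (w b) - \<delta> (z b)) \<in> B"
      using delta_diff[OF F1] by (simp add: y(2))
    have 2: "koszul_d Y vs (\<lambda>b. \<delta> (y b)) b - \<delta> (koszul_d X vs y b) \<in> B"
      using koszul_d_delta[OF chain_mem[OF y(1)] vs] .
    have 3: "\<delta> (w b) - \<delta> (z b) - \<delta> (w b) \<in> B"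
      using stable_uminus[OF B zB] by simp
    show ?thesis
      using B_sym[OF B_trans[OF B_trans[OF B_trans[OF 2 1] 3] B_sym[OF w(2)]]] .
  qed
  then show "\<exists>e\<in>koszul_chain (length vs) (Suc (Suc k)) N. \<forall>b. c b - koszul_d Y vs e b \<in> B"
    using delta_chain[OF y(1)] by auto
qed

end

section \<open>Squarefree monomial ideals\<close>

abbreviation "keys \<equiv> Poly_Mapping.keys"
abbreviation "lookup \<equiv> Poly_Mapping.lookup"
abbreviation "single \<equiv> Poly_Mapping.single"

lemma lookup_single_mult_add:
  "lookup (single m c * p) (m + e) = (c::'k::comm_ring_1) * lookup p e"
  for m :: "'v \<Rightarrow>\<^sub>0 nat"
  by (simp add: lookup_mult lookup_single when_mult)

lemma lookup_single_mult_other: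
  fixes m :: "'v \<Rightarrow>\<^sub>0 nat"
  assumes "\<And>e'. e \<noteq> m + e'"
  shows "lookup (single m c * p) e = (0::'k::comm_ring_1)"
  using assms by (simp add: lookup_mult lookup_single when_mult)

lemma keys_add_nat: "keys (m + e) = keys m \<union> keys e"
  for m :: "'v \<Rightarrow>\<^sub>0 nat"
  by (auto simp: in_keys_iff lookup_add)

definition mexp :: "'v set \<Rightarrow> 'v \<Rightarrow>\<^sub>0 nat" where
  "mexp T = (\<Sum>x\<in>T. single x 1)"

lemma lookup_mexp: "finite T \<Longrightarrow> lookup (mexp T) x = (if x \<in> T then 1 else 0)"
  by (simp add: mexp_def lookup_sum lookup_single when_def)

lemma keys_mexp [simp]: "finite T \<Longrightarrow> keys (mexp T) = T"
  by (auto simp: in_keys_iff lookup_mexp split: if_splits)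

lemma mexp_add_diff: 
  assumes "finite T" "T \<subseteq> keys k" shows "mexp T + (k - mexp T) = k"
proof (rule poly_mapping_eqI)
  fix x
  show "lookup (mexp T + (k - mexp T)) x = lookup k x"
    using assms by (auto simp: lookup_add lookup_minus lookup_mexp in_keys_iff Suc_leI)
qed

lemma mexp_singleton: "mexp {v} = single v 1"
  by (simp add: mexp_def)

lemma mexp_Un_disjoint: "finite T \<Longrightarrow> finite U \<Longrightarrow> T \<inter> U = {} \<Longrightarrow> mexp (T \<union> U) = mexp T + mexp U"
  by (simp add: mexp_def sum.union_disjoint)

definition polys :: "'v set \<Rightarrow> ('v, 'k::field) mpoly set" where
  "polys V = {p. \<forall>m\<in>keys p. keys m \<subseteq> V}"

lemma polys_zero [simp]: "0 \<in> polys V"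
  and polys_one [simp]: "1 \<in> polys V"
  by (auto simp: polys_def)

lemma polys_single: "keys m \<subseteq> V \<Longrightarrow> single m c \<in> polys V"
  by (auto simp: polys_def)

lemma polys_uminus: "p \<in> polys V \<Longrightarrow> - p \<in> polys V"
  by (auto simp: polys_def in_keys_iff)

lemma polys_add: 
  assumes "p \<in> polys V" "q \<in> polys V" shows "p + q \<in> polys V"
  using assms Poly_Mapping.keys_add[of p q] unfolding polys_def by blast

lemma polys_diff: "p \<in> polys V \<Longrightarrow> q \<in> polys V \<Longrightarrow> p - q \<in> polys V"
  using polys_add[of p V "- q"] polys_uminus[of q V] by simp

lemma polys_mult: 
  assumes "p \<in> polys V" "q \<in> polys V" shows "p * q \<in> polys V"
  unfolding polys_def
proof (intro CollectI ballI)
  fix m assume "m \<in> keys (p * q)"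
  then obtain a b where "a \<in> keys p" "b \<in> keys q" "m = a + b"
    using keys_mult[of p q] by blast
  then show "keys m \<subseteq> V"
    using assms by (auto simp: polys_def keys_add_nat)
qed

lemma polys_var: "v \<in> V \<Longrightarrow> var v \<in> polys V"
  unfolding var_def by (rule polys_single) simp

lemma polys_sum: "(\<And>i. i \<in> A \<Longrightarrow> f i \<in> polys V) \<Longrightarrow> sum f A \<in> polys V"
  by (induction A rule: infinite_finite_induct) (auto intro: polys_add)

lemma polys_split_monomial:
  assumes "p \<in> polys V"
  obtains q r where "q \<in> polys V" "r \<in> polys V" "p = q + single m 1 * r"
    "\<And>k. k \<in> keys q \<Longrightarrow> k \<in> keys p \<and> (\<forall>e. k \<noteq> m + e)"
proof -
  define r where "r = Poly_Mapping.map_key (\<lambda>e. m + e) p"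
  define q where "q = p - single m 1 * r"
  have r: "lookup r e = lookup p (m + e)" for e
    unfolding r_def by (simp add: map_key.rep_eq inj_on_def)
  have lq: "lookup q k = (if \<exists>e. k = m + e then 0 else lookup p k)" for k
  proof (cases "\<exists>e. k = m + e")
    case True
    then show ?thesis by (auto simp: q_def lookup_minus lookup_single_mult_add r)
  next
    case False
    then have "lookup (single m 1 * r) k = 0"
      by (intro lookup_single_mult_other) auto
    with False show ?thesis by (auto simp: q_def lookup_minus)
  qed
  have kq: "k \<in> keys p \<and> (\<forall>e. k \<noteq> m + e)" if "k \<in> keys q" for k
    using that lq[of k] by (auto simp: in_keys_iff split: if_splits)
  show ?thesis
  proof (rule that[OF _ _ _ kq])
    show "q \<in> polys V" using kq assms by (auto simp: polys_def)
    show "r \<in> polys V"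
      unfolding polys_def
    proof (intro CollectI ballI)
      fix e assume "e \<in> keys r"
      then have "m + e \<in> keys p" by (simp add: in_keys_iff r)
      then have "keys (m + e) \<subseteq> V" using assms by (simp add: polys_def)
      then show "keys e \<subseteq> V" by (simp add: keys_add_nat)
    qed
    show "p = q + single m 1 * r" by (simp add: q_def)
  qed
qed

text \<open>Divisibility by a squarefree monomial depends on supports only, so membership is decided
  monomial by monomial. Agreement with the generated ideal is
  \<open>genideal_monomials\<close>.\<close>

definition monomial_ideal :: "'v set \<Rightarrow> 'v set set \<Rightarrow> ('v, 'k::field) mpoly set" where
  "monomial_ideal V \<Gamma> = {p \<in> polys V. \<forall>m\<in>keys p. \<exists>T\<in>\<Gamma>. T \<subseteq> keys m}"

lemma monomial_ideal_zero [simp]: "0 \<in> monomial_ideal V \<Gamma>"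
  by (simp add: monomial_ideal_def)

lemma monomial_ideal_uminus: "p \<in> monomial_ideal V \<Gamma> \<Longrightarrow> - p \<in> monomial_ideal V \<Gamma>"
  by (auto simp: monomial_ideal_def polys_uminus in_keys_iff)

lemma monomial_ideal_add: 
  assumes "p \<in> monomial_ideal V \<Gamma>" "q \<in> monomial_ideal V \<Gamma>" shows "p + q \<in> monomial_ideal V \<Gamma>"
  using assms Poly_Mapping.keys_add[of p q] polys_add[of p V q] unfolding monomial_ideal_def by blast

lemma monomial_ideal_diff:
  "p \<in> monomial_ideal V \<Gamma> \<Longrightarrow> q \<in> monomial_ideal V \<Gamma> \<Longrightarrow> p - q \<in> monomial_ideal V \<Gamma>"
  using monomial_ideal_add[of p V \<Gamma> "- q"] monomial_ideal_uminus[of q V \<Gamma>] by simp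

lemma monomial_ideal_mult:
  assumes "p \<in> polys V" "q \<in> monomial_ideal V \<Gamma>" shows "p * q \<in> monomial_ideal V \<Gamma>"
  unfolding monomial_ideal_def
proof (intro CollectI conjI ballI)
  show "p * q \<in> polys V" using assms by (auto simp: monomial_ideal_def intro: polys_mult)
  fix m assume "m \<in> keys (p * q)"
  then obtain a b where "b \<in> keys q" "m = a + b"
    using keys_mult[of p q] by blast
  moreover from this obtain T where "T \<in> \<Gamma>" "T \<subseteq> keys b"
    using assms(2) by (auto simp: monomial_ideal_def)
  ultimately show "\<exists>T\<in>\<Gamma>. T \<subseteq> keys m"
    by (auto simp: keys_add_nat)
qed

lemma monomial_ideal_insert:
  assumes "p \<in> monomial_ideal V (insert T \<Gamma>)" "finite T"
  obtains q r where "q \<in> monomial_ideal V \<Gamma>" "r \<in> polys V"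
    "p = q + single (mexp T) 1 * r"
proof -
  have pV: "p \<in> polys V" using assms(1) by (simp add: monomial_ideal_def)
  obtain q r where qr: "q \<in> polys V" "r \<in> polys V" "p = q + single (mexp T) 1 * r"
    "\<And>k. k \<in> keys q \<Longrightarrow> k \<in> keys p \<and> (\<forall>e. k \<noteq> mexp T + e)"
    using polys_split_monomial[OF pV, of "mexp T"] by metis
  have "\<exists>U\<in>\<Gamma>. U \<subseteq> keys k" if "k \<in> keys q" for k
  proof -
    have "\<not> T \<subseteq> keys k"
      using qr(4)[OF that] mexp_add_diff[OF assms(2), of k] by metis
    then show ?thesis using qr(4)[OF that] assms(1) by (auto simp: monomial_ideal_def)
  qed
  then have "q \<in> monomial_ideal V \<Gamma>" using qr(1) by (simp add: monomial_ideal_def)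
  then show ?thesis using that qr by blast
qed

text \<open>For squarefree generators, \<open>U\<close> divides the product exactly if
  \<open>U - T\<close> divides the other factor. Since \<open>T\<close> may leave \<open>V\<close>,
  membership of the product in the ring is a conjunct of its own.\<close>

lemma monomial_ideal_colon:
  assumes "r \<in> polys V" "finite T"
  shows "single (mexp T) 1 * r \<in> monomial_ideal V \<Gamma> \<longleftrightarrow>
    r \<in> monomial_ideal V ((\<lambda>U. U - T) ` \<Gamma>) \<and> single (mexp T) 1 * r \<in> polys V"
    (is "?x * r \<in> _ \<longleftrightarrow> _")
proof -
  have k: "mexp T + k \<in> keys (?x * r) \<longleftrightarrow> k \<in> keys r" for k
    by (simp add: in_keys_iff lookup_single_mult_add)
  have k': "\<exists>k\<in>keys r. e = mexp T + k" if "e \<in> keys (?x * r)" for e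
  proof -
    have "\<exists>k. e = mexp T + k"
      using lookup_single_mult_other[of e "mexp T" 1 r] that by (auto simp: in_keys_iff)
    then show ?thesis using that k by blast
  qed
  have "(\<forall>e\<in>keys (?x * r). \<exists>U\<in>\<Gamma>. U \<subseteq> keys e) \<longleftrightarrow>
      (\<forall>k\<in>keys r. \<exists>U\<in>\<Gamma>. U \<subseteq> keys (mexp T + k))"
  proof -
    have "keys (?x * r) = (\<lambda>k. mexp T + k) ` keys r"
    proof (intro equalityI subsetI)
      fix e assume "e \<in> keys (?x * r)"
      from k'[OF this] show "e \<in> (\<lambda>k. mexp T + k) ` keys r" by auto
    qed (use k in auto)
    then show ?thesis by simp
  qed
  also have "\<dots> \<longleftrightarrow> (\<forall>k\<in>keys r. \<exists>U\<in>(\<lambda>U. U - T) ` \<Gamma>. U \<subseteq> keys k)"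
    using assms(2) by (auto simp: keys_add_nat Diff_subset_conv)
  finally show ?thesis using assms(1) by (auto simp: monomial_ideal_def)
qed

text \<open>Elements of \<open>S^n\<close> are functions that vanish from index \<open>n\<close> on.
  In contrast to extensional functions they form a subgroup of a type with pointwise addition, as
  the Koszul part requires.\<close>

definition vecs :: "'v set \<Rightarrow> nat \<Rightarrow> (nat \<Rightarrow> ('v, 'k::field) mpoly) set" where
  "vecs V n = {u. (\<forall>j<n. u j \<in> polys V) \<and> (\<forall>j\<ge>n. u j = 0)}"

definition vmult :: "'v \<Rightarrow> (nat \<Rightarrow> ('v, 'k::field) mpoly) \<Rightarrow> nat \<Rightarrow> ('v, 'k) mpoly" where
  "vmult v u = (\<lambda>j. var v * u j)"

interpretation vmult: commuting_operators vmult
  by unfold_locales (auto simp: vmult_def algebra_simps)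

lemma vecs_nth: "u \<in> vecs V n \<Longrightarrow> u j \<in> polys V"
  by (cases "j < n") (auto simp: vecs_def)

lemma vecs_smult: "p \<in> polys V \<Longrightarrow> u \<in> vecs V n \<Longrightarrow> (\<lambda>j. p * u j) \<in> vecs V n"
  by (auto simp: vecs_def intro: polys_mult)

lemma vecs_add: "u \<in> vecs V n \<Longrightarrow> w \<in> vecs V n \<Longrightarrow> u + w \<in> vecs V n"
  by (auto simp: vecs_def intro: polys_add)

lemma stable_vecs: "stable_under vmult V (vecs V n)"
  unfolding stable_under_def
  by (auto simp: vmult_def intro: vecs_smult polys_var) (auto simp: vecs_def intro: polys_diff)

text \<open>A copy of the ideal inside \<open>S^1\<close>, so that \<open>S/I\<close> and the free
  modules have elements of one type.\<close>

definition vec_ideal :: "'v set \<Rightarrow> 'v set set \<Rightarrow> (nat \<Rightarrow> ('v, 'k::field) mpoly) set" where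
  "vec_ideal V \<Gamma> = {u \<in> vecs V 1. u 0 \<in> monomial_ideal V \<Gamma>}"

lemma stable_vec_ideal: "stable_under vmult V (vec_ideal V \<Gamma>)"
  using stable_vecs[of V 1] unfolding stable_under_def
  by (auto simp: vec_ideal_def vmult_def intro: monomial_ideal_diff monomial_ideal_mult polys_var)

lemma keys_var_mult:
  "k \<in> keys (var v * p) \<longleftrightarrow> (\<exists>e\<in>keys p. k = single v 1 + e)"
  for p :: "('v, 'k::field) mpoly"
proof
  assume k: "k \<in> keys (var v * p)"
  then obtain e where "k = single v 1 + e"
    using lookup_single_mult_other[of k "single v 1" 1 p]
    by (auto simp: in_keys_iff var_def)
  then show "\<exists>e\<in>keys p. k = single v 1 + e"
    using k by (auto simp: in_keys_iff var_def lookup_single_mult_add)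
next
  assume "\<exists>e\<in>keys p. k = single v 1 + e"
  then show "k \<in> keys (var v * p)"
    by (auto simp: in_keys_iff var_def lookup_single_mult_add)
qed

lemma var_span_vecs_sub:
  assumes "set vs \<subseteq> V" "e \<in> koszul_chain (length vs) 1 (vecs V n)"
    and "k \<in> keys (koszul_d vmult vs e (replicate (length vs) False) j)"
  shows "\<exists>v\<in>set vs. v \<in> keys k"
  using assms
proof (induction vs arbitrary: e)
  case (Cons v vs)
  let ?r = "replicate (length vs) False"
  have e0: "(\<lambda>b. e (False # b)) \<in> koszul_chain (length vs) 1 (vecs V n)"
    using Cons.prems(2) by (auto intro: chain_False)
  have "k \<in> keys (koszul_d vmult vs (\<lambda>b. e (False # b)) ?r j + var v * e (True # ?r) j)"
    using Cons.prems(3) by (simp add: vmult_def[of v])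
  then have "k \<in> keys (koszul_d vmult vs (\<lambda>b. e (False # b)) ?r j) \<or>
      k \<in> keys (var v * e (True # ?r) j)"
    by (rule UnE[OF subsetD[OF Poly_Mapping.keys_add] disjI1 disjI2])
  then show ?case
  proof
    assume "k \<in> keys (koszul_d vmult vs (\<lambda>b. e (False # b)) ?r j)"
    then show ?thesis using Cons.IH[OF _ e0] Cons.prems(1) by auto
  next
    assume "k \<in> keys (var v * e (True # ?r) j)"
    then show ?thesis by (auto simp: keys_var_mult keys_add_nat)
  qed
qed simp

text \<open>The part divisible by the first variable is split off in each coordinate; what remains
  must involve one of the later variables.\<close>

lemma vecs_in_var_span:
  assumes "set vs \<subseteq> V" "u \<in> vecs V n"
    and "\<And>j k. k \<in> keys (u j) \<Longrightarrow> \<exists>v\<in>set vs. v \<in> keys k"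
  shows "u \<in> var_span vmult vs (vecs V n)"
  using assms
proof (induction vs arbitrary: u)
  case Nil
  then have "u j = 0" for j
    using Nil(3)[of _ j] by (metis empty_iff keys_eq_empty equals0I list.set(1))
  then have "u = 0" by auto
  moreover have "(\<lambda>b. 0) \<in> koszul_chain 0 1 (vecs V n)"
    using stable_zero[OF stable_vecs] by (auto intro: chainI)
  ultimately show ?case by (auto simp: var_span_def zero_fun_def)
next
  case (Cons v vs)
  let ?r = "replicate (length vs) False"
  have "\<exists>q r. q \<in> polys V \<and> r \<in> polys V \<and> u j = q + var v * r \<and>
      (\<forall>k. k \<in> keys q \<longrightarrow> k \<in> keys (u j) \<and> (\<forall>e. k \<noteq> single v 1 + e))
      \<and> (j \<ge> n \<longrightarrow> q = 0 \<and> r = 0)" for j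
  proof (cases "j < n")
    case True
    show ?thesis
      using polys_split_monomial[OF vecs_nth[OF Cons.prems(2)], of j "single v 1"] True
      unfolding var_def by (metis not_le)
  next
    case False
    then have "u j = 0" using Cons.prems(2) by (simp add: vecs_def)
    then show ?thesis by (intro exI[of _ 0]) simp
  qed
  then obtain g h where gh: "\<And>j. g j \<in> polys V" "\<And>j. h j \<in> polys V" "\<And>j. u j = g j + var v * h j"
      "\<And>j k. k \<in> keys (g j) \<Longrightarrow> k \<in> keys (u j) \<and> (\<forall>e. k \<noteq> single v 1 + e)"
      "\<And>j. j \<ge> n \<Longrightarrow> g j = 0 \<and> h j = 0"
    by metis
  have gV: "g \<in> vecs V n" and hV: "h \<in> vecs V n" using gh by (auto simp: vecs_def)
  have "g \<in> var_span vmult vs (vecs V n)"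
  proof (rule Cons.IH[OF _ gV])
    fix j k assume k: "k \<in> keys (g j)"
    then have "v \<notin> keys k"
      using gh(4)[OF k] mexp_add_diff[of "{v}" k, unfolded mexp_singleton]
      by (metis empty_subsetI finite.emptyI finite.insertI insert_subset)
    then show "\<exists>v\<in>set vs. v \<in> keys k"
      using Cons.prems(3) gh(4)[OF k] by fastforce
  qed (use Cons.prems in auto)
  then obtain e0 where e0: "e0 \<in> koszul_chain (length vs) 1 (vecs V n)" "g = koszul_d vmult vs e0 ?r"
    by (auto simp: var_span_def)
  \<comment> \<open>The quotient \<open>h\<close> is placed at the singleton subset containing only
    \<open>v\<close>.\<close>
  define e where "e = (\<lambda>b. case b of [] \<Rightarrow> 0 | t # b' \<Rightarrow> if t then (if b' = ?r then h else 0) else e0 b')"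
  have z: "0 \<in> vecs V n" using stable_zero[OF stable_vecs] .
  have "e \<in> koszul_chain (length (v # vs)) 1 (vecs V n)"
  proof (rule chainI)
    show "e b \<in> vecs V n" for b
      using z hV chain_mem[OF e0(1)] by (auto simp: e_def split: list.split)
    show "length b = length (v # vs) \<and> count_list b True = 1" if "e b \<noteq> 0" for b
    proof -
      obtain t b' where b: "b = t # b'" using \<open>e b \<noteq> 0\<close> by (cases b) (auto simp: e_def)
      show ?thesis
      proof (cases t)
        case True
        then have "b' = ?r" using \<open>e b \<noteq> 0\<close> b by (auto simp: e_def split: if_splits)
        then show ?thesis using True b length_0_count[of b' "length vs"] by simp
      next
        case False
        then have "e0 b' \<noteq> 0" using \<open>e b \<noteq> 0\<close> b by (auto simp: e_def)
        then show ?thesis using False b chain_supp[OF e0(1)] by auto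
      qed
    qed
  qed
  moreover have "u = koszul_d vmult (v # vs) e (replicate (length (v # vs)) False)"
    using gh(3) e0(2) by (auto simp: e_def vmult_def fun_eq_iff)
  ultimately show ?case unfolding var_span_def by blast
qed

lemma var_span_vecs:
  assumes "set vs \<subseteq> V"
  shows "var_span vmult vs (vecs V n) =
    {u \<in> vecs V n. \<forall>j. \<forall>k\<in>keys (u j). \<exists>v\<in>set vs. v \<in> keys k}"
proof -
  have "u \<in> vecs V n" if "u \<in> var_span vmult vs (vecs V n)" for u
  proof -
    obtain e where "e \<in> koszul_chain (length vs) 1 (vecs V n)" "u = koszul_d vmult vs e (replicate (length vs) False)"
      using \<open>u \<in> var_span vmult vs (vecs V n)\<close> by (auto simp: var_span_def)
    then show ?thesis
      using vmult.koszul_d_closed[OF stable_subset[OF stable_vecs assms], of e n] chain_mem by blast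
  qed
  moreover have "\<exists>v\<in>set vs. v \<in> keys k"
    if "u \<in> var_span vmult vs (vecs V n)" "k \<in> keys (u j)" for u j k
    using that var_span_vecs_sub[OF assms] unfolding var_span_def by blast
  ultimately show ?thesis
    using vecs_in_var_span[OF assms] by blast
qed

text \<open>If \<open>v\<close> times a monomial involves a variable other than \<open>v\<close>, so
  does the monomial itself.\<close>

lemma regular_vecs:
  assumes "set vs \<subseteq> V" "distinct vs"
  shows "regular_sequence vmult vs (vecs V n)"
  using assms
proof (induction vs)
  case (Cons v vs)
  have "a \<in> var_span vmult vs (vecs V n)"
    if a: "a \<in> vecs V n" "vmult v a \<in> var_span vmult vs (vecs V n)" for a
  proof (rule vecs_in_var_span)
    fix j k assume "k \<in> keys (a j)"
    then have "single v 1 + k \<in> keys (vmult v a j)"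
      by (auto simp: vmult_def keys_var_mult)
    then have "\<exists>w\<in>set vs. w \<in> keys (single v 1 + k)"
      using a(2) var_span_vecs[of vs V n] Cons.prems(1) by auto
    then show "\<exists>w\<in>set vs. w \<in> keys k"
      using Cons.prems(2) by (auto simp: keys_add_nat)
  qed (use Cons.prems a in auto)
  then show ?case using Cons by auto
qed simp

section \<open>Vanishing of Koszul homology from certificates\<close>

text \<open>The long exact sequence of \<open>0 \<rightarrow> S/(J : f) \<rightarrow> S/J \<rightarrow> S/(J + f) \<rightarrow> 0\<close> with \<open>f\<close> the squarefree
  monomial supported on \<open>T\<close>, reduced to the chase that is needed.\<close>
lemma acyclic_insert:
  fixes V :: "'v set" and N :: "(nat \<Rightarrow> ('v, 'k::field) mpoly) set"
  defines "N \<equiv> vecs V 1"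
  assumes T: "finite T" "T \<subseteq> V" and vs: "set vs \<subseteq> V"
    and ac1: "acyclic_at vmult vs (Suc i) N (vec_ideal V \<Gamma>)"
    and ac2: "acyclic_at vmult vs i N (vec_ideal V ((\<lambda>U. U - T) ` \<Gamma>))"
  shows "acyclic_at vmult vs (Suc i) N (vec_ideal V (insert T \<Gamma>))"
  unfolding acyclic_at_def N_def
proof (intro ballI impI)
  let ?n = "length vs" and ?N = "vecs V 1 :: (nat \<Rightarrow> ('v, 'k) mpoly) set"
  note ac1 = ac1[unfolded N_def] and ac2 = ac2[unfolded N_def]
  define f :: "('v, 'k) mpoly" where "f = single (mexp T) 1"
  define fm where "fm u = (\<lambda>j::nat. f * u j)" for u
  have fV: "f \<in> polys V" using T unfolding f_def by (intro polys_single) simp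
  have stN: "stable_under vmult (set vs) ?N" by (rule stable_subset[OF stable_vecs vs])
  fix c :: "bool list \<Rightarrow> nat \<Rightarrow> ('v, 'k) mpoly"
  assume c: "c \<in> koszul_chain ?n (Suc i) ?N" "\<forall>b. koszul_d vmult vs c b \<in> vec_ideal V (insert T \<Gamma>)"
  have kc: "koszul_d vmult vs c \<in> koszul_chain ?n i ?N" by (rule vmult.koszul_d_chain[OF stN c(1)])
  \<comment> \<open>Modulo \<open>J\<close> the boundary of \<open>c\<close> is a multiple of
    \<open>f\<close>. The clause about zero makes the cofactors form a chain of degree
    \<open>i\<close>.\<close>
  have "\<exists>\<beta>\<in>?N. koszul_d vmult vs c b - fm \<beta> \<in> vec_ideal V \<Gamma> \<and> (koszul_d vmult vs c b = 0 \<longrightarrow> \<beta> = 0)" for b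
  proof (cases "koszul_d vmult vs c b = 0")
    case True
    then show ?thesis
      using stable_zero[OF stN] stable_zero[OF stable_vec_ideal]
      by (intro bexI[of _ 0]) (auto simp: fm_def zero_fun_def)
  next
    case False
    have kN: "koszul_d vmult vs c b \<in> ?N" using chain_mem[OF kc] .
    have "koszul_d vmult vs c b 0 \<in> monomial_ideal V (insert T \<Gamma>)"
      using c(2) by (auto simp: vec_ideal_def)
    then obtain q r where qr: "q \<in> monomial_ideal V \<Gamma>" "r \<in> polys V" "koszul_d vmult vs c b 0 = q + f * r"
      using monomial_ideal_insert[OF _ T(1)] unfolding f_def by metis
    let ?\<beta> = "\<lambda>j::nat. if j = 0 then r else 0"
    have bN: "?\<beta> \<in> ?N" using qr by (auto simp: vecs_def)
    have "koszul_d vmult vs c b - fm ?\<beta> \<in> ?N"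
      using stable_diff[OF stable_vecs kN] vecs_smult[OF fV bN] unfolding fm_def by blast
    moreover have "(koszul_d vmult vs c b - fm ?\<beta>) 0 = q" by (simp add: qr fm_def)
    ultimately have "koszul_d vmult vs c b - fm ?\<beta> \<in> vec_ideal V \<Gamma>" using qr(1) by (simp add: vec_ideal_def)
    then show ?thesis using bN False by blast
  qed
  then obtain \<beta> where \<beta>: "\<And>b. \<beta> b \<in> ?N" "\<And>b. koszul_d vmult vs c b - fm (\<beta> b) \<in> vec_ideal V \<Gamma>"
      "\<And>b. koszul_d vmult vs c b = 0 \<Longrightarrow> \<beta> b = 0"
    by metis
  have b_chain: "\<beta> \<in> koszul_chain ?n i ?N"
    by (rule chainI) (use \<beta> chain_supp[OF kc] in auto)
  have kfm: "koszul_d vmult vs (\<lambda>b. fm (w b)) b = fm (koszul_d vmult vs w b)" for w b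
  proof -
    show ?thesis
    proof (induction vs arbitrary: w b)
      case Nil
      then show ?case by (simp add: fm_def zero_fun_def)
    next
      case (Cons v vs)
      then show ?case
        by (auto simp: fm_def vmult_def fun_eq_iff algebra_simps split: list.split)
    qed
  qed
  \<comment> \<open>The boundary of a boundary is zero, so \<open>f\<close> times the boundary of
    \<open>\<beta>\<close> lies in \<open>J\<close>: thus \<open>\<beta>\<close> is a cycle modulo
    \<open>J : f\<close>, representing the connecting homomorphism.\<close>
  have "koszul_d vmult vs \<beta> b \<in> vec_ideal V ((\<lambda>U. U - T) ` \<Gamma>)" for b
  proof -
    have "koszul_d vmult vs (\<lambda>b. koszul_d vmult vs c b - fm (\<beta> b)) b \<in> vec_ideal V \<Gamma>"
      by (rule vmult.koszul_d_closed[OF stable_subset[OF stable_vec_ideal vs]]) (rule \<beta>(2))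
    then have "- fm (koszul_d vmult vs \<beta> b) \<in> vec_ideal V \<Gamma>"
      by (simp add: vmult.koszul_d_diff kfm)
    then have 1: "fm (koszul_d vmult vs \<beta> b) \<in> vec_ideal V \<Gamma>"
      using stable_uminus[OF stable_vec_ideal] by fastforce
    have 2: "koszul_d vmult vs \<beta> b \<in> ?N"
      by (rule vmult.koszul_d_closed[OF stN]) (rule \<beta>(1))
    have "koszul_d vmult vs \<beta> b 0 \<in> monomial_ideal V ((\<lambda>U. U - T) ` \<Gamma>)"
      using 1 monomial_ideal_colon[OF vecs_nth[OF 2] T(1)]
      unfolding vec_ideal_def fm_def f_def by blast
    then show ?thesis using 2 by (simp add: vec_ideal_def)
  qed
  then obtain \<gamma> where \<gamma>: "\<gamma> \<in> koszul_chain ?n (Suc i) ?N"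
      "\<And>b. \<beta> b - koszul_d vmult vs \<gamma> b \<in> vec_ideal V ((\<lambda>U. U - T) ` \<Gamma>)"
    using ac2 b_chain unfolding acyclic_at_def by meson
  have fm_ideal: "fm u \<in> vec_ideal V \<Gamma>" if "u \<in> vec_ideal V ((\<lambda>U. U - T) ` \<Gamma>)" for u
  proof -
    have "u \<in> vecs V 1" "u 0 \<in> monomial_ideal V ((\<lambda>U. U - T) ` \<Gamma>)"
      using that by (auto simp: vec_ideal_def)
    then show ?thesis
      using monomial_ideal_colon[OF vecs_nth T(1), of u V 1 0 \<Gamma>] vecs_smult[OF fV]
        polys_mult[OF fV vecs_nth]
      unfolding vec_ideal_def fm_def f_def by blast
  qed
  \<comment> \<open>Subtracting \<open>f \<gamma>\<close> keeps the class modulo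
    \<open>J + f\<close> and makes the chain a cycle modulo \<open>J\<close>.\<close>
  let ?c = "\<lambda>b. c b - fm (\<gamma> b)"
  have fm0: "fm 0 = 0" by (auto simp: fm_def)
  have fg: "(\<lambda>b. fm (\<gamma> b)) \<in> koszul_chain ?n (Suc i) ?N"
  proof (rule chainI)
    show "fm (\<gamma> b) \<in> ?N" for b
      using vecs_smult[OF fV chain_mem[OF \<gamma>(1)]] unfolding fm_def .
    show "length b = ?n \<and> count_list b True = Suc i" if "fm (\<gamma> b) \<noteq> 0" for b
      using chain_supp[OF \<gamma>(1), of b] that fm0 by metis
  qed
  have c': "?c \<in> koszul_chain ?n (Suc i) ?N"
    by (rule chain_diff[OF stable_vecs c(1) fg])
  have "koszul_d vmult vs ?c b \<in> vec_ideal V \<Gamma>" for b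
  proof -
    have "koszul_d vmult vs ?c b = (koszul_d vmult vs c b - fm (\<beta> b)) + fm (\<beta> b - koszul_d vmult vs \<gamma> b)"
      by (simp add: vmult.koszul_d_diff kfm) (simp add: fm_def fun_eq_iff algebra_simps)
    then show ?thesis
      using stable_add[OF stable_vec_ideal \<beta>(2) fm_ideal[OF \<gamma>(2)]] by simp
  qed
  then obtain \<psi> where \<psi>: "\<psi> \<in> koszul_chain ?n (Suc (Suc i)) ?N" "\<And>b. ?c b - koszul_d vmult vs \<psi> b \<in> vec_ideal V \<Gamma>"
    using ac1 c' unfolding acyclic_at_def by meson
  have sub: "vec_ideal V \<Gamma> \<subseteq> vec_ideal V (insert T \<Gamma>)"
    by (auto simp: vec_ideal_def monomial_ideal_def)
  have fT: "fm u \<in> vec_ideal V (insert T \<Gamma>)" if "u \<in> ?N" for u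
  proof -
    have "f \<in> monomial_ideal V (insert T \<Gamma>)"
      using fV T by (auto simp: monomial_ideal_def f_def)
    then have "u 0 * f \<in> monomial_ideal V (insert T \<Gamma>)"
      by (rule monomial_ideal_mult[OF vecs_nth[OF that]])
    then show ?thesis
      using vecs_smult[OF fV that] by (simp add: vec_ideal_def fm_def mult.commute)
  qed
  have "c b - koszul_d vmult vs \<psi> b \<in> vec_ideal V (insert T \<Gamma>)" for b
  proof -
    have "c b - koszul_d vmult vs \<psi> b = (?c b - koszul_d vmult vs \<psi> b) + fm (\<gamma> b)" by simp
    then show ?thesis
      using stable_add[OF stable_vec_ideal subsetD[OF sub \<psi>(2)] fT[OF chain_mem[OF \<gamma>(1)]]] by metis
  qed
  with \<psi>(1) show "\<exists>e\<in>koszul_chain ?n (Suc (Suc i)) ?N. \<forall>b. c b - koszul_d vmult vs e b \<in> vec_ideal V (insert T \<Gamma>)"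
    by blast
qed

text \<open>The zero ideal is covered by acyclicity of \<open>S\<close> itself. In the rule
  \<open>colon\<close>, degree \<open>i\<close> for the enlarged ideal needs degree \<open>i\<close>
  for the old ideal and degree \<open>i - 1\<close> for the colon ideal, which explains the
  \<open>Suc\<close> there.\<close>

lemma pd_bound_acyclic:
  assumes "pd_bound V \<Gamma> p" "distinct vs" "set vs \<subseteq> V" "i > p"
  shows "acyclic_at vmult vs i (vecs V 1) (vec_ideal V \<Gamma> :: (nat \<Rightarrow> ('v, 'k::field) mpoly) set)"
  using assms(1,4)
proof (induction arbitrary: i rule: pd_bound.induct)
  case empty
  then obtain i' where i: "i = Suc i'" by (cases i) auto
  have "u = 0" if "u \<in> vec_ideal V {}" for u :: "nat \<Rightarrow> ('v, 'k) mpoly"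
  proof
    fix j show "u j = 0 j"
      using that by (cases "j = 0") (auto simp: vec_ideal_def vecs_def monomial_ideal_def intro: poly_mapping_eqI simp: in_keys_iff)
  qed
  then have B: "vec_ideal V {} = {0 :: nat \<Rightarrow> ('v, 'k) mpoly}"
    using stable_zero[OF stable_vec_ideal] by blast
  show ?case
    unfolding acyclic_at_def B i
    using vmult.exact_if_regular[OF stable_subset[OF stable_vecs assms(3)] regular_vecs[OF assms(3,2)]]
    by fastforce
next
  case (mono \<Gamma> p q)
  then show ?case by simp
next
  case (cong \<Gamma> p \<Gamma>')
  have "monomial_ideal V \<Gamma>' = (monomial_ideal V \<Gamma> :: ('v, 'k) mpoly set)"
  proof -
    have "(\<exists>T\<in>\<Gamma>'. T \<subseteq> M) \<longleftrightarrow> (\<exists>T\<in>\<Gamma>. T \<subseteq> M)" for M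
      using cong.hyps(2,3) by (meson subset_trans)
    then show ?thesis by (simp add: monomial_ideal_def)
  qed
  then show ?case using cong by (simp add: vec_ideal_def)
next
  case (colon \<Gamma> p T)
  then obtain i' where i: "i = Suc i'" "i' > p" by (cases i) auto
  show ?case
    unfolding i using colon i by (intro acyclic_insert[OF _ _ assms(3)]) auto
qed

section \<open>Koszul homology along a resolution\<close>

lemma chain_zero_set: "c \<in> koszul_chain n k {0} \<Longrightarrow> c b = 0"
  using chain_mem[of c n k "{0}" b] by simp

text \<open>A resolution cut into short exact sequences: \<open>eps\<close> maps \<open>F_0\<close>
  onto \<open>S/I\<close> with kernel \<open>Zs 0\<close>, and \<open>del i\<close> maps
  \<open>F_(i+1)\<close> onto the syzygies \<open>Zs i\<close> with kernel
  \<open>Zs (Suc i)\<close>.\<close>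

locale vec_resolution =
  fixes V :: "'v set" and \<Gamma> :: "'v set set" and b :: "nat \<Rightarrow> nat"
    and eps :: "(nat \<Rightarrow> ('v, 'k::field) mpoly) \<Rightarrow> nat \<Rightarrow> ('v, 'k) mpoly"
    and del :: "nat \<Rightarrow> (nat \<Rightarrow> ('v, 'k) mpoly) \<Rightarrow> nat \<Rightarrow> ('v, 'k) mpoly"
    and Zs :: "nat \<Rightarrow> (nat \<Rightarrow> ('v, 'k) mpoly) set"
  assumes eps: "commuting_operators_map vmult vmult V (vecs V (b 0)) (vec_ideal V \<Gamma>) (vecs V 1) eps"
    and Zs_0: "Zs 0 = {u \<in> vecs V (b 0). eps u \<in> vec_ideal V \<Gamma>}"
    and del: "\<And>i. commuting_operators_map vmult vmult V (vecs V (b (Suc i))) {0} (Zs i) (del i)"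
    and Zs_Suc: "\<And>i. Zs (Suc i) = {u \<in> vecs V (b (Suc i)). del i u = 0}"
begin

lemma eps_Z: "commuting_operators_map.Z (vecs V (b 0)) (vec_ideal V \<Gamma>) eps = Zs 0"
  by (simp add: commuting_operators_map.Z_def[OF eps] Zs_0)

lemma del_Z: "commuting_operators_map.Z (vecs V (b (Suc i))) {0} (del i) = Zs (Suc i)"
  by (simp add: commuting_operators_map.Z_def[OF del] Zs_Suc)

lemma Zs_sub: "Zs i \<subseteq> vecs V (b i)"
  by (cases i) (auto simp: Zs_0 Zs_Suc)

lemma Zs_image: "z \<in> Zs i \<Longrightarrow> \<exists>a\<in>vecs V (b (Suc i)). z = del i a"
  using commuting_operators_map.delta_surj[OF del] by fastforce

lemma del_mem: "a \<in> vecs V (b (Suc i)) \<Longrightarrow> del i a \<in> Zs i"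
  by (rule commuting_operators_map.delta_mem[OF del])

lemma Zs_stable: "stable_under vmult V (Zs i)"
  by (rule commuting_operators_map.N[OF del])

lemma vecs_0: "vecs V 0 = {0}"
  by (auto simp: vecs_def fun_eq_iff)

text \<open>Rank 0 in degree \<open>h + 1\<close> forces \<open>Zs h = {0}\<close>. Vanishing
  homology then climbs from degree 0 of \<open>Zs h\<close> to degree \<open>h\<close> of
  \<open>Zs 0\<close> and finally to degree \<open>h + 1\<close> of \<open>S/I\<close>.\<close>

lemma acyclic_if_rank_0:
  assumes "b (Suc h) = 0" "distinct ws" "set ws \<subseteq> V"
  shows "acyclic_at vmult ws (Suc h) (vecs V 1) (vec_ideal V \<Gamma> :: (nat \<Rightarrow> ('v, 'k) mpoly) set)"
proof -
  have "acyclic_at vmult ws j (Zs (h - j)) {0}" if "j \<le> h" for j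
    using that
  proof (induction j)
    case 0
    have "Zs h = {0}"
    proof -
      have "del h 0 = 0" by (rule commuting_operators_map.delta_zero[OF del])
      then have "z = 0" if "z \<in> Zs h" for z
        using Zs_image[OF that] assms(1) by (auto simp: vecs_0)
      then show ?thesis using stable_zero[OF Zs_stable[of h]] by blast
    qed
    moreover have "acyclic_at vmult ws 0 {0} {0 :: nat \<Rightarrow> ('v, 'k) mpoly}"
      unfolding acyclic_at_def
    proof (intro ballI impI)
      fix c assume "c \<in> koszul_chain (length ws) 0 {0 :: nat \<Rightarrow> ('v, 'k) mpoly}"
      then have "\<forall>b. c b - koszul_d vmult ws (\<lambda>b. 0) b \<in> {0}"
        using chain_zero_set by auto
      moreover have "(\<lambda>b. 0) \<in> koszul_chain (length ws) (Suc 0) {0 :: nat \<Rightarrow> ('v, 'k) mpoly}"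
        by (auto intro: chainI)
      ultimately show "\<exists>e\<in>koszul_chain (length ws) (Suc 0) {0}. \<forall>b. c b - koszul_d vmult ws e b \<in> {0}"
        by blast
    qed
    ultimately show ?case by (simp only: diff_zero)
  next
    case (Suc j)
    have eq: "Suc (h - Suc j) = h - j" using Suc.prems by simp
    have "acyclic_at vmult ws j (Zs (Suc (h - Suc j))) {0}"
      using Suc.IH Suc.prems unfolding eq by linarith
    then show ?case
      using commuting_operators_map.acyclic_shift_image[OF del[of "h - Suc j"] assms(3)]
        regular_vecs[OF assms(3,2)] unfolding del_Z by blast
  qed
  from this[of h] have "acyclic_at vmult ws h (Zs 0) {0}" by simp
  then show ?thesis
    using commuting_operators_map.acyclic_shift_image[OF eps assms(3)]
        regular_vecs[OF assms(3,2)] unfolding eps_Z by blast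
qed

text \<open>Descending the syzygies turns the vanishing of \<open>H_(i+1)(S/I)\<close> into that of
  \<open>H_0(Zs i)\<close>, i.e. every element of \<open>Zs i\<close> is a combination of variables
  times elements of \<open>Zs i\<close>. Applied to the image of a basis vector, this contradicts
  minimality.\<close>

lemma rank_0_if_acyclic:
  assumes ac: "acyclic_at vmult vs (Suc i) (vecs V 1) (vec_ideal V \<Gamma> :: (nat \<Rightarrow> ('v, 'k) mpoly) set)"
    and vs: "distinct vs" "set vs \<subseteq> V"
    and minimal: "\<And>i u. u \<in> vecs V (b (Suc i)) \<Longrightarrow> del i u \<in> var_span vmult vs (vecs V (b i))"
  shows "b (Suc i) = 0"
proof (rule ccontr)
  let ?n = "length vs" and ?r = "replicate (length vs) False"
  have reg: "regular_sequence vmult vs (vecs V n :: (nat \<Rightarrow> ('v, 'k) mpoly) set)" for n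
    by (rule regular_vecs[OF vs(2,1)])
  have st: "stable_under vmult (set vs) (vecs V n :: (nat \<Rightarrow> ('v, 'k) mpoly) set)" for n
    by (rule stable_subset[OF stable_vecs vs(2)])
  have Zspan: "Zs j \<subseteq> var_span vmult vs (vecs V (b j))" for j
    using Zs_image[of _ j] minimal by blast
  \<comment> \<open>In degree 0, where the free module is not acyclic, minimality supplies the
    bounding chain: the syzygies lie in the span of the variables.\<close>
  have ex: "\<exists>w\<in>koszul_chain ?n (Suc k) (vecs V (b j)). \<forall>b. z b = koszul_d vmult vs w b"
    if z: "z \<in> koszul_chain ?n k (Zs j)" "\<And>b. koszul_d vmult vs z b = 0" for z k j
  proof (cases k)
    case 0
    have "z ?r \<in> var_span vmult vs (vecs V (b j))"
      using chain_mem[OF z(1)] Zspan by blast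
    then obtain w where w: "w \<in> koszul_chain ?n (Suc 0) (vecs V (b j))" "z ?r = koszul_d vmult vs w ?r"
      by (auto simp: var_span_def)
    have "z b = koszul_d vmult vs w b" for b
    proof (cases "b = ?r")
      case False
      then have "\<not> (length b = ?n \<and> count_list b True = 0)" by (simp add: length_0_count)
      then show ?thesis
        using chain_supp[OF z(1), of b] chain_supp[OF vmult.koszul_d_chain[OF st w(1)], of b] 0
        by metis
    qed (use w in simp)
    then show ?thesis using w 0 by blast
  next
    case (Suc k')
    show ?thesis
      using vmult.exact_if_regular[OF st reg, of z k'] chain_mono[OF z(1) Zs_sub] z(2) Suc by simp
  qed
  have "acyclic_at vmult vs i (Zs 0) {0}"
    using commuting_operators_map.acyclic_shift_kernel[OF eps vs(2) ac] ex
    unfolding eps_Z by blast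
  then have "acyclic_at vmult vs (i - j) (Zs j) {0}" if "j \<le> i" for j
    using that
  proof (induction j)
    case (Suc j)
    have eq: "Suc (i - Suc j) = i - j" using Suc.prems by simp
    have "acyclic_at vmult vs (Suc (i - Suc j)) (Zs j) {0}"
      using Suc.IH Suc.prems unfolding eq by linarith
    then show ?case
      using commuting_operators_map.acyclic_shift_kernel[OF del[of j] vs(2)] ex
      unfolding del_Z by blast
  qed (simp only: diff_zero)
  from this[of i] have ac0: "acyclic_at vmult vs 0 (Zs i) {0}" by simp
  assume nz: "b (Suc i) \<noteq> 0"
  \<comment> \<open>The first basis vector. Its image lies in the span of the variables times
    \<open>Zs i\<close>, which is the image under \<open>del i\<close> of the corresponding span in
    \<open>F_(i+1)\<close>; this produces \<open>?k\<close>.\<close>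
  define e :: "nat \<Rightarrow> ('v, 'k) mpoly" where "e = (\<lambda>j. if j = 0 then 1 else 0)"
  have eF: "e \<in> vecs V (b (Suc i))" using nz by (auto simp: e_def vecs_def)
  define c where "c = (\<lambda>b. if b = ?r then del i e else 0)"
  have c: "c \<in> koszul_chain ?n 0 (Zs i)"
  proof (rule chainI)
    show "c b \<in> Zs i" for b
      using del_mem[OF eF] stable_zero[OF Zs_stable] by (simp add: c_def)
    show "length b = ?n \<and> count_list b True = 0" if "c b \<noteq> 0" for b
      using that length_0_count[of b ?n] by (auto simp: c_def split: if_splits)
  qed
  have "\<forall>b. koszul_d vmult vs c b \<in> {0}" using vmult.koszul_d_chain_0[OF c] by simp
  then obtain y where y: "y \<in> koszul_chain ?n (Suc 0) (Zs i)" "\<And>b. c b - koszul_d vmult vs y b = 0"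
    using ac0 c unfolding acyclic_at_def by (metis singletonD)
  obtain w where w: "w \<in> koszul_chain ?n (Suc 0) (vecs V (b (Suc i)))" "\<And>b. y b = del i (w b)"
    using commuting_operators_map.lift_chain[OF del y(1)] by auto
  let ?k = "koszul_d vmult vs w ?r"
  have kF: "?k \<in> vecs V (b (Suc i))"
    by (rule vmult.koszul_d_closed[OF st]) (rule chain_mem[OF w(1)])
  have "koszul_d vmult vs (\<lambda>b. del i (w b)) ?r - del i ?k \<in> {0}"
    by (rule commuting_operators_map.koszul_d_delta[OF del chain_mem[OF w(1)] vs(2)])
  moreover have "(\<lambda>b. del i (w b)) = y" using w(2) by auto
  ultimately have "del i ?k = koszul_d vmult vs y ?r" by simp
  also have "\<dots> = del i e" using y(2)[of ?r] by (simp add: c_def)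
  finally have "del i (e - ?k) = 0"
    using commuting_operators_map.delta_diff[OF del eF kF] by simp
  then have "e - ?k \<in> Zs (Suc i)"
    using stable_diff[OF stable_vecs eF kF] by (simp add: Zs_Suc)
  then have 1: "e - ?k \<in> var_span vmult vs (vecs V (b (Suc i)))" using Zspan by blast
  have 2: "?k \<in> var_span vmult vs (vecs V (b (Suc i)))"
    using w(1) by (auto simp: var_span_def)
  \<comment> \<open>Both summands lack a constant term, whereas the constant term of
    \<open>e 0\<close> is 1.\<close>
  have "e 0 = (e - ?k) 0 + ?k 0" by simp
  then have "0 \<in> keys ((e - ?k) 0 + ?k 0)" by (simp add: e_def)
  then have "0 \<in> keys ((e - ?k) 0) \<or> 0 \<in> keys (?k 0)"
    by (rule UnE[OF subsetD[OF Poly_Mapping.keys_add] disjI1 disjI2])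
  then show False
    using 1 2 unfolding var_span_vecs[OF vs(2)] by fastforce
qed

end

section \<open>Arbitrary resolutions over the polynomial ring\<close>

lemma poly_ring_simps [simp]:
  "carrier (poly_ring K V) = polys V" "add (poly_ring K V) = (+)" "mult (poly_ring K V) = (*)"
  "zero (poly_ring K V) = 0" "one (poly_ring K V) = 1"
  by (auto simp: poly_ring_def polys_def)

lemma cring_poly_ring: "cring (poly_ring K V)"
proof (rule cringI)
  show "abelian_group (poly_ring K V)"
  proof (rule abelian_groupI)
    fix p assume "p \<in> carrier (poly_ring K V)"
    then show "\<exists>q\<in>carrier (poly_ring K V). q \<oplus>\<^bsub>poly_ring K V\<^esub> p = \<zero>\<^bsub>poly_ring K V\<^esub>"
      by (intro bexI[of _ "- p"]) (auto intro: polys_uminus)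
  qed (auto intro: polys_add simp: algebra_simps)
  show "comm_monoid (poly_ring K V)"
    by (rule comm_monoidI) (auto intro: polys_mult simp: algebra_simps)
qed (auto simp: algebra_simps)

lemma ideal_monomial_ideal:
  fixes V :: "'v set" and K :: "'k::field itself"
  shows "ideal (monomial_ideal V \<Gamma>) (poly_ring K V)"
proof (rule idealI)
  interpret cring "poly_ring K V" by (rule cring_poly_ring)
  show "ring (poly_ring K V)" by (rule ring_axioms)
  let ?I = "monomial_ideal V \<Gamma> :: ('v, 'k) mpoly set"
  show "subgroup ?I (add_monoid (poly_ring K V))"
  proof (rule add.subgroupI)
    show "?I \<subseteq> carrier (poly_ring K V)" by (auto simp: monomial_ideal_def)
    show "?I \<noteq> {}" using monomial_ideal_zero by blast
    fix p assume p: "p \<in> ?I"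
    then have pV: "p \<in> polys V" by (simp add: monomial_ideal_def)
    have "\<ominus>\<^bsub>poly_ring K V\<^esub> p = - p"
      using minus_equality[of "- p" p] pV polys_uminus[OF pV] by simp
    then show "\<ominus>\<^bsub>poly_ring K V\<^esub> p \<in> ?I"
      using monomial_ideal_uminus[OF p] by simp
  qed (simp add: monomial_ideal_add)
  fix p q assume "p \<in> ?I" "q \<in> carrier (poly_ring K V)"
  then show "q \<otimes>\<^bsub>poly_ring K V\<^esub> p \<in> ?I" "p \<otimes>\<^bsub>poly_ring K V\<^esub> q \<in> ?I"
    using monomial_ideal_mult[of q V p \<Gamma>] by (simp_all add: mult.commute)
qed

lemma genideal_monomials:
  fixes K :: "'k::field itself"
  assumes "finite \<Gamma>" "\<And>T. T \<in> \<Gamma> \<Longrightarrow> finite T \<and> T \<subseteq> V"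
  shows "Idl\<^bsub>poly_ring K V\<^esub> ((\<lambda>T. single (mexp T) 1) ` \<Gamma>) = monomial_ideal V \<Gamma>"
    (is "Idl\<^bsub>_\<^esub> (?m ` \<Gamma>) = _")
proof
  interpret cring "poly_ring K V" by (rule cring_poly_ring)
  have mV: "?m T \<in> polys V" if "T \<in> \<Gamma>" for T
    using assms(2)[OF that] by (intro polys_single) simp
  have "?m T \<in> monomial_ideal V \<Gamma>" if "T \<in> \<Gamma>" for T
    using assms(2)[OF that] mV[OF that] that by (auto simp: monomial_ideal_def)
  then show "Idl\<^bsub>poly_ring K V\<^esub> (?m ` \<Gamma>) \<subseteq> monomial_ideal V \<Gamma>"
    by (intro genideal_minimal ideal_monomial_ideal) auto
  interpret J: ideal "Idl\<^bsub>poly_ring K V\<^esub> (?m ` \<Gamma>)" "poly_ring K V"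
    by (rule genideal_ideal) (use mV in auto)
  have gen: "?m T \<in> Idl\<^bsub>poly_ring K V\<^esub> (?m ` \<Gamma>)" if "T \<in> \<Gamma>" for T
    using genideal_self[of "?m ` \<Gamma>"] mV that by auto
  \<comment> \<open>The induction runs over subsets \<open>\<Delta>\<close> of the generators while
    the generated ideal stays that of \<open>\<Gamma>\<close>.\<close>
  have "p \<in> Idl\<^bsub>poly_ring K V\<^esub> (?m ` \<Gamma>)"
    if "\<Delta> \<subseteq> \<Gamma>" "p \<in> monomial_ideal V \<Delta>" for \<Delta> and p :: "('a, 'k) mpoly"
    using finite_subset[OF that(1) assms(1)] that
  proof (induction \<Delta> arbitrary: p rule: finite_induct)
    case empty
    then have "keys p = {}" by (auto simp: monomial_ideal_def)
    then have "p = 0" by (auto intro: poly_mapping_eqI simp: in_keys_iff)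
    then show ?case using J.zero_closed by simp
  next
    case (insert T \<Delta>)
    then have T: "T \<in> \<Gamma>" by simp
    obtain q r where qr: "q \<in> monomial_ideal V \<Delta>" "r \<in> polys V" "p = q + ?m T * r"
      using monomial_ideal_insert[OF insert.prems(2)] assms(2)[OF T] by metis
    have "q \<in> Idl\<^bsub>poly_ring K V\<^esub> (?m ` \<Gamma>)" using insert.IH insert.prems qr(1) by auto
    moreover have "?m T * r \<in> Idl\<^bsub>poly_ring K V\<^esub> (?m ` \<Gamma>)"
      using J.I_r_closed[OF gen[OF T]] qr(2) by simp
    ultimately show ?case using J.a_closed qr(3) by fastforce
  qed
  then show "monomial_ideal V \<Gamma> \<subseteq> Idl\<^bsub>poly_ring K V\<^esub> (?m ` \<Gamma>)" by blast
qed

lemma edge_ideal_eq: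
  assumes "simple_graph V E"
  shows "edge_ideal K V E = monomial_ideal V E"
proof -
  have fin: "finite V" and EV: "\<And>e. e \<in> E \<Longrightarrow> e \<subseteq> V \<and> card e = 2"
    using assms by (auto simp: simple_graph_def)
  have m: "var x * var y = (single (mexp {x, y}) 1 :: ('a, 'b) mpoly)" if "{x, y} \<in> E" for x y
  proof -
    have "x \<noteq> y" using EV[OF that] by auto
    then show ?thesis
      using mexp_Un_disjoint[of "{x}" "{y}"] by (simp add: var_def mult_single mexp_singleton insert_commute)
  qed
  have "{var x * var y | x y. {x, y} \<in> E} = (\<lambda>T. single (mexp T) 1 :: ('a, 'b) mpoly) ` E"
  proof (intro equalityI subsetI)
    fix p assume "p \<in> (\<lambda>T. single (mexp T) 1 :: ('a, 'b) mpoly) ` E"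
    then obtain T where T: "T \<in> E" "p = single (mexp T) 1" by auto
    obtain x y where xy: "T = {x, y}" using EV[OF T(1)] by (meson card_2_iff)
    then have "p = var x * var y" using T m[of x y] by simp
    then show "p \<in> {var x * var y | x y. {x, y} \<in> E}" using T(1) xy by blast
  qed (use m in auto)
  moreover have "finite E" by (rule finite_subset[of _ "Pow V"]) (use EV fin in auto)
  ultimately show ?thesis
    unfolding edge_ideal_def using genideal_monomials[of E V K] EV fin finite_subset by (metis (no_types, lifting))
qed

lemma irrelevant_ideal_eq:
  fixes K :: "'k::field itself"
  assumes "finite V"
  shows "irrelevant_ideal K V = monomial_ideal V ((\<lambda>v. {v}) ` V)"
proof -
  have v: "var ` V = (\<lambda>T. single (mexp T) 1 :: ('a, 'k) mpoly) ` (\<lambda>v. {v}) ` V"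
    by (simp add: image_image mexp_singleton var_def)
  show ?thesis
    unfolding irrelevant_ideal_def v by (rule genideal_monomials) (use assms in auto)
qed

lemma coset_eq_iff:
  fixes p q :: "('v, 'k::field) mpoly"
  shows "monomial_ideal V \<Gamma> +>\<^bsub>poly_ring K V\<^esub> p = monomial_ideal V \<Gamma> +>\<^bsub>poly_ring K V\<^esub> q \<longleftrightarrow>
    p - q \<in> monomial_ideal V \<Gamma>" (is "?I +>\<^bsub>_\<^esub> p = _ \<longleftrightarrow> _")
proof -
  have c: "?I +>\<^bsub>poly_ring K V\<^esub> p = (\<lambda>h. h + p) ` ?I" for p
    by (auto simp: a_r_coset_def')
  show ?thesis
  proof
    assume "?I +>\<^bsub>poly_ring K V\<^esub> p = ?I +>\<^bsub>poly_ring K V\<^esub> q"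
    moreover have "p \<in> ?I +>\<^bsub>poly_ring K V\<^esub> p" unfolding c
      by (rule image_eqI[of _ _ 0]) auto
    ultimately obtain h where "h \<in> ?I" "p = h + q" unfolding c by auto
    then show "p - q \<in> ?I" by simp
  next
    assume pq: "p - q \<in> ?I"
    have "h + p \<in> (\<lambda>h. h + q) ` ?I" if "h \<in> ?I" for h
      using monomial_ideal_add[OF that pq] by (intro image_eqI[of _ _ "h + (p - q)"]) auto
    moreover have "h + q \<in> (\<lambda>h. h + p) ` ?I" if "h \<in> ?I" for h
      using monomial_ideal_diff[OF that pq] by (intro image_eqI[of _ _ "h - (p - q)"]) auto
    ultimately show "?I +>\<^bsub>poly_ring K V\<^esub> p = ?I +>\<^bsub>poly_ring K V\<^esub> q" unfolding c by blast
  qed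
qed

lemma coset_zero: "monomial_ideal V \<Gamma> +>\<^bsub>poly_ring K V\<^esub> 0 = monomial_ideal V \<Gamma>"
  by (auto simp: a_r_coset_def')

text \<open>Together with \<open>to_vec\<close> this passes between tuples that vanish outside the
  index range and the tuples of \<open>free_module\<close>, which are undefined there.\<close>

definition to_ext :: "nat \<Rightarrow> (nat \<Rightarrow> 'a) \<Rightarrow> nat \<Rightarrow> 'a" where
  "to_ext n u = (\<lambda>j\<in>{..<n}. u j)"

definition to_vec :: "nat \<Rightarrow> (nat \<Rightarrow> 'a::zero) \<Rightarrow> nat \<Rightarrow> 'a" where
  "to_vec n x = (\<lambda>j. if j < n then x j else 0)"

lemma to_ext_mem: "u \<in> vecs V n \<Longrightarrow> to_ext n u \<in> carrier (free_module (poly_ring K V) n)"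
  by (auto simp: to_ext_def free_module_def vecs_def)

lemma to_vec_mem: "x \<in> carrier (free_module (poly_ring K V) n) \<Longrightarrow> to_vec n x \<in> vecs V n"
  by (auto simp: to_vec_def free_module_def vecs_def)

lemma to_vec_to_ext: "u \<in> vecs V n \<Longrightarrow> to_vec n (to_ext n u) = u"
  by (auto simp: to_vec_def to_ext_def vecs_def fun_eq_iff)

lemma to_ext_to_vec: "x \<in> carrier (free_module (poly_ring K V) n) \<Longrightarrow> to_ext n (to_vec n x) = x"
  by (auto simp: to_vec_def to_ext_def free_module_def fun_eq_iff PiE_def extensional_def)

lemma to_ext_add: "to_ext n (u + w) = to_ext n u \<oplus>\<^bsub>free_module (poly_ring K V) n\<^esub> to_ext n w"
  by (auto simp: to_ext_def free_module_def fun_eq_iff)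

lemma to_ext_vmult: "to_ext n (vmult v u) = var v \<odot>\<^bsub>free_module (poly_ring K V) n\<^esub> to_ext n u"
  by (auto simp: to_ext_def free_module_def fun_eq_iff vmult_def)

lemma to_vec_add: "to_vec n (x \<oplus>\<^bsub>free_module (poly_ring K V) n\<^esub> y) = to_vec n x + to_vec n y"
  by (auto simp: to_vec_def free_module_def fun_eq_iff)

lemma to_vec_smult: "to_vec n (p \<odot>\<^bsub>free_module (poly_ring K V) n\<^esub> x) = (\<lambda>j. p * to_vec n x j)"
  by (auto simp: to_vec_def free_module_def fun_eq_iff)

lemma to_vec_zero: "to_vec n (\<zero>\<^bsub>free_module (poly_ring K V) n\<^esub>) = 0"
  by (auto simp: to_vec_def free_module_def fun_eq_iff)

lemma to_ext_zero: "to_ext n 0 = \<zero>\<^bsub>free_module (poly_ring K V) n\<^esub>"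
  by (auto simp: to_ext_def free_module_def fun_eq_iff)

lemma quotient_module_simps:
  shows "carrier (quotient_module R I) = a_rcosets\<^bsub>R\<^esub> I"
    and "\<zero>\<^bsub>quotient_module R I\<^esub> = I"
    and "X \<oplus>\<^bsub>quotient_module R I\<^esub> Y = X <+>\<^bsub>R\<^esub> Y"
    and "r \<odot>\<^bsub>quotient_module R I\<^esub> X = rcoset_mult R I (I +>\<^bsub>R\<^esub> r) X"
  by (simp_all add: quotient_module_def FactRing_def)

lemma commuting_operators_mapI:
  assumes "stable_under vmult V F" "stable_under vmult V B" "stable_under vmult V N"
    "\<delta> 0 = 0"
    "\<And>a b. \<lbrakk>a \<in> F; b \<in> F\<rbrakk> \<Longrightarrow> \<delta> (a + b) - (\<delta> a + \<delta> b) \<in> B"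
    "\<And>a v. \<lbrakk>a \<in> F; v \<in> V\<rbrakk> \<Longrightarrow> \<delta> (vmult v a) - vmult v (\<delta> a) \<in> B"
    "\<And>a. a \<in> F \<Longrightarrow> \<delta> a \<in> N" "\<And>n. n \<in> N \<Longrightarrow> \<exists>a\<in>F. n - \<delta> a \<in> B" "B \<subseteq> N"
  shows "commuting_operators_map vmult vmult V F B N \<delta>"
  using assms by unfold_locales auto

section \<open>Both bounds for a given graded free resolution\<close>

context
  fixes K :: "'k::field itself" and V :: "'v set" and \<Gamma> :: "'v set set"
    and gr :: "int \<Rightarrow> ('v, 'k) mpoly set set" and b a d \<epsilon>
  assumes res: "graded_free_resolution K V (quotient_module (poly_ring K V) (monomial_ideal V \<Gamma>))
    gr b a d \<epsilon>"
begin

private abbreviation "R \<equiv> poly_ring K V"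
private abbreviation "I \<equiv> monomial_ideal V \<Gamma> :: ('v, 'k) mpoly set"

private definition "lift_coset X = (SOME p. p \<in> polys V \<and> X = I +>\<^bsub>R\<^esub> p)"

text \<open>The representative chosen for the zero coset need not be 0, but lifting chains requires
  that 0 be sent to 0; hence the case distinction.\<close>

private definition "eps u = (if u = 0 then 0 else
  (\<lambda>j::nat. if j = 0 then lift_coset (\<epsilon> (to_ext (b 0) u)) else 0))"

private definition "del i u = to_vec (b i) (d (Suc i) (to_ext (b (Suc i)) u))"

private definition "Zs i = (case i of 0 \<Rightarrow> {u \<in> vecs V (b 0). eps u \<in> vec_ideal V \<Gamma>}
  | Suc i \<Rightarrow> {u \<in> vecs V (b (Suc i)). del i u = 0})"

private lemma
  e_hom: "\<epsilon> \<in> mod_hom R (free_module R (b 0)) (quotient_module R I)"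
  and d_hom: "d (Suc i) \<in> mod_hom R (free_module R (b (Suc i))) (free_module R (b i))"
  and e_surj: "\<epsilon> ` carrier (free_module R (b 0)) = carrier (quotient_module R I)"
  and e_ker: "a_kernel (free_module R (b 0)) (quotient_module R I) \<epsilon> = d 1 ` carrier (free_module R (b 1))"
  and d_ker: "a_kernel (free_module R (b (Suc i))) (free_module R (b i)) (d (Suc i)) =
    d (Suc (Suc i)) ` carrier (free_module R (b (Suc (Suc i))))"
  using res unfolding graded_free_resolution_def Let_def by simp_all

private lemma carrier_quotient: "X \<in> carrier (quotient_module R I) \<longleftrightarrow> (\<exists>p\<in>polys V. X = I +>\<^bsub>R\<^esub> p)"
  by (auto simp: quotient_module_simps A_RCOSETS_defs a_r_coset_def)

private lemma e_mem:
  "u \<in> vecs V (b 0) \<Longrightarrow> \<epsilon> (to_ext (b 0) u) \<in> carrier (quotient_module R I)"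
  using e_hom to_ext_mem[where u = u and V = V and n = "b 0" and K = K] by (auto simp: mod_hom_def)

text \<open>Preservation of zero is not part of \<open>mod_hom\<close>; it follows from additivity
  applied to \<open>0 + 0\<close>.\<close>

private lemma e_zero: "\<epsilon> (to_ext (b 0) 0) = I"
proof -
  interpret I: ideal I R by (rule ideal_monomial_ideal)
  have z: "0 \<in> vecs V (b 0)" by (rule stable_zero[OF stable_vecs])
  obtain p where p: "p \<in> polys V" "\<epsilon> (to_ext (b 0) 0) = I +>\<^bsub>R\<^esub> p"
    using e_mem[OF z] carrier_quotient by blast
  have "\<epsilon> (to_ext (b 0) (0 + 0)) = \<epsilon> (to_ext (b 0) 0) <+>\<^bsub>R\<^esub> \<epsilon> (to_ext (b 0) 0)"
    unfolding to_ext_add[where K = K and V = V] using e_hom to_ext_mem[where K = K, OF z]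
    by (auto simp: mod_hom_def quotient_module_simps)
  then have "I +>\<^bsub>R\<^esub> p = I +>\<^bsub>R\<^esub> (p + p)"
    using p I.a_rcos_sum[of p p] by simp
  then have "p \<in> I"
    using monomial_ideal_uminus[of "p - (p + p)" V \<Gamma>] by (simp add: coset_eq_iff)
  then have "I +>\<^bsub>R\<^esub> p = I +>\<^bsub>R\<^esub> 0" by (simp add: coset_eq_iff)
  then show ?thesis using p coset_zero by metis
qed

private lemma eps_0:
  assumes "u \<in> vecs V (b 0)"
  shows "eps u 0 \<in> polys V" "\<epsilon> (to_ext (b 0) u) = I +>\<^bsub>R\<^esub> eps u 0"
proof -
  interpret I: ideal I R by (rule ideal_monomial_ideal)
  have "eps u 0 \<in> polys V \<and> \<epsilon> (to_ext (b 0) u) = I +>\<^bsub>R\<^esub> eps u 0"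
  proof (cases "u = 0")
    case True
    then show ?thesis using e_zero by (simp add: eps_def coset_zero)
  next
    case False
    have "\<exists>p. p \<in> polys V \<and> \<epsilon> (to_ext (b 0) u) = I +>\<^bsub>R\<^esub> p"
      using e_mem[OF assms] carrier_quotient by blast
    from someI_ex[OF this] False show ?thesis
      by (simp add: eps_def lift_coset_def)
  qed
  then show "eps u 0 \<in> polys V" "\<epsilon> (to_ext (b 0) u) = I +>\<^bsub>R\<^esub> eps u 0" by auto
qed

private lemma eps_vec: "u \<in> vecs V (b 0) \<Longrightarrow> eps u \<in> vecs V 1"
  using eps_0(1)[of u] by (auto simp: vecs_def eps_def)

private lemma vec_idealI: "u \<in> vecs V 1 \<Longrightarrow> u 0 \<in> I \<Longrightarrow> u \<in> vec_ideal V \<Gamma>"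
  by (simp add: vec_ideal_def)

private lemma eps_map:
  "commuting_operators_map vmult vmult V (vecs V (b 0)) (vec_ideal V \<Gamma>) (vecs V 1) eps"
proof (rule commuting_operators_mapI)
  interpret I: ideal I R by (rule ideal_monomial_ideal)
  show "eps 0 = 0" by (simp add: eps_def)
  fix u :: "nat \<Rightarrow> ('v, 'k) mpoly" assume u: "u \<in> vecs V (b 0)"
  show "eps u \<in> vecs V 1" by (rule eps_vec[OF u])
  {
    fix w :: "nat \<Rightarrow> ('v, 'k) mpoly" assume w: "w \<in> vecs V (b 0)"
    have uw: "u + w \<in> vecs V (b 0)" by (rule vecs_add[OF u w])
    have "\<epsilon> (to_ext (b 0) (u + w)) = \<epsilon> (to_ext (b 0) u) <+>\<^bsub>R\<^esub> \<epsilon> (to_ext (b 0) w)"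
      unfolding to_ext_add[where K = K and V = V] using e_hom to_ext_mem[where K = K, OF u] to_ext_mem[where K = K, OF w]
      by (auto simp: mod_hom_def quotient_module_simps)
    then have "I +>\<^bsub>R\<^esub> eps (u + w) 0 = I +>\<^bsub>R\<^esub> (eps u 0 + eps w 0)"
      using eps_0[OF u] eps_0[OF w] eps_0[OF uw] I.a_rcos_sum[of "eps u 0" "eps w 0"] by simp
    then have "(eps (u + w) - (eps u + eps w)) 0 \<in> I"
      by (simp add: coset_eq_iff)
    then show "eps (u + w) - (eps u + eps w) \<in> vec_ideal V \<Gamma>"
      by (intro vec_idealI stable_diff[OF stable_vecs] vecs_add eps_vec u w uw)
  }
  {
    fix v assume v: "v \<in> V"
    have uv: "vmult v u \<in> vecs V (b 0)" by (rule stable_act[OF stable_vecs u v])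
    have "\<epsilon> (to_ext (b 0) (vmult v u)) = rcoset_mult R I (I +>\<^bsub>R\<^esub> var v) (\<epsilon> (to_ext (b 0) u))"
      unfolding to_ext_vmult[where K = K and V = V] using e_hom to_ext_mem[where K = K, OF u] polys_var[OF v]
      by (auto simp: mod_hom_def quotient_module_simps)
    then have "I +>\<^bsub>R\<^esub> eps (vmult v u) 0 = I +>\<^bsub>R\<^esub> (var v * eps u 0)"
      using eps_0[OF u] eps_0[OF uv] I.rcoset_mult_add[of "var v" "eps u 0"] polys_var[OF v] by simp
    then have "(eps (vmult v u) - vmult v (eps u)) 0 \<in> I"
      by (simp add: coset_eq_iff vmult_def)
    then show "eps (vmult v u) - vmult v (eps u) \<in> vec_ideal V \<Gamma>"
      by (intro vec_idealI stable_diff[OF stable_vecs] stable_act[OF stable_vecs _ v] eps_vec u uv)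
  }
next
  fix n :: "nat \<Rightarrow> ('v, 'k) mpoly" assume n: "n \<in> vecs V 1"
  have "I +>\<^bsub>R\<^esub> n 0 \<in> \<epsilon> ` carrier (free_module R (b 0))"
    unfolding e_surj carrier_quotient using vecs_nth[OF n] by (intro bexI[of _ "n 0"]) simp_all
  then obtain x where x': "I +>\<^bsub>R\<^esub> n 0 = \<epsilon> x" "x \<in> carrier (free_module R (b 0))"
    by (rule imageE)
  note x = x'(2) x'(1)[symmetric]
  let ?u = "to_vec (b 0) x"
  have u: "?u \<in> vecs V (b 0)" by (rule to_vec_mem[OF x(1)])
  have "I +>\<^bsub>R\<^esub> n 0 = I +>\<^bsub>R\<^esub> eps ?u 0"
    using eps_0(2)[OF u] x to_ext_to_vec[OF x(1)] by simp
  then have "(n - eps ?u) 0 \<in> I" by (simp add: coset_eq_iff)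
  then show "\<exists>a\<in>vecs V (b 0). n - eps a \<in> vec_ideal V \<Gamma>"
    using u n by (intro bexI[OF _ u] vec_idealI stable_diff[OF stable_vecs] eps_vec)
next
  show "stable_under vmult V (vec_ideal V \<Gamma> :: (nat \<Rightarrow> ('v, 'k) mpoly) set)" by (rule stable_vec_ideal)
  show "vec_ideal V \<Gamma> \<subseteq> (vecs V 1 :: (nat \<Rightarrow> ('v, 'k) mpoly) set)" by (auto simp: vec_ideal_def)
qed (rule stable_vecs)+

private lemma d_mem: "x \<in> carrier (free_module R (b (Suc i))) \<Longrightarrow> d (Suc i) x \<in> carrier (free_module R (b i))"
  using d_hom[of i] by (auto simp: mod_hom_def)

private lemma del_vec: "u \<in> vecs V (b (Suc i)) \<Longrightarrow> del i u \<in> vecs V (b i)"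
  unfolding del_def by (intro to_vec_mem[where K = K] d_mem to_ext_mem)

private lemma to_ext_del: "u \<in> vecs V (b (Suc i)) \<Longrightarrow> to_ext (b i) (del i u) = d (Suc i) (to_ext (b (Suc i)) u)"
  unfolding del_def by (intro to_ext_to_vec[where K = K and V = V] d_mem to_ext_mem)

private lemma del_add:
  assumes "u \<in> vecs V (b (Suc i))" "w \<in> vecs V (b (Suc i))"
  shows "del i (u + w) = del i u + del i w"
  unfolding del_def to_ext_add[where K = K and V = V] to_vec_add[where K = K and V = V, symmetric]
  using d_hom[of i] to_ext_mem[where K = K, OF assms(1)] to_ext_mem[where K = K, OF assms(2)]
  by (auto simp: mod_hom_def)

private lemma del_vmult:
  assumes "u \<in> vecs V (b (Suc i))" "v \<in> V"
  shows "del i (vmult v u) = vmult v (del i u)"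
proof -
  have "d (Suc i) (to_ext (b (Suc i)) (vmult v u)) =
      var v \<odot>\<^bsub>free_module R (b i)\<^esub> d (Suc i) (to_ext (b (Suc i)) u)"
    unfolding to_ext_vmult[where K = K and V = V]
    using d_hom[of i] to_ext_mem[where K = K, OF assms(1)] polys_var[OF assms(2), where 'b = 'k]
    by (auto simp: mod_hom_def)
  then show ?thesis by (simp add: del_def to_vec_smult) (simp add: vmult_def)
qed

private lemma del_zero: "del i 0 = 0"
  using del_add[of 0 i 0] stable_zero[OF stable_vecs, of V "b (Suc i)"] by simp

private lemma ker_e: 
  assumes "u \<in> vecs V (b 0)" shows "eps u \<in> vec_ideal V \<Gamma> \<longleftrightarrow> \<epsilon> (to_ext (b 0) u) = I"
proof -
  interpret I: ideal I R by (rule ideal_monomial_ideal)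
  have "\<epsilon> (to_ext (b 0) u) = I \<longleftrightarrow> I +>\<^bsub>R\<^esub> eps u 0 = I +>\<^bsub>R\<^esub> 0"
    using eps_0(2)[OF assms] by (simp add: coset_zero)
  then show ?thesis
    using eps_vec[OF assms] by (simp add: coset_eq_iff vec_ideal_def)
qed

private lemma ker_d: 
  assumes "u \<in> vecs V (b (Suc i))"
  shows "del i u = 0 \<longleftrightarrow> d (Suc i) (to_ext (b (Suc i)) u) = \<zero>\<^bsub>free_module R (b i)\<^esub>"
  using to_ext_del[OF assms] to_ext_zero[where n = "b i" and K = K and V = V] del_def[of i u] to_vec_zero[where n = "b i" and K = K and V = V]
  by metis

text \<open>Exactness, transported to vectors. Describing the kernels as images gives stability of
  \<open>Zs\<close> and surjectivity of \<open>del\<close> at once.\<close>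

private lemma Zs_eq: "Zs i = del i ` vecs V (b (Suc i))"
proof -
  have ker: "u \<in> Zs i \<longleftrightarrow> to_ext (b i) u \<in> d (Suc i) ` carrier (free_module R (b (Suc i)))"
    if u: "u \<in> vecs V (b i)" for u
  proof (cases i)
    case 0
    have "u \<in> Zs i \<longleftrightarrow> to_ext (b 0) u \<in> a_kernel (free_module R (b 0)) (quotient_module R I) \<epsilon>"
      using u 0 ker_e to_ext_mem[where u = u and V = V and n = "b 0" and K = K]
      by (simp add: Zs_def a_kernel_def' quotient_module_simps)
    then show ?thesis unfolding e_ker using 0 by simp
  next
    case (Suc j)
    have "u \<in> Zs i \<longleftrightarrow> to_ext (b i) u \<in> a_kernel (free_module R (b (Suc j))) (free_module R (b j)) (d (Suc j))"
      using u Suc ker_d to_ext_mem[where u = u and V = V and n = "b i" and K = K]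
      by (simp add: Zs_def a_kernel_def')
    then show ?thesis unfolding d_ker using Suc by simp
  qed
  have sub: "Zs i \<subseteq> vecs V (b i)" by (auto simp: Zs_def split: nat.splits)
  show ?thesis
  proof (intro equalityI subsetI)
    fix u assume "u \<in> Zs i"
    then have u: "u \<in> vecs V (b i)" using sub by blast
    then obtain x where x: "x \<in> carrier (free_module R (b (Suc i)))" "to_ext (b i) u = d (Suc i) x"
      using ker \<open>u \<in> Zs i\<close> by blast
    then have "u = del i (to_vec (b (Suc i)) x)"
      unfolding del_def using to_vec_to_ext[OF u] to_ext_to_vec[OF x(1)] by simp
    then show "u \<in> del i ` vecs V (b (Suc i))" using to_vec_mem[OF x(1)] by blast
  next
    fix u assume "u \<in> del i ` vecs V (b (Suc i))"
    then obtain w where w: "w \<in> vecs V (b (Suc i))" "u = del i w" by blast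
    show "u \<in> Zs i"
      using ker[of u] del_vec[OF w(1)] to_ext_del[OF w(1)] to_ext_mem[where K = K, OF w(1)] w(2) by auto
  qed
qed

private lemma Zs_st: "stable_under vmult V (Zs i)"
  unfolding stable_under_def
proof (intro conjI ballI)
  have z: "0 \<in> vecs V (b (Suc i))" by (rule stable_zero[OF stable_vecs])
  show "0 \<in> Zs i" unfolding Zs_eq using del_zero[of i] z by (metis image_eqI)
next
  fix x y assume "x \<in> Zs i" "y \<in> Zs i"
  then obtain u w where uw: "u \<in> vecs V (b (Suc i))" "x = del i u" "w \<in> vecs V (b (Suc i))" "y = del i w"
    unfolding Zs_eq by blast
  have uw': "u - w \<in> vecs V (b (Suc i))" by (rule stable_diff[OF stable_vecs uw(1,3)])
  have "x - y = del i (u - w)" using del_add[OF uw' uw(3)] uw by simp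
  then show "x - y \<in> Zs i" unfolding Zs_eq using uw' by blast
next
  fix x v assume "x \<in> Zs i" "v \<in> V"
  then obtain u where u: "u \<in> vecs V (b (Suc i))" "x = del i u"
    unfolding Zs_eq by blast
  then show "vmult v x \<in> Zs i"
    unfolding Zs_eq using del_vmult[OF u(1) \<open>v \<in> V\<close>] stable_act[OF stable_vecs u(1) \<open>v \<in> V\<close>]
    by (metis image_eqI)
qed

private lemma del_map:
  "commuting_operators_map vmult vmult V (vecs V (b (Suc i))) {0} (Zs i) (del i)"
proof (rule commuting_operators_mapI)
  show "stable_under vmult V {0 :: nat \<Rightarrow> ('v, 'k) mpoly}"
    by (auto simp: stable_under_def vmult_def zero_fun_def)
  show "{0} \<subseteq> Zs i" using stable_zero[OF Zs_st] by blast
  show "stable_under vmult V (Zs i)" by (rule Zs_st)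
  show "stable_under vmult V (vecs V (b (Suc i)) :: (nat \<Rightarrow> ('v, 'k) mpoly) set)" by (rule stable_vecs)
qed (auto simp: del_zero del_add del_vmult Zs_eq)

private lemma vec_res: "vec_resolution V \<Gamma> b eps del Zs"
  by (intro vec_resolution.intro eps_map del_map) (simp_all add: Zs_def)

text \<open>The Koszul complex is taken on all variables of \<open>V\<close>, whose span in the free
  module is exactly where minimality places the images.\<close>

lemma minimal_resolution_rank_0:
  assumes "finite V" "pd_bound V \<Gamma> p" "i > p"
    and min: "\<And>i. d (Suc i) ` carrier (free_module R (b (Suc i))) \<subseteq> {..<b i} \<rightarrow>\<^sub>E irrelevant_ideal K V"
  shows "b i = 0"
proof -
  obtain vs where vs: "distinct vs" "set vs = V"
    using finite_distinct_list[OF assms(1)] by blast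
  obtain i' where i: "i = Suc i'" using assms(3) by (cases i) auto
  show ?thesis
    unfolding i
  proof (rule vec_resolution.rank_0_if_acyclic[OF vec_res _ vs(1)])
    show "acyclic_at vmult vs (Suc i') (vecs V 1) (vec_ideal V \<Gamma> :: (nat \<Rightarrow> ('v, 'k) mpoly) set)"
      using pd_bound_acyclic[OF assms(2) vs(1)] vs(2) assms(3) i by simp
    show "set vs \<subseteq> V" using vs by simp
    fix i and u :: "nat \<Rightarrow> ('v, 'k) mpoly" assume u: "u \<in> vecs V (b (Suc i))"
    show "del i u \<in> var_span vmult vs (vecs V (b i))"
    proof (rule vecs_in_var_span)
      show "set vs \<subseteq> V" using vs by simp
      show "del i u \<in> vecs V (b i)" by (rule del_vec[OF u])
      fix j k assume k: "k \<in> keys (del i u j)"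
      then have "j < b i" by (auto simp: del_def to_vec_def split: if_splits)
      moreover have "d (Suc i) (to_ext (b (Suc i)) u) \<in> {..<b i} \<rightarrow>\<^sub>E irrelevant_ideal K V"
        using min[of i] to_ext_mem[where K = K, OF u] by blast
      ultimately have "del i u j \<in> irrelevant_ideal K V"
        by (auto simp: del_def to_vec_def)
      then show "\<exists>v\<in>set vs. v \<in> keys k"
        using k vs(2) unfolding irrelevant_ideal_eq[OF assms(1)] by (auto simp: monomial_ideal_def)
    qed
  qed
qed

lemma resolution_rank_nonzero:
  assumes "finite V" and A: "A \<subseteq> V" "\<And>f. f \<in> \<Gamma> \<Longrightarrow> \<not> f \<subseteq> A"
    "\<And>c. c \<in> V - A \<Longrightarrow> \<exists>a\<in>A. {c, a} \<in> \<Gamma>" and "card (V - A) > 0"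
  shows "b (card (V - A)) \<noteq> 0"
proof
  assume b0: "b (card (V - A)) = 0"
  obtain ws where ws: "distinct ws" "set ws = V - A"
    using finite_distinct_list[of "V - A"] assms(1) by blast
  let ?n = "length ws"
  have n: "card (V - A) = ?n" using ws distinct_card by metis
  then obtain h where h: "?n = Suc h" using assms(5) by (cases ws) auto
  have "acyclic_at vmult ws (Suc h) (vecs V 1) (vec_ideal V \<Gamma> :: (nat \<Rightarrow> ('v, 'k) mpoly) set)"
    by (rule vec_resolution.acyclic_if_rank_0[OF vec_res]) (use b0 n h ws in auto)
  then have ac: "acyclic_at vmult ws ?n (vecs V 1) (vec_ideal V \<Gamma> :: (nat \<Rightarrow> ('v, 'k) mpoly) set)"
    using h by simp
  have finA: "finite A" using A(1) assms(1) finite_subset by blast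
  define m :: "nat \<Rightarrow> ('v, 'k) mpoly" where
    "m = (\<lambda>j. if j = 0 then single (mexp A) 1 else 0)"
  have m: "m \<in> vecs V 1" using A(1) finA by (auto simp: m_def vecs_def intro!: polys_single)
  have mv: "vmult c m \<in> vec_ideal V \<Gamma>" if c: "c \<in> V - A" for c
  proof -
    obtain a where a: "a \<in> A" "{c, a} \<in> \<Gamma>" using A(3)[OF c] by blast
    have "var c * m 0 = single (single c 1 + mexp A) 1"
      by (simp add: m_def var_def mult_single)
    moreover have "keys (single c 1 + mexp A) = insert c A"
      using finA by (simp add: keys_add_nat)
    ultimately have "var c * m 0 \<in> I"
      using a c A(1) by (auto simp: monomial_ideal_def intro!: polys_single bexI[of _ "{c, a}"])
    then show ?thesis
      using stable_act[OF stable_vecs m, of c] c by (auto simp: vec_ideal_def vmult_def)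
  qed
  define c where "c = (\<lambda>b. if b = replicate ?n True then m else 0)"
  have cc: "c \<in> koszul_chain ?n ?n (vecs V 1)"
  proof (rule chainI)
    have "(0 :: nat \<Rightarrow> ('v, 'k) mpoly) \<in> vecs V 1" by (rule stable_zero[OF stable_vecs])
    then show "c b \<in> vecs V 1" for b using m by (simp add: c_def)
    show "length b = ?n \<and> count_list b True = ?n" if "c b \<noteq> 0" for b
      using that length_count[of b ?n] by (auto simp: c_def split: if_splits)
  qed
  \<comment> \<open>Generalised to every chain with values \<open>m\<close> and 0, since the
    recursion over \<open>vs\<close> passes to the components of the chain.\<close>
  have "koszul_d vmult vs c' b \<in> vec_ideal V \<Gamma>"
    if "set vs \<subseteq> V - A" "\<And>b. c' b = m \<or> c' b = 0" for vs b c'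
    using that
  proof (induction vs arbitrary: b c')
    case Nil
    have "(0 :: nat \<Rightarrow> ('v, 'k) mpoly) \<in> vec_ideal V \<Gamma>" by (rule stable_zero[OF stable_vec_ideal])
    then show ?case by (simp only: koszul_d.simps)
  next
    case (Cons v vs)
    have IH: "koszul_d vmult vs (\<lambda>b. c' (t # b)) b' \<in> vec_ideal V \<Gamma>" for t b'
      by (rule Cons.IH) (use Cons.prems in auto)
    have z: "(0 :: nat \<Rightarrow> ('v, 'k) mpoly) \<in> vec_ideal V \<Gamma>" by (rule stable_zero[OF stable_vec_ideal])
    have "vmult v (c' b') \<in> vec_ideal V \<Gamma>" for b'
    proof (cases "c' b' = m")
      case True
      then show ?thesis using mv[of v] Cons.prems(1) by auto
    next
      case False
      then have "c' b' = 0" using Cons.prems(2) by blast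
      then show ?thesis using z by (simp only: vmult.X_zero)
    qed
    then show ?case
      using IH z by (cases b) (auto simp only: koszul_d.simps list.case split: if_splits
          intro!: stable_add[OF stable_vec_ideal] stable_uminus[OF stable_vec_ideal])
  qed
  then have "\<forall>b. koszul_d vmult ws c b \<in> vec_ideal V \<Gamma>" using ws by (auto simp: c_def)
  then obtain e where e: "e \<in> koszul_chain ?n (Suc ?n) (vecs V 1)" "\<And>b. c b - koszul_d vmult ws e b \<in> vec_ideal V \<Gamma>"
    using ac cc unfolding acyclic_at_def by metis
  \<comment> \<open>There are no chains above the top degree, so the cycle can bound only if
    \<open>m\<close> itself lies in the ideal; but \<open>A\<close> contains no edge.\<close>
  have "e = (\<lambda>b. 0)"
  proof
    fix b show "e b = 0"
      using chain_supp[OF e(1), of b] count_le_length[of b True] by fastforce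
  qed
  then have "koszul_d vmult ws e b = 0" for b by simp
  then have "m \<in> vec_ideal V \<Gamma>" using e(2)[of "replicate ?n True"] by (simp add: c_def)
  then have "single (mexp A) 1 \<in> I" by (simp add: vec_ideal_def m_def)
  then obtain T where "T \<in> \<Gamma>" "T \<subseteq> A" using finA by (auto simp: monomial_ideal_def)
  then show False using A(2) by blast
qed

end

section \<open>Squarefree modules\<close>

definition lincomb :: "nat \<Rightarrow> (nat \<Rightarrow> 'k::field) \<Rightarrow> (nat \<Rightarrow> nat \<Rightarrow> 'k) \<Rightarrow> nat \<Rightarrow> 'k" where
  "lincomb m \<mu> g = (\<lambda>j. \<Sum>i<m. \<mu> i * g i j)"

definition coeff_subspace :: "(nat \<Rightarrow> 'k::field) set \<Rightarrow> bool" where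
  "coeff_subspace W \<longleftrightarrow> (\<lambda>j. 0) \<in> W \<and> (\<forall>c\<in>W. \<forall>d\<in>W. \<forall>x. (\<lambda>j. c j + x * d j) \<in> W)"

lemma subsp_comb: "coeff_subspace W \<Longrightarrow> c \<in> W \<Longrightarrow> d \<in> W \<Longrightarrow> (\<lambda>j. c j + x * d j) \<in> W"
  by (simp add: coeff_subspace_def)

lemma subsp_sum:
  assumes "coeff_subspace W" "\<And>i. i \<in> G \<Longrightarrow> \<mu> i \<noteq> 0 \<Longrightarrow> h i \<in> W"
  shows "(\<lambda>j. \<Sum>i\<in>G. \<mu> i * h i j) \<in> W"
  using assms(2)
proof (induction G rule: infinite_finite_induct)
  case (insert i G)
  have IH: "(\<lambda>j. \<Sum>i\<in>G. \<mu> i * h i j) \<in> W" using insert by auto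
  show ?case
  proof (cases "\<mu> i = 0")
    case True
    then show ?thesis using IH insert.hyps by simp
  next
    case False
    then show ?thesis
      using subsp_comb[OF assms(1) IH, of "h i" "\<mu> i"] insert by (simp add: add.commute)
  qed
qed (use assms(1) in \<open>auto simp: coeff_subspace_def\<close>)

text \<open>Gaussian elimination on the last coordinate: at most one spanning vector with a nonzero
  entry there is added to a finite spanning set of the rest.\<close>

lemma subsp_finite_span:
  assumes "coeff_subspace W" "\<And>c j. c \<in> W \<Longrightarrow> c j \<noteq> 0 \<Longrightarrow> j < n"
  shows "\<exists>C. finite C \<and> C \<subseteq> W \<and> (\<forall>c\<in>W. \<exists>\<mu>. c = (\<lambda>j. \<Sum>x\<in>C. \<mu> x * x j))"
  using assms
proof (induction n arbitrary: W)
  case 0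
  then have "c = (\<lambda>j. 0)" if "c \<in> W" for c using that by fastforce
  then show ?case by (intro exI[of _ "{}"]) auto
next
  case (Suc n)
  let ?W = "{c \<in> W. c n = 0}"
  have sW: "coeff_subspace ?W" using Suc.prems(1) by (auto simp: coeff_subspace_def)
  have supp: "j < n" if "c \<in> ?W" "c j \<noteq> 0" for c j
  proof -
    have "j < Suc n" using that Suc.prems(2) by blast
    moreover have "j \<noteq> n" using that by auto
    ultimately show ?thesis by simp
  qed
  have "\<exists>C. finite C \<and> C \<subseteq> ?W \<and> (\<forall>c\<in>?W. \<exists>\<mu>. c = (\<lambda>j. \<Sum>x\<in>C. \<mu> x * x j))"
    by (rule Suc.IH[OF sW]) (rule supp)
  then obtain C where C: "finite C" "C \<subseteq> ?W"
    "\<forall>c\<in>?W. \<exists>\<mu>. c = (\<lambda>j. \<Sum>x\<in>C. \<mu> x * x j)" by (elim exE conjE)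
  show ?case
  proof (cases "\<exists>w\<in>W. w n \<noteq> 0")
    case False
    then have "?W = W" by auto
    then show ?thesis using C by metis
  next
    case True
    then obtain w where w: "w \<in> W" "w n \<noteq> 0" by blast
    have wC: "w \<notin> C" using C(2) w by auto
    have "\<exists>\<mu>. c = (\<lambda>j. \<Sum>x\<in>insert w C. \<mu> x * x j)" if c: "c \<in> W" for c
    proof -
      define q where "q = c n / w n"
      have "(\<lambda>j. c j + (- q) * w j) \<in> ?W"
        using subsp_comb[OF Suc.prems(1) c w(1), of "- q"] w(2) by (simp add: q_def)
      from bspec[OF C(3) this] obtain \<mu> where
        \<mu>: "(\<lambda>j. c j + (- q) * w j) = (\<lambda>j. \<Sum>x\<in>C. \<mu> x * x j)"
        by (elim exE)
      have "c = (\<lambda>j. \<Sum>x\<in>insert w C. (\<mu>(w := q)) x * x j)"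
      proof
        fix j
        have "(\<Sum>x\<in>C. (\<mu>(w := q)) x * x j) = (\<Sum>x\<in>C. \<mu> x * x j)"
          by (rule sum.cong) (use wC in auto)
        also have "\<dots> = c j - q * w j" using fun_cong[OF \<mu>, of j] by simp
        finally show "c j = (\<Sum>x\<in>insert w C. (\<mu>(w := q)) x * x j)"
          using C(1) wC by simp
      qed
      then show ?thesis by blast
    qed
    then show ?thesis using C(1,2) w(1) by (intro exI[of _ "insert w C"] conjI ballI) auto
  qed
qed

section \<open>Minimal generators in squarefree multidegrees\<close>

text \<open>A squarefree submodule of \<open>S\<^sup>n\<close>, the \<open>j\<close>-th basis element having multidegree \<open>A j\<close>, is
  determined by the coefficient spaces \<open>L T\<close> of its elements of squarefree multidegree \<open>T\<close>.
  Strictness of the inclusion \<open>A j \<subset> T\<close> says that the submodule lies in \<open>\<mm> S\<^sup>n\<close>.\<close>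
definition squarefree_system ::
  "'v set \<Rightarrow> nat \<Rightarrow> (nat \<Rightarrow> 'v set) \<Rightarrow> ('v set \<Rightarrow> (nat \<Rightarrow> 'k::field) set) \<Rightarrow> bool" where
  "squarefree_system V n A L \<longleftrightarrow> (\<forall>j. A j \<subseteq> V) \<and> (\<forall>T. coeff_subspace (L T)) \<and> (\<forall>T U. T \<subseteq> U \<longrightarrow> L T \<subseteq> L U) \<and>
     (\<forall>T. \<forall>c\<in>L T. \<forall>j. c j \<noteq> 0 \<longrightarrow> j < n \<and> A j \<subset> T)"

text \<open>The relations of multidegree \<open>T\<close> among generators \<open>g i\<close> of
  multidegree \<open>B i\<close>, i.e. the coefficient spaces of the next syzygy module.\<close>

definition kernel_system ::
  "nat \<Rightarrow> (nat \<Rightarrow> 'v set) \<Rightarrow> (nat \<Rightarrow> nat \<Rightarrow> 'k::field) \<Rightarrow> 'v set \<Rightarrow> (nat \<Rightarrow> 'k) set" where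
  "kernel_system m B g T = {\<mu>. (\<forall>i. \<mu> i \<noteq> 0 \<longrightarrow> i < m \<and> B i \<subseteq> T) \<and> (\<forall>j. lincomb m \<mu> g j = 0)}"

text \<open>Generation is tested in squarefree multidegrees; \<open>matrix_map_image\<close> extends
  it to all multidegrees.\<close>

definition generates ::
  "'v set \<Rightarrow> ('v set \<Rightarrow> (nat \<Rightarrow> 'k::field) set) \<Rightarrow> nat \<Rightarrow> (nat \<Rightarrow> 'v set) \<Rightarrow> (nat \<Rightarrow> nat \<Rightarrow> 'k) \<Rightarrow> bool" where
  "generates V L m B g \<longleftrightarrow> (\<forall>i<m. g i \<in> L (B i)) \<and>
     (\<forall>T\<subseteq>V. \<forall>c\<in>L T. \<exists>\<mu>. (\<forall>i. \<mu> i \<noteq> 0 \<longrightarrow> i < m \<and> B i \<subseteq> T) \<and> c = lincomb m \<mu> g)"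

text \<open>Spanning sets of the finitely many spaces \<open>L T\<close> form a finite generating
  family, and one of least size is taken. Its irredundancy is what makes the inclusions for the
  relations strict, so that the construction can be repeated.\<close>

lemma exists_minimal_generators:
  assumes "finite V" "squarefree_system V n A (L :: 'v set \<Rightarrow> (nat \<Rightarrow> 'k::field) set)"
  shows "\<exists>m B g. generates V L m B g \<and> squarefree_system V m B (kernel_system m B g)"
proof -
  have sub: "coeff_subspace (L T)" and mono: "T \<subseteq> U \<Longrightarrow> L T \<subseteq> L U"
    and supp: "c \<in> L T \<Longrightarrow> c j \<noteq> 0 \<Longrightarrow> j < n" for T U c j
    using assms(2) by (auto simp: squarefree_system_def)
  define gen where "gen G \<longleftrightarrow> finite G \<and> (\<forall>p\<in>G. fst p \<subseteq> V \<and> snd p \<in> L (fst p)) \<and>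
    (\<forall>T\<subseteq>V. \<forall>c\<in>L T. \<exists>\<mu>. (\<forall>p\<in>G. \<mu> p \<noteq> 0 \<longrightarrow> fst p \<subseteq> T) \<and> c = (\<lambda>j. \<Sum>p\<in>G. \<mu> p * snd p j))"
    for G :: "('v set \<times> (nat \<Rightarrow> 'k)) set"
  have "\<exists>C. finite C \<and> C \<subseteq> L T \<and> (\<forall>c\<in>L T. \<exists>\<mu>. c = (\<lambda>j. \<Sum>x\<in>C. \<mu> x * x j))" for T
    by (rule subsp_finite_span[OF sub supp])
  then have "\<exists>C. \<forall>T. finite (C T) \<and> C T \<subseteq> L T \<and> (\<forall>c\<in>L T. \<exists>\<mu>. c = (\<lambda>j. \<Sum>x\<in>C T. \<mu> x * x j))"
    by (intro choice allI)
  then obtain C where C0: "\<forall>T. finite (C T) \<and> C T \<subseteq> L T \<and> (\<forall>c\<in>L T. \<exists>\<mu>. c = (\<lambda>j. \<Sum>x\<in>C T. \<mu> x * x j))"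
    by (elim exE)
  have C: "finite (C T)" "C T \<subseteq> L T" "c \<in> L T \<Longrightarrow> \<exists>\<mu>. c = (\<lambda>j. \<Sum>x\<in>C T. \<mu> x * x j)" for T c
    using C0[rule_format, of T] by simp_all
  have "gen (Sigma (Pow V) C)"
    unfolding gen_def
  proof (intro conjI allI impI ballI)
    show "finite (Sigma (Pow V) C)" using C(1) assms(1) by auto
    show "fst p \<subseteq> V" "snd p \<in> L (fst p)" if "p \<in> Sigma (Pow V) C" for p
      using that C(2)[of "fst p"] by auto
    fix T c assume T: "T \<subseteq> V" "c \<in> L T"
    obtain \<mu> where \<mu>: "c = (\<lambda>j. \<Sum>x\<in>C T. \<mu> x * x j)" using C(3)[OF T(2)] by blast
    define \<nu> where "\<nu> p = (if fst p = T then \<mu> (snd p) else 0)" for p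
    have "c j = (\<Sum>p\<in>Sigma (Pow V) C. \<nu> p * snd p j)" for j
    proof -
      have "(\<Sum>p\<in>Sigma (Pow V) C. \<nu> p * snd p j) = (\<Sum>p\<in>Pair T ` C T. \<nu> p * snd p j)"
        by (rule sum.mono_neutral_right) (use C(1) assms(1) T in \<open>auto simp: \<nu>_def\<close>)
      also have "\<dots> = (\<Sum>x\<in>C T. \<mu> x * x j)"
        by (subst sum.reindex) (auto simp: inj_on_def \<nu>_def)
      finally show ?thesis using \<mu> by simp
    qed
    then show "\<exists>\<mu>. (\<forall>p\<in>Sigma (Pow V) C. \<mu> p \<noteq> 0 \<longrightarrow> fst p \<subseteq> T) \<and>
        c = (\<lambda>j. \<Sum>p\<in>Sigma (Pow V) C. \<mu> p * snd p j)"
      by (intro exI[of _ \<nu>]) (auto simp: \<nu>_def)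
  qed
  then obtain G where G: "gen G" and Gmin: "\<And>G'. gen G' \<Longrightarrow> card G \<le> card G'"
    using ex_has_least_nat[of gen "Sigma (Pow V) C" card] by blast
  have finG: "finite G" and GL: "\<And>p. p \<in> G \<Longrightarrow> fst p \<subseteq> V \<and> snd p \<in> L (fst p)"
    and Ggen: "\<And>T c. T \<subseteq> V \<Longrightarrow> c \<in> L T \<Longrightarrow>
      \<exists>\<mu>. (\<forall>p\<in>G. \<mu> p \<noteq> 0 \<longrightarrow> fst p \<subseteq> T) \<and> c = (\<lambda>j. \<Sum>p\<in>G. \<mu> p * snd p j)"
    using G unfolding gen_def by blast+
  text \<open>A relation with a nonzero coefficient at a generator of full multidegree would make that
    generator redundant.\<close>
  have irred: "fst p0 \<noteq> T"
    if \<mu>: "T \<subseteq> V" "\<And>p. p \<in> G \<Longrightarrow> \<mu> p \<noteq> 0 \<Longrightarrow> fst p \<subseteq> T" "\<And>j. (\<Sum>p\<in>G. \<mu> p * snd p j) = 0"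
      "p0 \<in> G" "\<mu> p0 \<noteq> 0" for T \<mu> p0
  proof
    assume T: "fst p0 = T"
    let ?G = "G - {p0}"
    have p0: "snd p0 j = (\<Sum>p\<in>?G. (- \<mu> p / \<mu> p0) * snd p j)" for j
    proof -
      have "\<mu> p0 * snd p0 j + (\<Sum>p\<in>?G. \<mu> p * snd p j) = 0"
        using \<mu>(3)[of j] sum.remove[OF finG \<mu>(4), of "\<lambda>p. \<mu> p * snd p j"] by simp
      then have "\<mu> p0 * snd p0 j = (\<Sum>p\<in>?G. - \<mu> p * snd p j)"
        by (simp add: sum_negf eq_neg_iff_add_eq_0)
      then have "snd p0 j = (\<Sum>p\<in>?G. - \<mu> p * snd p j) / \<mu> p0"
        using \<mu>(5) by (simp add: field_simps)
      then show ?thesis by (simp add: sum_divide_distrib)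
    qed
    have "gen ?G"
      unfolding gen_def
    proof (intro conjI allI impI ballI)
      show "finite ?G" using finG by simp
      show "fst p \<subseteq> V" "snd p \<in> L (fst p)" if "p \<in> ?G" for p
        using that GL by auto
      fix U c assume U: "U \<subseteq> V" "c \<in> L U"
      obtain \<nu> where \<nu>: "\<And>p. p \<in> G \<Longrightarrow> \<nu> p \<noteq> 0 \<Longrightarrow> fst p \<subseteq> U" "c = (\<lambda>j. \<Sum>p\<in>G. \<nu> p * snd p j)"
        using Ggen[OF U] by blast
      \<comment> \<open>The redundant generator is replaced by its expression through the others.
        The multidegrees stay admissible, as those used in the expression are contained in that of
        \<open>p0\<close>.\<close>
      let ?\<nu> = "\<lambda>p. \<nu> p + \<nu> p0 * (- \<mu> p / \<mu> p0)"
      have "c j = (\<Sum>p\<in>?G. ?\<nu> p * snd p j)" for j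
      proof -
        have "c j = \<nu> p0 * snd p0 j + (\<Sum>p\<in>?G. \<nu> p * snd p j)"
          using \<nu>(2) sum.remove[OF finG \<mu>(4), of "\<lambda>p. \<nu> p * snd p j"] by simp
        also have "\<dots> = (\<Sum>p\<in>?G. \<nu> p0 * ((- \<mu> p / \<mu> p0) * snd p j)) + (\<Sum>p\<in>?G. \<nu> p * snd p j)"
          by (subst p0) (simp only: sum_distrib_left)
        also have "\<dots> = (\<Sum>p\<in>?G. ?\<nu> p * snd p j)"
          unfolding sum.distrib[symmetric] by (rule sum.cong) (auto simp: algebra_simps)
        finally show ?thesis .
      qed
      moreover have "fst p \<subseteq> U" if p: "p \<in> ?G" "?\<nu> p \<noteq> 0" for p
      proof (cases "\<nu> p = 0")
        case True
        then have "\<nu> p0 \<noteq> 0" "\<mu> p \<noteq> 0" using p by auto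
        then have "fst p \<subseteq> fst p0" "fst p0 \<subseteq> U" using \<mu>(2)[of p] \<nu>(1)[OF \<mu>(4)] p T by auto
        then show ?thesis by blast
      next
        case False
        then show ?thesis using \<nu>(1) p by auto
      qed
      ultimately show "\<exists>\<mu>. (\<forall>p\<in>?G. \<mu> p \<noteq> 0 \<longrightarrow> fst p \<subseteq> U) \<and> c = (\<lambda>j. \<Sum>p\<in>?G. \<mu> p * snd p j)"
        by (intro exI[of _ ?\<nu>]) blast
    qed
    from Gmin[OF this] show False
      using \<mu>(4) finG by (meson card_Diff1_less leD)
  qed
  define m where "m = card G"
  obtain f where f: "bij_betw f {..<m} G"
    using ex_bij_betw_nat_finite[OF finG] by (auto simp: m_def atLeast0LessThan)
  \<comment> \<open>The value outside the range is \<open>{}\<close> because a squarefree system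
    asks for a subset of \<open>V\<close> at every index.\<close>
  define B where "B i = (if i < m then fst (f i) else {})" for i
  define g where "g i = snd (f i)" for i
  have fG: "f i \<in> G" if "i < m" for i using f that by (auto simp: bij_betw_def)
  have reidx: "(\<Sum>p\<in>G. \<mu> p * snd p j) = (\<Sum>i<m. \<mu> (f i) * g i j)" for \<mu> j
    using sum.reindex_bij_betw[OF f, of "\<lambda>p. \<mu> p * snd p j"] by (simp add: g_def)
  define finv where "finv = the_inv_into {..<m} f"
  have finv: "finv (f i) = i" if "i < m" for i
    using f that by (auto simp: finv_def bij_betw_def the_inv_into_f_f)
  have "generates V L m B g"
    unfolding generates_def
  proof (intro conjI allI impI ballI)
    show "g i \<in> L (B i)" if "i < m" for i using GL[OF fG[OF that]] that by (simp add: g_def B_def)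
    fix T c assume T: "T \<subseteq> V" "c \<in> L T"
    obtain \<nu> where \<nu>: "\<forall>p\<in>G. \<nu> p \<noteq> 0 \<longrightarrow> fst p \<subseteq> T" "c = (\<lambda>j. \<Sum>p\<in>G. \<nu> p * snd p j)"
      using Ggen[OF T] by blast
    let ?\<mu> = "\<lambda>i. if i < m then \<nu> (f i) else 0"
    have "c = lincomb m ?\<mu> g"
      unfolding \<nu>(2) lincomb_def reidx by simp
    moreover have "\<forall>i. ?\<mu> i \<noteq> 0 \<longrightarrow> i < m \<and> B i \<subseteq> T" using \<nu>(1) fG by (auto simp: B_def)
    ultimately show "\<exists>\<mu>. (\<forall>i. \<mu> i \<noteq> 0 \<longrightarrow> i < m \<and> B i \<subseteq> T) \<and> c = lincomb m \<mu> g"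
      by (intro exI[of _ ?\<mu>] conjI)
  qed
  moreover have "squarefree_system V m B (kernel_system m B g)"
    unfolding squarefree_system_def
  proof (intro conjI allI impI ballI)
    show BV: "B i \<subseteq> V" for i using GL[OF fG] by (simp add: B_def)
    show "coeff_subspace (kernel_system m B g T)" for T
      unfolding coeff_subspace_def
    proof (intro conjI ballI allI)
      show "(\<lambda>j. 0) \<in> kernel_system m B g T" by (simp add: kernel_system_def lincomb_def)
      fix c d x assume cd: "c \<in> kernel_system m B g T" "d \<in> kernel_system m B g T"
      have "lincomb m (\<lambda>j. c j + x * d j) g j = lincomb m c g j + x * lincomb m d g j" for j
        by (simp add: lincomb_def algebra_simps sum.distrib sum_distrib_left)
      moreover have "i < m \<and> B i \<subseteq> T" if "c i + x * d i \<noteq> 0" for i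
      proof -
        have "c i \<noteq> 0 \<or> d i \<noteq> 0" using that by auto
        then show ?thesis using cd by (auto simp: kernel_system_def)
      qed
      ultimately show "(\<lambda>j. c j + x * d j) \<in> kernel_system m B g T"
        using cd by (simp add: kernel_system_def)
    qed
    show "kernel_system m B g T \<subseteq> kernel_system m B g U" if "T \<subseteq> U" for T U
      using that by (auto simp: kernel_system_def)
    fix T \<mu> i assume \<mu>: "\<mu> \<in> kernel_system m B g T" "\<mu> i \<noteq> 0"
    then show i: "i < m" by (auto simp: kernel_system_def)
    have BT: "B i \<subseteq> T" using \<mu> by (auto simp: kernel_system_def)
    moreover have "B i \<noteq> T"
    proof
      assume "B i = T"
      then have TV: "T \<subseteq> V" using BV by blast
      have "fst (f i) \<noteq> T"
      proof (rule irred[OF TV, of "\<mu> \<circ> finv"])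
        fix p assume p: "p \<in> G" "(\<mu> \<circ> finv) p \<noteq> 0"
        then obtain k where k: "k < m" "p = f k" using f by (auto simp: bij_betw_def)
        then have "\<mu> k \<noteq> 0" using p finv by simp
        then have "B k \<subseteq> T" using \<mu> by (auto simp: kernel_system_def)
        then show "fst p \<subseteq> T" using k by (simp add: B_def)
      next
        fix j
        have "(\<Sum>p\<in>G. (\<mu> \<circ> finv) p * snd p j) = lincomb m \<mu> g j"
          unfolding reidx lincomb_def by (rule sum.cong) (auto simp: finv)
        then show "(\<Sum>p\<in>G. (\<mu> \<circ> finv) p * snd p j) = 0"
          using \<mu> by (simp add: kernel_system_def)
      qed (use fG i finv \<mu> in auto)
      then show False using \<open>B i = T\<close> i by (simp add: B_def)
    qed
    ultimately show "B i \<subset> T" by blast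
  qed
  ultimately show ?thesis by blast
qed

text \<open>The component of \<open>u\<close> in multidegree \<open>w\<close>: coordinate
  \<open>j\<close> is the coefficient of the monomial that reaches \<open>w\<close> when multiplied
  by the \<open>j\<close>-th basis element, of multidegree \<open>A j\<close>.\<close>

definition coeff_vec ::
  "nat \<Rightarrow> (nat \<Rightarrow> 'v set) \<Rightarrow> (nat \<Rightarrow> ('v, 'k::field) mpoly) \<Rightarrow> ('v \<Rightarrow>\<^sub>0 nat) \<Rightarrow> nat \<Rightarrow> 'k" where
  "coeff_vec n A u w = (\<lambda>j. if j < n \<and> A j \<subseteq> keys w
     then lookup (u j) (w - mexp (A j)) else 0)"

text \<open>The homogeneous map of multigraded free modules given by the scalar matrix
  \<open>g\<close>; the monomial factors make up the differences of the multidegrees.\<close>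

definition matrix_map ::
  "nat \<Rightarrow> (nat \<Rightarrow> 'v set) \<Rightarrow> (nat \<Rightarrow> 'v set) \<Rightarrow> (nat \<Rightarrow> nat \<Rightarrow> 'k) \<Rightarrow>
   (nat \<Rightarrow> ('v, 'k::field) mpoly) \<Rightarrow> nat \<Rightarrow> ('v, 'k) mpoly" where
  "matrix_map m B A g u = (\<lambda>j. \<Sum>i<m. u i * single (mexp (B i - A j)) (g i j))"

text \<open>The component in multidegree \<open>w\<close> depends only on the support of
  \<open>w\<close>, which is squarefreeness of the module.\<close>

definition system_module ::
  "'v set \<Rightarrow> nat \<Rightarrow> (nat \<Rightarrow> 'v set) \<Rightarrow> ('v set \<Rightarrow> (nat \<Rightarrow> 'k::field) set) \<Rightarrow> (nat \<Rightarrow> ('v, 'k) mpoly) set" where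
  "system_module V n A L = {u \<in> vecs V n. \<forall>w. coeff_vec n A u w \<in> L (keys w)}"

lemma vecs_eqI:
  assumes A: "\<And>j. finite (A j)" and "u \<in> vecs V n" "u' \<in> vecs V n"
    and "\<And>w. coeff_vec n A u w = coeff_vec n A u' w"
  shows "u = u'"
proof
  fix j
  show "u j = u' j"
  proof (cases "j < n")
    case True
    show ?thesis
    proof (rule poly_mapping_eqI)
      fix e
      have "A j \<subseteq> keys (e + mexp (A j))" using A by (simp add: keys_add_nat)
      then show "lookup (u j) e = lookup (u' j) e"
        using fun_cong[OF assms(4), of "e + mexp (A j)" j] True by (simp add: coeff_vec_def)
    qed
  next
    case False
    then show ?thesis using assms(2,3) by (simp add: vecs_def)
  qed
qed

text \<open>In each multidegree the map acts by the scalar matrix \<open>g\<close>, which reduces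
  kernels and images to linear algebra.\<close>

lemma coeff_vec_matrix_map:
  assumes fin: "\<And>j. finite (A j)" "\<And>i. finite (B i)"
    and g: "\<And>i j. i < m \<Longrightarrow> g i j \<noteq> 0 \<Longrightarrow> j < n \<and> A j \<subseteq> B i"
  shows "coeff_vec n A (matrix_map m B A g u) w = lincomb m (coeff_vec m B u w) g"
proof
  fix j
  let ?K = "keys w"
  show "coeff_vec n A (matrix_map m B A g u) w j = lincomb m (coeff_vec m B u w) g j"
  proof (cases "j < n \<and> A j \<subseteq> ?K")
    case True
    have "lookup (u i * single (mexp (B i - A j)) (g i j)) (w - mexp (A j)) =
        coeff_vec m B u w i * g i j" if i: "i < m" for i
    proof (cases "g i j = 0")
      case False
      then have AB: "A j \<subseteq> B i" using g[OF i] by blast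
      show ?thesis
      proof (cases "B i \<subseteq> ?K")
        case True
        have "w - mexp (A j) = mexp (B i - A j) + (w - mexp (B i))"
        proof (rule poly_mapping_eqI)
          fix x show "lookup (w - mexp (A j)) x =
              lookup (mexp (B i - A j) + (w - mexp (B i))) x"
            using True AB fin by (auto simp: lookup_minus lookup_add lookup_mexp in_keys_iff Suc_leI)
        qed
        then show ?thesis
          using True i by (simp add: coeff_vec_def lookup_single_mult_add mult.commute[of "u i"])
      next
        case nB: False
        then obtain x where x: "x \<in> B i" "x \<notin> ?K" by blast
        have "w - mexp (A j) \<noteq> mexp (B i - A j) + e" for e
        proof
          assume "w - mexp (A j) = mexp (B i - A j) + e"
          then have "lookup (w - mexp (A j)) x = lookup (mexp (B i - A j) + e) x"
            by simp
          moreover have "x \<notin> A j" using x True by auto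
          ultimately show False
            using x fin by (simp add: lookup_minus lookup_add lookup_mexp in_keys_iff)
        qed
        then show ?thesis
          using nB by (simp add: coeff_vec_def lookup_single_mult_other mult.commute[of "u i"])
      qed
    qed simp
    then show ?thesis
      using True by (simp add: coeff_vec_def[of n] matrix_map_def lincomb_def lookup_sum)
  next
    case False
    have "coeff_vec m B u w i * g i j = 0" if "i < m" for i
      using g[OF that, of j] False by (auto simp: coeff_vec_def)
    then have "lincomb m (coeff_vec m B u w) g j = 0"
      unfolding lincomb_def by (intro sum.neutral) simp
    then show ?thesis using False by (auto simp: coeff_vec_def[of n])
  qed
qed

lemma matrix_map_vecs:
  assumes "\<And>i. B i \<subseteq> V" "finite V" "\<And>i j. i < m \<Longrightarrow> g i j \<noteq> 0 \<Longrightarrow> j < n" "u \<in> vecs V m"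
  shows "matrix_map m B A g u \<in> vecs V n"
proof -
  have "u i * single (mexp (B i - A j)) (g i j) \<in> polys V" for i j
  proof -
    have "finite (B i - A j)" using assms(1,2) by (meson finite_Diff finite_subset)
    then show ?thesis
      using assms(1)[of i] by (intro polys_mult vecs_nth[OF assms(4)] polys_single) auto
  qed
  moreover have "u i * single (mexp (B i - A j)) (g i j) = 0" if "i < m" "j \<ge> n" for i j
    using assms(3)[OF that(1), of j] that(2) by fastforce
  ultimately show ?thesis
    unfolding vecs_def matrix_map_def by (auto intro!: polys_sum)
qed

text \<open>A vector is determined by its components, and the condition on each component sees only
  the support of the multidegree.\<close>

lemma matrix_map_kernel:
  fixes V :: "'v set" and g :: "nat \<Rightarrow> nat \<Rightarrow> 'k::field"
  assumes fin: "\<And>j. finite (A j)" "finite V" and BV: "\<And>i. B i \<subseteq> V"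
    and g: "\<And>i j. i < m \<Longrightarrow> g i j \<noteq> 0 \<Longrightarrow> j < n \<and> A j \<subseteq> B i"
  shows "system_module V m B (kernel_system m B g) = {u \<in> vecs V m. matrix_map m B A g u = 0}"
proof -
  have finB: "finite (B i)" for i using BV fin(2) finite_subset by blast
  have "(\<forall>w. coeff_vec m B u w \<in> kernel_system m B g (keys w)) \<longleftrightarrow> matrix_map m B A g u = 0"
    if u: "u \<in> vecs V m" for u
  proof -
    have "coeff_vec m B u w \<in> kernel_system m B g (keys w) \<longleftrightarrow>
        coeff_vec n A (matrix_map m B A g u) w = coeff_vec n A (0 :: nat \<Rightarrow> ('v, 'k) mpoly) w" for w
    proof -
      have "coeff_vec m B u w \<in> kernel_system m B g (keys w) \<longleftrightarrow>
          lincomb m (coeff_vec m B u w) g = (\<lambda>j. 0)"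
        by (auto simp: kernel_system_def coeff_vec_def fun_eq_iff)
      moreover have "coeff_vec n A (matrix_map m B A g u) w = lincomb m (coeff_vec m B u w) g"
        by (rule coeff_vec_matrix_map[where n = n, OF fin(1) finB g])
      moreover have "coeff_vec n A (0 :: nat \<Rightarrow> ('v, 'k) mpoly) w = (\<lambda>j. 0)" by (auto simp: coeff_vec_def)
      ultimately show ?thesis by (simp only:)
    qed
    then have 1: "(\<forall>w. coeff_vec m B u w \<in> kernel_system m B g (keys w)) \<longleftrightarrow>
        (\<forall>w. coeff_vec n A (matrix_map m B A g u) w = coeff_vec n A (0 :: nat \<Rightarrow> ('v, 'k) mpoly) w)" by blast
    have 2: "matrix_map m B A g u \<in> vecs V n"
      by (rule matrix_map_vecs[OF BV fin(2) _ u]) (use g in blast)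
    have 3: "(0 :: nat \<Rightarrow> ('v, 'k) mpoly) \<in> vecs V n" by (rule stable_zero[OF stable_vecs])
    show ?thesis
      unfolding 1
    proof
      show "matrix_map m B A g u = 0"
        if "\<forall>w. coeff_vec n A (matrix_map m B A g u) w = coeff_vec n A (0 :: nat \<Rightarrow> ('v, 'k) mpoly) w"
        by (rule vecs_eqI[where A = A, OF fin(1) 2 3]) (use that in simp)
    qed simp
  qed
  then show ?thesis unfolding system_module_def by blast
qed

text \<open>Preimages are assembled multidegree by multidegree: the component in \<open>w\<close> is
  combined from the generators for the support of \<open>w\<close>, and the monomial
  \<open>w - mexp (B i)\<close> restores the multidegree.\<close>

lemma matrix_map_image:
  assumes sys: "squarefree_system V n A L" and gen: "generates V L m B g"
    and fin: "finite V" and BV: "\<And>i. B i \<subseteq> V"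
  shows "matrix_map m B A g ` vecs V m = system_module V n A L"
proof -
  have sub: "coeff_subspace (L T)" and mono: "T \<subseteq> U \<Longrightarrow> L T \<subseteq> L U" and AV: "A j \<subseteq> V"
    and supp: "c \<in> L T \<Longrightarrow> c j \<noteq> 0 \<Longrightarrow> j < n \<and> A j \<subset> T" for T U c j
    using sys by (auto simp: squarefree_system_def)
  have gL: "g i \<in> L (B i)" if "i < m" for i using gen that by (simp add: generates_def)
  have g: "j < n \<and> A j \<subseteq> B i" if "i < m" "g i j \<noteq> 0" for i j
    using supp[OF gL that(2)] that by auto
  have finA: "finite (A j)" and finB: "finite (B j)" for j
    using finite_subset[OF AV fin] finite_subset[OF BV fin] .
  have cm: "coeff_vec n A (matrix_map m B A g u) w = lincomb m (coeff_vec m B u w) g" for u w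
    by (rule coeff_vec_matrix_map[where n = n, OF finA finB g])
  show ?thesis
  proof (intro equalityI subsetI)
    fix u assume "u \<in> matrix_map m B A g ` vecs V m"
    then obtain x where x: "x \<in> vecs V m" "u = matrix_map m B A g x" by blast
    have "u \<in> vecs V n"
      unfolding x(2) by (rule matrix_map_vecs[OF BV fin _ x(1)]) (use g in blast)
    moreover have "coeff_vec n A u w \<in> L (keys w)" for w
      unfolding x(2) cm lincomb_def
    proof (rule subsp_sum[OF sub])
      fix i assume "i \<in> {..<m}" "coeff_vec m B x w i \<noteq> 0"
      then have "i < m" "B i \<subseteq> keys w" by (auto simp: coeff_vec_def split: if_splits)
      then show "g i \<in> L (keys w)" using gL mono by blast
    qed
    ultimately show "u \<in> system_module V n A L" by (simp add: system_module_def)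
  next
    fix u assume u: "u \<in> system_module V n A L"
    then have uV: "u \<in> vecs V n" and uL: "\<And>w. coeff_vec n A u w \<in> L (keys w)"
      by (auto simp: system_module_def)
    \<comment> \<open>Only these finitely many multidegrees occur in \<open>u\<close>, so the
      preimage is a finite sum.\<close>
    define W where "W = {w. coeff_vec n A u w \<noteq> (\<lambda>j. 0)}"
    have Wsub: "W \<subseteq> (\<Union>j<n. (\<lambda>e. mexp (A j) + e) ` keys (u j))"
    proof
      fix w assume "w \<in> W"
      then obtain j where "coeff_vec n A u w j \<noteq> 0" by (auto simp: W_def)
      then have j: "j < n" "A j \<subseteq> keys w" "w - mexp (A j) \<in> keys (u j)"
        by (auto simp: coeff_vec_def in_keys_iff split: if_splits)
      then have "w = mexp (A j) + (w - mexp (A j))" using mexp_add_diff[OF finA j(2)] by simp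
      then show "w \<in> (\<Union>j<n. (\<lambda>e. mexp (A j) + e) ` keys (u j))"
        using j by blast
    qed
    then have finW: "finite W" by (rule finite_subset) simp
    have WV: "keys w \<subseteq> V" if w: "w \<in> W" for w
    proof -
      obtain j e where je: "j < n" "e \<in> keys (u j)" "w = mexp (A j) + e"
        using subsetD[OF Wsub w] by blast
      have "u j \<in> polys V" by (rule vecs_nth[OF uV])
      then have "keys e \<subseteq> V" using je(2) by (simp add: polys_def)
      then show ?thesis using AV finA je(3) by (simp add: keys_add_nat)
    qed
    have "\<exists>\<mu>. (\<forall>i. \<mu> i \<noteq> 0 \<longrightarrow> i < m \<and> B i \<subseteq> keys w) \<and> coeff_vec n A u w = lincomb m \<mu> g"
      if w: "w \<in> W" for w
      using gen WV[OF w] uL[of w] unfolding generates_def by blast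
    then obtain \<mu> where \<mu>: "\<And>w i. w \<in> W \<Longrightarrow> \<mu> w i \<noteq> 0 \<Longrightarrow> i < m \<and> B i \<subseteq> keys w"
        "\<And>w. w \<in> W \<Longrightarrow> coeff_vec n A u w = lincomb m (\<mu> w) g"
      by metis
    define x where "x = (\<lambda>i. \<Sum>w\<in>W. single (w - mexp (B i)) (\<mu> w i))"
    have xV: "x \<in> vecs V m"
      unfolding vecs_def
    proof (intro CollectI conjI allI impI)
      fix i
      have "keys (w - mexp (B i)) \<subseteq> V" if "w \<in> W" for w
      proof -
        have "keys (w - mexp (B i)) \<subseteq> keys w"
          by (auto simp: in_keys_iff lookup_minus)
        then show ?thesis using WV[OF that] by blast
      qed
      then show "x i \<in> polys V"
        unfolding x_def by (intro polys_sum polys_single)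
      show "x i = 0" if "i \<ge> m"
        unfolding x_def using \<mu>(1)[of _ i] that by (intro sum.neutral) fastforce
    qed
    have cx: "coeff_vec m B x w = (if w \<in> W then \<mu> w else (\<lambda>i. 0))" for w
    proof
      fix i
      show "coeff_vec m B x w i = (if w \<in> W then \<mu> w else (\<lambda>i. 0)) i"
      proof (cases "i < m \<and> B i \<subseteq> keys w")
        case True
        have "lookup (single (w' - mexp (B i)) (\<mu> w' i)) (w - mexp (B i)) =
            (if w' = w then \<mu> w' i else 0)" if w': "w' \<in> W" for w'
        proof (cases "\<mu> w' i = 0")
          case False
          then have "w' = mexp (B i) + (w' - mexp (B i))"
            using mexp_add_diff[OF finB] \<mu>(1)[OF w'] by metis
          moreover have "w = mexp (B i) + (w - mexp (B i))"
            using mexp_add_diff[OF finB] True by metis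
          ultimately have "w' - mexp (B i) = w - mexp (B i) \<longleftrightarrow> w' = w" by metis
          then show ?thesis by (simp add: lookup_single)
        next
          case True
          then show ?thesis by (cases "w' = w") simp_all
        qed
        then have "lookup (x i) (w - mexp (B i)) = (\<Sum>w'\<in>W. if w' = w then \<mu> w' i else 0)"
          unfolding x_def lookup_sum by (intro sum.cong) auto
        then show ?thesis using True finW by (simp add: coeff_vec_def)
      next
        case False
        then show ?thesis using \<mu>(1)[of w i] by (auto simp: coeff_vec_def)
      qed
    qed
    have "u = matrix_map m B A g x"
    proof (rule vecs_eqI[OF finA uV])
      show "matrix_map m B A g x \<in> vecs V n"
        by (rule matrix_map_vecs[OF BV fin _ xV]) (use g in blast)
      show "coeff_vec n A u w = coeff_vec n A (matrix_map m B A g x) w" for w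
      proof (cases "w \<in> W")
        case True
        then show ?thesis unfolding cm cx using \<mu>(2) by simp
      next
        case False
        then show ?thesis unfolding cm cx by (simp add: W_def lincomb_def)
      qed
    qed
    then show "u \<in> matrix_map m B A g ` vecs V m" using xV by blast
  qed
qed

section \<open>Existence of a minimal resolution\<close>

lemma mon_degree_add: "mon_degree (k + l) = mon_degree k + mon_degree l"
proof -
  let ?U = "keys k \<union> keys l"
  have ext: "mon_degree m = (\<Sum>x\<in>?U. lookup m x)" if "keys m \<subseteq> ?U" for m
    unfolding mon_degree_def using that by (intro sum.mono_neutral_left) (auto simp: in_keys_iff)
  show ?thesis
    using ext[of k] ext[of l] ext[of "k + l"] by (simp add: keys_add_nat lookup_add sum.distrib)
qed

lemma mon_degree_mexp: "finite T \<Longrightarrow> mon_degree (mexp T) = card T"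
  by (simp add: mon_degree_def lookup_mexp)

lemma homogeneous_part_add:
  assumes "p \<in> homogeneous_part K V t" "q \<in> homogeneous_part K V t"
  shows "p + q \<in> homogeneous_part K V t"
  using assms Poly_Mapping.keys_add[of p q] unfolding homogeneous_part_def by (auto intro: polys_add)

lemma homogeneous_part_sum:
  "(\<And>i. i \<in> G \<Longrightarrow> f i \<in> homogeneous_part K V t) \<Longrightarrow> sum f G \<in> homogeneous_part K V t"
proof (induction G rule: infinite_finite_induct)
  case (insert i G)
  then show ?case by (simp add: homogeneous_part_add)
qed (auto simp: homogeneous_part_def)

lemma homogeneous_part_mult_single:
  assumes p: "p \<in> homogeneous_part K V t" and T: "finite T" "T \<subseteq> V"
  shows "p * single (mexp T) c \<in> homogeneous_part K V (t + int (card T))"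
proof -
  have "single (mexp T) c \<in> polys V" using T by (intro polys_single) simp
  then have 1: "p * single (mexp T) c \<in> polys V"
    using p by (intro polys_mult) (auto simp: homogeneous_part_def)
  have "int (mon_degree k) = t + int (card T)"
    if k: "k \<in> keys (p * single (mexp T) c)" for k
  proof -
    obtain a b where "a \<in> keys p" "b \<in> keys (single (mexp T) c)" "k = a + b"
      using keys_mult[of p "single (mexp T) c"] k by blast
    then show ?thesis
      using p T by (auto simp: homogeneous_part_def mon_degree_add mon_degree_mexp split: if_splits)
  qed
  then show ?thesis using 1 by (simp add: homogeneous_part_def)
qed

lemma matrix_map_add: "matrix_map m B A g (u + w) = matrix_map m B A g u + matrix_map m B A g w"
  by (auto simp: matrix_map_def fun_eq_iff algebra_simps sum.distrib)

lemma matrix_map_smult: "matrix_map m B A g (\<lambda>i. p * u i) = (\<lambda>j. p * matrix_map m B A g u j)"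
  by (auto simp: matrix_map_def fun_eq_iff sum_distrib_left mult.assoc)

lemma to_ext_smult: "to_ext n (\<lambda>j. p * u j) = p \<odot>\<^bsub>free_module (poly_ring K V) n\<^esub> to_ext n u"
  by (auto simp: to_ext_def free_module_def fun_eq_iff)

lemma to_ext_eq_zero_iff:
  assumes "u \<in> vecs V n"
  shows "to_ext n u = \<zero>\<^bsub>free_module (poly_ring K V) n\<^esub> \<longleftrightarrow> u = 0"
  using to_vec_to_ext[OF assms] to_vec_zero[where K = K and V = V] to_ext_zero[where K = K and V = V]
  by metis

definition ideal_system :: "'v set set \<Rightarrow> 'v set \<Rightarrow> (nat \<Rightarrow> 'k::field) set" where
  "ideal_system \<Gamma> T = {c. (\<forall>j. c j \<noteq> 0 \<longrightarrow> j = 0) \<and> (c 0 \<noteq> 0 \<longrightarrow> (\<exists>U\<in>\<Gamma>. U \<subseteq> T))}"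

text \<open>The basis element of \<open>S\<close> has multidegree \<open>{}\<close>; excluding
  \<open>{}\<close> from \<open>\<Gamma>\<close> gives the strict inclusion, i.e. keeps 1 out of the
  ideal.\<close>

lemma squarefree_system_ideal:
  assumes "{} \<notin> \<Gamma>"
  shows "squarefree_system V 1 (\<lambda>_. {}) (ideal_system \<Gamma> :: _ \<Rightarrow> (nat \<Rightarrow> 'k::field) set)"
  unfolding squarefree_system_def
proof (intro conjI allI impI ballI)
  show "coeff_subspace (ideal_system \<Gamma> T :: (nat \<Rightarrow> 'k) set)" for T
    unfolding coeff_subspace_def
  proof (intro conjI ballI allI)
    show "(\<lambda>j. 0) \<in> (ideal_system \<Gamma> T :: (nat \<Rightarrow> 'k) set)" by (simp add: ideal_system_def)
    fix c d :: "nat \<Rightarrow> 'k" and x :: 'k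
    assume cd: "c \<in> ideal_system \<Gamma> T" "d \<in> ideal_system \<Gamma> T"
    have "c j \<noteq> 0 \<or> d j \<noteq> 0" if "c j + x * d j \<noteq> 0" for j using that by auto
    with cd show "(\<lambda>j. c j + x * d j) \<in> ideal_system \<Gamma> T"
      unfolding ideal_system_def by blast
  qed
  show "ideal_system \<Gamma> T \<subseteq> (ideal_system \<Gamma> U :: (nat \<Rightarrow> 'k) set)" if "T \<subseteq> U" for T U
    using that unfolding ideal_system_def by blast
  fix T and c :: "nat \<Rightarrow> 'k" and j assume c: "c \<in> ideal_system \<Gamma> T" "c j \<noteq> 0"
  then have "j = 0" by (simp add: ideal_system_def)
  moreover from this c obtain U where "U \<in> \<Gamma>" "U \<subseteq> T" by (auto simp: ideal_system_def)
  ultimately show "j < 1" "{} \<subset> T" using assms by auto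
qed simp

lemma system_module_ideal: "system_module V 1 (\<lambda>_. {}) (ideal_system \<Gamma>) = vec_ideal V \<Gamma>"
proof -
  have "(\<forall>w. coeff_vec 1 (\<lambda>_. {}) u w \<in> ideal_system \<Gamma> (keys w)) \<longleftrightarrow>
      u 0 \<in> monomial_ideal V \<Gamma>" if "u \<in> vecs V 1" for u :: "nat \<Rightarrow> ('a, 'b) mpoly"
    using vecs_nth[OF that, of 0]
    by (auto simp: ideal_system_def coeff_vec_def monomial_ideal_def mexp_def in_keys_iff)
  then show ?thesis unfolding system_module_def vec_ideal_def by blast
qed

text \<open>Minimal generators of the current syzygies are chosen again and again. Each choice
  yields a squarefree system of relations, which is just what the next choice needs.\<close>

lemma exists_minimal_resolution:
  fixes K :: "'k::field itself" and V :: "'v set"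
  assumes fin: "finite V" and ne: "{} \<notin> \<Gamma>"
  shows "\<exists>b a d \<epsilon>. minimal_graded_free_resolution K V
    (quotient_module (poly_ring K V) (monomial_ideal V \<Gamma>)) (quotient_grading K V (monomial_ideal V \<Gamma>)) b a d \<epsilon>"
proof -
  let ?R = "poly_ring K V" and ?I = "monomial_ideal V \<Gamma> :: ('v, 'k) mpoly set"
  \<comment> \<open>A stage holds the rank, the multidegrees of the basis, the syzygies and the
    matrix into the preceding stage. Stage 0 is \<open>S\<close> with the ideal as its syzygies and
    has no preceding stage.\<close>
  let ?base = "(1, \<lambda>_. {}, ideal_system \<Gamma>, undefined) ::
    nat \<times> (nat \<Rightarrow> 'v set) \<times> ('v set \<Rightarrow> (nat \<Rightarrow> 'k) set) \<times> (nat \<Rightarrow> nat \<Rightarrow> 'k)"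
  have "\<exists>f. \<forall>i. (case f i of (n, A, L, g) \<Rightarrow> squarefree_system V n A L \<and> (i = 0 \<longrightarrow> f i = ?base)) \<and>
      (case f i of (n, A, L, h) \<Rightarrow> case f (Suc i) of (m, B, L', g) \<Rightarrow>
        generates V L m B g \<and> L' = kernel_system m B g)"
  proof (rule dependent_nat_choice)
    show "\<exists>x. case x of (n, A, L, g) \<Rightarrow> squarefree_system V n A L \<and> ((0::nat) = 0 \<longrightarrow> x = ?base)"
      using squarefree_system_ideal[OF ne] by (intro exI[of _ ?base]) auto
    fix x :: "nat \<times> (nat \<Rightarrow> 'v set) \<times> ('v set \<Rightarrow> (nat \<Rightarrow> 'k) set) \<times> (nat \<Rightarrow> nat \<Rightarrow> 'k)" and i :: nat
    assume x: "case x of (n, A, L, g) \<Rightarrow> squarefree_system V n A L \<and> (i = 0 \<longrightarrow> x = ?base)"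
    obtain n A L h where xe: "x = (n, A, L, h)" by (metis prod_cases4)
    have "squarefree_system V n A L" using x unfolding xe by simp
    from exists_minimal_generators[OF fin this]
    obtain m B g where "generates V L m B g" "squarefree_system V m B (kernel_system m B g)"
      by (elim exE conjE)
    then show "\<exists>y. (case y of (n, A, L, g) \<Rightarrow> squarefree_system V n A L \<and> (Suc i = 0 \<longrightarrow> y = ?base)) \<and>
        (case x of (n, A, L, h) \<Rightarrow> case y of (m, B, L', g) \<Rightarrow> generates V L m B g \<and> L' = kernel_system m B g)"
      unfolding xe by (intro exI[of _ "(m, B, kernel_system m B g, g)"]) simp
  qed
  then obtain f where f: "\<forall>i. (case f i of (n, A, L, g) \<Rightarrow> squarefree_system V n A L \<and> (i = 0 \<longrightarrow> f i = ?base)) \<and>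
      (case f i of (n, A, L, h) \<Rightarrow> case f (Suc i) of (m, B, L', g) \<Rightarrow>
        generates V L m B g \<and> L' = kernel_system m B g)" ..
  define b where "b i = fst (f i)" for i
  define A where "A i = fst (snd (f i))" for i
  define L where "L i = fst (snd (snd (f i)))" for i
  define g where "g i = snd (snd (snd (f (Suc i))))" for i
  have sys: "squarefree_system V (b i) (A i) (L i)" for i
    using spec[OF f, of i] by (auto simp: b_def A_def L_def split: prod.splits)
  have gen: "generates V (L i) (b (Suc i)) (A (Suc i)) (g i)"
    and L_Suc: "L (Suc i) = kernel_system (b (Suc i)) (A (Suc i)) (g i)" for i
    using spec[OF f, of i] by (auto simp: b_def A_def L_def g_def split: prod.splits)
  have base: "b 0 = 1" "A 0 = (\<lambda>_. {})" "L 0 = ideal_system \<Gamma>"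
    using spec[OF f, of 0] by (auto simp: b_def A_def L_def split: prod.splits)
  have AV: "A i j \<subseteq> V" for i j using sys by (simp add: squarefree_system_def)
  have finA: "finite (A i j)" for i j using finite_subset[OF AV fin] .
  have gA: "j < b i \<and> A i j \<subset> A (Suc i) k" if "k < b (Suc i)" "g i k j \<noteq> 0" for i j k
  proof -
    have gL: "g i k \<in> L i (A (Suc i) k)" using gen[of i] that by (simp add: generates_def)
    show ?thesis
      using sys[of i, unfolded squarefree_system_def, THEN conjunct2, THEN conjunct2, THEN conjunct2,
          rule_format, OF gL that(2)] .
  qed
  define D where "D i = matrix_map (b (Suc i)) (A (Suc i)) (A i) (g i)" for i
  \<comment> \<open>\<open>D\<close> is indexed by its target and \<open>d\<close> by its source,
    hence the shift.\<close>
  define d where "d i x = to_ext (b (i - 1)) (D (i - 1) (to_vec (b i) x))" for i x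
  define \<epsilon> where "\<epsilon> x = ?I +>\<^bsub>?R\<^esub> x 0" for x :: "nat \<Rightarrow> ('v, 'k) mpoly"
  \<comment> \<open>The total degree of a squarefree multidegree is its cardinality.\<close>
  define a where "a i j = int (card (A i j))" for i j
  let ?F = "\<lambda>i. free_module ?R (b i)"
  have D_vecs: "D i u \<in> vecs V (b i)" if "u \<in> vecs V (b (Suc i))" for i u
    unfolding D_def by (rule matrix_map_vecs[OF AV fin _ that]) (use gA in blast)
  have D_ker: "system_module V (b (Suc i)) (A (Suc i)) (L (Suc i)) = {u \<in> vecs V (b (Suc i)). D i u = 0}" for i
    unfolding L_Suc D_def by (rule matrix_map_kernel[where n = "b i", OF finA fin AV]) (use gA in blast)
  have D_im: "D i ` vecs V (b (Suc i)) = system_module V (b i) (A i) (L i)" for i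
    unfolding D_def by (rule matrix_map_image[OF sys gen fin AV])
  have dmem: "d (Suc i) x \<in> carrier (?F i)" if "x \<in> carrier (?F (Suc i))" for i x
    unfolding d_def using to_ext_mem[where K = K, OF D_vecs[OF to_vec_mem[OF that]]] by simp
  have d_image: "d (Suc i) ` carrier (?F (Suc i)) = to_ext (b i) ` system_module V (b i) (A i) (L i)" for i
  proof -
    have "to_vec (b (Suc i)) ` carrier (?F (Suc i)) = vecs V (b (Suc i))"
    proof (intro equalityI subsetI)
      fix u :: "nat \<Rightarrow> ('v, 'k) mpoly" assume "u \<in> vecs V (b (Suc i))"
      then show "u \<in> to_vec (b (Suc i)) ` carrier (?F (Suc i))"
        using to_vec_to_ext[of u V] to_ext_mem[where K = K] by (metis image_eqI)
    qed (use to_vec_mem[where K = K] in blast)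
    from this[symmetric] show ?thesis unfolding D_im[symmetric] d_def by (simp add: image_image)
  qed
  interpret I: ideal ?I ?R by (rule ideal_monomial_ideal)
  have F0: "x 0 \<in> polys V" if "x \<in> carrier (?F 0)" for x
    using that base(1) by (auto simp: free_module_def)
  have "graded_free_resolution K V (quotient_module ?R ?I) (quotient_grading K V ?I) b a d \<epsilon>"
    unfolding graded_free_resolution_def Let_def
  proof (intro conjI allI)
    show "\<epsilon> \<in> mod_hom ?R (?F 0) (quotient_module ?R ?I)"
      unfolding mod_hom_def
    proof (intro CollectI conjI ballI)
      show "\<epsilon> \<in> carrier (?F 0) \<rightarrow> carrier (quotient_module ?R ?I)"
        using F0 I.a_rcosetsI[OF I.a_subset] by (auto simp: \<epsilon>_def quotient_module_simps)
      fix x y assume xy: "x \<in> carrier (?F 0)" "y \<in> carrier (?F 0)"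
      have "(x \<oplus>\<^bsub>?F 0\<^esub> y) 0 = x 0 + y 0" using base(1) by (simp add: free_module_def)
      then show "\<epsilon> (x \<oplus>\<^bsub>?F 0\<^esub> y) = \<epsilon> x \<oplus>\<^bsub>quotient_module ?R ?I\<^esub> \<epsilon> y"
        using I.a_rcos_sum[of "x 0" "y 0"] F0[OF xy(1)] F0[OF xy(2)]
        by (simp add: \<epsilon>_def quotient_module_simps)
    next
      fix r x assume rx: "r \<in> carrier ?R" "x \<in> carrier (?F 0)"
      have "(r \<odot>\<^bsub>?F 0\<^esub> x) 0 = r * x 0" using base(1) by (simp add: free_module_def)
      then show "\<epsilon> (r \<odot>\<^bsub>?F 0\<^esub> x) = r \<odot>\<^bsub>quotient_module ?R ?I\<^esub> \<epsilon> x"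
        using I.rcoset_mult_add[of r "x 0"] rx(1) F0[OF rx(2)]
        by (simp add: \<epsilon>_def quotient_module_simps)
    qed
    show "d (Suc i) \<in> mod_hom ?R (?F (Suc i)) (?F i)" for i
      unfolding mod_hom_def
    proof (intro CollectI conjI ballI)
      show "d (Suc i) \<in> carrier (?F (Suc i)) \<rightarrow> carrier (?F i)" using dmem by blast
      show "d (Suc i) (x \<oplus>\<^bsub>?F (Suc i)\<^esub> y) = d (Suc i) x \<oplus>\<^bsub>?F i\<^esub> d (Suc i) y" for x y
        by (simp add: d_def to_vec_add D_def matrix_map_add to_ext_add[where K = K and V = V])
      show "d (Suc i) (r \<odot>\<^bsub>?F (Suc i)\<^esub> x) = r \<odot>\<^bsub>?F i\<^esub> d (Suc i) x" for r x
        by (simp add: d_def to_vec_smult D_def matrix_map_smult to_ext_smult[where K = K and V = V])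
    qed
    show "\<epsilon> ` free_grading K V (b 0) (a 0) t \<subseteq> quotient_grading K V ?I t" for t
      using base by (auto simp: \<epsilon>_def free_grading_def quotient_grading_def a_def)
    show "d (Suc i) ` free_grading K V (b (Suc i)) (a (Suc i)) t \<subseteq> free_grading K V (b i) (a i) t" for i t
    proof
      fix y assume "y \<in> d (Suc i) ` free_grading K V (b (Suc i)) (a (Suc i)) t"
      then obtain x where x: "x \<in> free_grading K V (b (Suc i)) (a (Suc i)) t" "y = d (Suc i) x" by blast
      have "D i (to_vec (b (Suc i)) x) j \<in> homogeneous_part K V (t - a i j)" for j
        unfolding D_def matrix_map_def
      proof (rule homogeneous_part_sum)
        fix k assume k: "k \<in> {..<b (Suc i)}"
        let ?s = "single (mexp (A (Suc i) k - A i j)) (g i k j) :: ('v, 'k) mpoly"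
        show "to_vec (b (Suc i)) x k * ?s \<in> homogeneous_part K V (t - a i j)"
        proof (cases "g i k j = 0")
          case True
          then show ?thesis by (simp add: homogeneous_part_def)
        next
          case False
          then have sub: "A i j \<subseteq> A (Suc i) k" using gA k by blast
          have "to_vec (b (Suc i)) x k \<in> homogeneous_part K V (t - a (Suc i) k)"
            using x(1) k by (auto simp: free_grading_def to_vec_def)
          from homogeneous_part_mult_single[OF this, of "A (Suc i) k - A i j" "g i k j"]
          have "to_vec (b (Suc i)) x k * ?s \<in>
              homogeneous_part K V (t - a (Suc i) k + int (card (A (Suc i) k - A i j)))"
            using finA AV by blast
          moreover have "t - a (Suc i) k + int (card (A (Suc i) k - A i j)) = t - a i j"
            using card_Diff_subset[OF finA sub] card_mono[OF finA sub] by (simp add: a_def of_nat_diff)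
          ultimately show ?thesis by simp
        qed
      qed
      then show "y \<in> free_grading K V (b i) (a i) t"
        unfolding x(2) d_def free_grading_def to_ext_def by simp
    qed
    show "\<epsilon> ` carrier (?F 0) = carrier (quotient_module ?R ?I)"
    proof (intro equalityI subsetI)
      fix X assume "X \<in> carrier (quotient_module ?R ?I)"
      then obtain p where p: "p \<in> polys V" "X = ?I +>\<^bsub>?R\<^esub> p"
        by (auto simp: quotient_module_simps A_RCOSETS_defs a_r_coset_def)
      have "(\<lambda>j\<in>{..<b 0}. p) \<in> carrier (?F 0)" using p by (auto simp: free_module_def)
      moreover have "X = \<epsilon> (\<lambda>j\<in>{..<b 0}. p)" using p base by (simp add: \<epsilon>_def)
      ultimately show "X \<in> \<epsilon> ` carrier (?F 0)" by blast
    qed (use F0 I.a_rcosetsI[OF I.a_subset] in \<open>auto simp: \<epsilon>_def quotient_module_simps\<close>)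
    show "a_kernel (?F 0) (quotient_module ?R ?I) \<epsilon> = d 1 ` carrier (?F 1)"
    proof -
      have "a_kernel (?F 0) (quotient_module ?R ?I) \<epsilon> = {x \<in> carrier (?F 0). x 0 \<in> ?I}"
        using coset_eq_iff[where V = V and \<Gamma> = \<Gamma> and K = K and q = 0]
        by (auto simp: a_kernel_def' quotient_module_simps \<epsilon>_def coset_zero)
      also have "\<dots> = to_ext (b 0) ` vec_ideal V \<Gamma>"
      proof (intro equalityI subsetI)
        fix x assume x: "x \<in> {x \<in> carrier (?F 0). x 0 \<in> ?I}"
        then have xc: "x \<in> carrier (?F 0)" by simp
        have "to_vec (b 0) x \<in> vec_ideal V \<Gamma>"
          using x to_vec_mem[where x = x and V = V and n = "b 0" and K = K] base by (simp add: vec_ideal_def to_vec_def)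
        from image_eqI[where f = "to_ext (b 0)" and x = "to_vec (b 0) x", OF to_ext_to_vec[OF xc, symmetric] this]
        show "x \<in> to_ext (b 0) ` vec_ideal V \<Gamma>" .
      next
        fix x :: "nat \<Rightarrow> ('v, 'k) mpoly" assume "x \<in> to_ext (b 0) ` vec_ideal V \<Gamma>"
        then obtain u where "u \<in> vec_ideal V \<Gamma>" "x = to_ext (b 0) u" by blast
        then show "x \<in> {x \<in> carrier (?F 0). x 0 \<in> ?I}"
          using to_ext_mem[where u = u and V = V and n = "b 0" and K = K] base by (simp add: vec_ideal_def to_ext_def)
      qed
      also have "\<dots> = d (Suc 0) ` carrier (?F (Suc 0))"
        unfolding d_image by (simp only: base system_module_ideal)
      finally show ?thesis by simp
    qed
    show "a_kernel (?F (Suc i)) (?F i) (d (Suc i)) = d (Suc (Suc i)) ` carrier (?F (Suc (Suc i)))" for i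
    proof -
      have d0: "d (Suc i) x = \<zero>\<^bsub>?F i\<^esub> \<longleftrightarrow> D i (to_vec (b (Suc i)) x) = 0" if "x \<in> carrier (?F (Suc i))" for x
        using to_ext_eq_zero_iff[where K = K, OF D_vecs[OF to_vec_mem[OF that]]] by (simp add: d_def)
      have "a_kernel (?F (Suc i)) (?F i) (d (Suc i)) = to_ext (b (Suc i)) ` {u \<in> vecs V (b (Suc i)). D i u = 0}"
      proof (intro equalityI subsetI)
        fix x assume "x \<in> a_kernel (?F (Suc i)) (?F i) (d (Suc i))"
        then have x: "x \<in> carrier (?F (Suc i))" "d (Suc i) x = \<zero>\<^bsub>?F i\<^esub>" by (simp_all add: a_kernel_def')
        have "to_vec (b (Suc i)) x \<in> {u \<in> vecs V (b (Suc i)). D i u = 0}"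
          using to_vec_mem[OF x(1)] d0[OF x(1)] x(2) by simp
        from image_eqI[where f = "to_ext (b (Suc i))" and x = "to_vec (b (Suc i)) x", OF to_ext_to_vec[OF x(1), symmetric] this]
        show "x \<in> to_ext (b (Suc i)) ` {u \<in> vecs V (b (Suc i)). D i u = 0}" .
      next
        fix x :: "nat \<Rightarrow> ('v, 'k) mpoly" assume "x \<in> to_ext (b (Suc i)) ` {u \<in> vecs V (b (Suc i)). D i u = 0}"
        then obtain u where u: "u \<in> vecs V (b (Suc i))" "D i u = 0" "x = to_ext (b (Suc i)) u" by blast
        have x: "x \<in> carrier (?F (Suc i))" using to_ext_mem[where K = K, OF u(1)] u(3) by simp
        then show "x \<in> a_kernel (?F (Suc i)) (?F i) (d (Suc i))"
          using d0[OF x] u to_vec_to_ext[OF u(1)] by (simp add: a_kernel_def')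
      qed
      then show ?thesis unfolding d_image D_ker .
    qed
  qed
  moreover have "d (Suc i) ` carrier (?F (Suc i)) \<subseteq> {..<b i} \<rightarrow>\<^sub>E irrelevant_ideal K V" for i
  proof
    fix y assume "y \<in> d (Suc i) ` carrier (?F (Suc i))"
    then obtain x where x: "x \<in> carrier (?F (Suc i))" "y = d (Suc i) x" by blast
    let ?J = "monomial_ideal V ((\<lambda>v. {v}) ` V) :: ('v, 'k) mpoly set"
    have "D i (to_vec (b (Suc i)) x) j \<in> ?J" for j
    proof -
      have "to_vec (b (Suc i)) x k * single (mexp (A (Suc i) k - A i j)) (g i k j) \<in> ?J"
        if k: "k < b (Suc i)" for k
      proof (cases "g i k j = 0")
        case False
        \<comment> \<open>Strictness of the inclusion of multidegrees puts a variable into every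
          nonzero matrix entry; this is minimality.\<close>
        then obtain v where v: "v \<in> A (Suc i) k - A i j" using gA[OF k False] by blast
        have "single (mexp (A (Suc i) k - A i j)) (g i k j) \<in> ?J"
          using v AV[of "Suc i" k] finA by (auto simp: monomial_ideal_def intro!: polys_single)
        then show ?thesis
          using vecs_nth[OF to_vec_mem[OF x(1)]] by (intro monomial_ideal_mult)
      qed simp
      then have "sum (\<lambda>k. to_vec (b (Suc i)) x k * single (mexp (A (Suc i) k - A i j)) (g i k j)) G \<in> ?J"
        if "G \<subseteq> {..<b (Suc i)}" for G
        using that
        by (induction G rule: infinite_finite_induct) (auto intro: monomial_ideal_add)
      then show ?thesis unfolding D_def matrix_map_def by blast
    qed
    then show "y \<in> {..<b i} \<rightarrow>\<^sub>E irrelevant_ideal K V"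
      unfolding x(2) d_def irrelevant_ideal_eq[OF fin] to_ext_def by simp
  qed
  ultimately show ?thesis unfolding minimal_graded_free_resolution_def by blast
qed

section \<open>Projective dimension of edge ideals of chordal graphs\<close>

theorem theorem5p3:
  fixes V :: "'v set" and E :: "'v set set" and K :: "'k::field itself"
  assumes "simple_graph V E" and "chordal E"
  shows "pd_edge_ring K V E = enat (d_strong V E) \<and> d_strong V E = d_semi_strong V E"
proof -
  have fin: "finite V" and ne: "{} \<notin> E" using assms(1) by (auto simp: simple_graph_def)
  obtain r where "perfect_elimination E r"
    using chordal_perfect_elimination[OF assms] by blast
  then have pd: "pd_bound V E (d_strong V E)"
    by (rule pd_bound_perfect_elimination[OF assms(1)])
  let ?M = "quotient_module (poly_ring K V) (monomial_ideal V E)" 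
  let ?gr = "quotient_grading K V (monomial_ideal V E)"
  let ?min = "minimal_graded_free_resolution K V ?M ?gr"
  have upper: "b i = 0" if "?min b a d \<epsilon>" "i > d_strong V E" for b a d \<epsilon> i
  proof (rule minimal_resolution_rank_0[OF _ fin pd that(2)])
    show "graded_free_resolution K V ?M ?gr b a d \<epsilon>"
      using that(1) by (simp add: minimal_graded_free_resolution_def)
    show "d (Suc i) ` carrier (free_module (poly_ring K V) (b (Suc i))) \<subseteq> {..<b i} \<rightarrow>\<^sub>E irrelevant_ideal K V" for i
      using that(1) by (simp add: minimal_graded_free_resolution_def)
  qed
  obtain \<B> where B: "semi_strongly_disjoint V E \<B>" "d_semi_strong V E = card (all_flowers \<B>)"
    using d_semi_strong_attained[OF fin] .
  obtain A where A: "A \<subseteq> V" "\<And>f. f \<in> E \<Longrightarrow> \<not> f \<subseteq> A"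
    "\<And>c. c \<in> V - A \<Longrightarrow> \<exists>a\<in>A. {c, a} \<in> E" "all_flowers \<B> \<subseteq> V - A"
    by (rule semi_strongly_disjoint_maximal_independent[OF assms(1) B(1)]) blast
  have lower: "b (card (V - A)) \<noteq> 0" if "?min b a d \<epsilon>" "card (V - A) > 0" for b a d \<epsilon>
  proof (rule resolution_rank_nonzero[OF _ fin A(1-3) that(2)])
    show "graded_free_resolution K V ?M ?gr b a d \<epsilon>"
      using that(1) by (simp add: minimal_graded_free_resolution_def)
  qed
  obtain b a d \<epsilon> where res: "?min b a d \<epsilon>"
    using exists_minimal_resolution[OF fin ne, of K] by blast
  \<comment> \<open>This closes the circle \<open>|V - A| \<le> d \<le> d' \<le> |V - A|\<close>, so
    equality holds throughout.\<close>
  have "card (V - A) \<le> d_strong V E"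
    using lower[OF res] upper[OF res, of "card (V - A)"] by force
  moreover have "d_semi_strong V E \<le> card (V - A)"
    unfolding B(2) using A(4) fin by (intro card_mono) auto
  moreover have "d_strong V E \<le> d_semi_strong V E"
    by (rule d_strong_le_d_semi_strong[OF assms(1)])
  ultimately have eq: "d_strong V E = d_semi_strong V E" "card (V - A) = d_strong V E" by auto
  have len: "resolution_length b = enat (d_strong V E)" if min: "?min b a d \<epsilon>" for b a d \<epsilon>
    unfolding resolution_length_def
  proof (rule antisym)
    show "(SUP i\<in>{i. b i \<noteq> 0}. enat i) \<le> enat (d_strong V E)"
      using upper[OF min] by (intro SUP_least) (force simp: not_less[symmetric])
    show "enat (d_strong V E) \<le> (SUP i\<in>{i. b i \<noteq> 0}. enat i)"
    proof (cases "d_strong V E = 0")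
      \<comment> \<open>For an empty cover \<open>lower\<close> says nothing, but a bound of 0 is
        trivial.\<close>
      case True
      then show ?thesis by (simp add: zero_enat_def[symmetric])
    next
      case False
      then show ?thesis using lower[OF min] eq(2) by (intro SUP_upper) simp
    qed
  qed
  have "projective_dimension K V ?M ?gr = enat (d_strong V E)"
    unfolding projective_dimension_def
  \<comment> \<open>Uniqueness of the length is immediate, because \<open>len\<close> computes it
    for every minimal resolution.\<close>
  proof (rule the_equality)
    show "\<exists>b a d \<epsilon>. ?min b a d \<epsilon> \<and> enat (d_strong V E) = resolution_length b"
      using res len[OF res] by metis
    show "l = enat (d_strong V E)" if "\<exists>b a d \<epsilon>. ?min b a d \<epsilon> \<and> l = resolution_length b" for l
      using that len by blast
  qed
  then show ?thesis
    using eq(1) by (simp add: pd_edge_ring_def Let_def edge_ideal_eq[OF assms(1)])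
qed

end
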